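(* Let $d\geq 5$ and $2\leq r\leq d-3$ be integers. The group $G_{\mathcal{A}(d,r)}$ of the telescope $\mathcal{A}(d,r)$ is $2$-generated and is a frame in $\prod_{\ell=1}^{\infty}\mathrm{Alt}(X^\ell)\cong\prod_{\ell=1}^{\infty}\mathrm{Alt}(d^\ell)$, where $X$ is the $d$-element set used to define $\mathcal{A}(d,r)$.
   Context: The telescope $\mathcal{A}(d,r)$: let $X=\{x_1,\dots,x_d\}$ be a set with $d$ elements, and let $X^\ell$ be the set of words of length $\ell$ over $X$. For $\ell\geq1$ put $\Omega_\ell=\mathrm{Alt}(X^\ell)$ and for $\ell\leq k$ let $\iota_{\ell,k}\colon\Omega_\ell\to\Omega_k$ be the embedding $\iota_{\ell,k}(\sigma)(vw)=\sigma(v)w$ for $v\in X^\ell$, $w\in X^{k-\ell}$. Let $B=\mathrm{Alt}(\{x_1,\dots,x_r\}\times X)\cong\mathrm{Alt}(rd)$, viewed as the subgroup of $\Omega_2$ fixing all words $x_ix_j$ with $i>r$. For $\ell\geq2$ define $\phi_\ell\colon B\to\Omega_\ell$ by $\phi_\ell(\sigma)(vxy)=v\,\sigma(xy)$ if $v=x_d^{\ell-2}$ and $\phi_\ell(\sigma)(vxy)=vxy$ otherwise, for $v\in X^{\ell-2}$, $x,y\in X$. Then $\mathcal{A}(d,r)=((\Omega_\ell)_{\ell\in\mathbb{N}},(\phi_\ell)_{\ell\geq2})$. The group of the telescope: let $P=\prod_{\ell=1}^\infty\Omega_\ell$ with projections $\pi_\ell$. Let $\Delta_1\colon\Omega_1\to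 P$, $\Delta_1(\omega)=(\omega,\iota_{1,2}(\omega),\iota_{1,3}(\omega),\dots)$. For $g\in B$ let $\tilde g^{[1]}\in P$ be given by $\pi_1(\tilde g^{[1]})=1$ and $\pi_i(\tilde g^{[1]})=\prod_{k=2}^{i}\iota_{k,i}(\phi_k(g))$ for $i>1$ (the factors commute), and let $C^{[1]}=\{\tilde g^{[1]}\mid g\in B\}$. Then $G_{\mathcal{A}(d,r)}=\langle\Delta_1(\Omega_1),C^{[1]}\rangle\leq P$. A frame in a product $\prod_{n=1}^\infty S_n$ of finite groups is a finitely generated subgroup $G$ that contains $\bigoplus_{n=1}^\infty S_n$ and for which the natural map $\widehat G\to\prod_{n=1}^\infty S_n$ from the profinite completion is an isomorphism. *)

theory Defs
  imports "HOL-Algebra.Sym_Groups" "HOL-Algebra.Product_Groups" "HOL-Analysis.Function_Topology"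
begin

section \<open>Profinite completions and frames\<close>

definition finite_index_normal :: "('g, 'm) monoid_scheme \<Rightarrow> 'g set set" where
  "finite_index_normal G = {N. N \<lhd> G \<and> finite (rcosets\<^bsub>G\<^esub> N)}"

text \<open>
  The profinite completion is the inverse limit of the finite quotients of \<^term>\<open>G\<close>. For
  \<^term>\<open>M \<subseteq> N\<close> the transition map from \<^term>\<open>G Mod M\<close> to \<^term>\<open>G Mod N\<close> sends a coset
  \<^term>\<open>M #>\<^bsub>G\<^esub> g\<close> to \<^term>\<open>N <#>\<^bsub>G\<^esub> (M #>\<^bsub>G\<^esub> g)\<close>, which is \<^term>\<open>N #>\<^bsub>G\<^esub> g\<close>.
\<close>

definition profinite_completion ::
  "('g, 'm) monoid_scheme \<Rightarrow> ('g set \<Rightarrow> 'g set) monoid" where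
  "profinite_completion G =
     (product_group (finite_index_normal G) (\<lambda>N. G Mod N))
       \<lparr>carrier := {c \<in> \<Pi>\<^sub>E N\<in>finite_index_normal G. carrier (G Mod N).
          \<forall>M\<in>finite_index_normal G. \<forall>N\<in>finite_index_normal G.
            M \<subseteq> N \<longrightarrow> N <#>\<^bsub>G\<^esub> c M = c N}\<rparr>"

definition profinite_completion_topology ::
  "('g, 'm) monoid_scheme \<Rightarrow> ('g set \<Rightarrow> 'g set) topology" where
  "profinite_completion_topology G =
     subtopology
       (product_topology (\<lambda>N. discrete_topology (carrier (G Mod N))) (finite_index_normal G))
       (carrier (profinite_completion G))"

abbreviation full_product :: "(nat \<Rightarrow> 'b monoid) \<Rightarrow> (nat \<Rightarrow> 'b) monoid" where
  "full_product S \<equiv> product_group {1..} S"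

abbreviation full_product_topology :: "(nat \<Rightarrow> 'b monoid) \<Rightarrow> (nat \<Rightarrow> 'b) topology" where
  "full_product_topology S \<equiv> product_topology (\<lambda>n. discrete_topology (carrier (S n))) {1..}"

text \<open>
  For a subgroup \<^term>\<open>H\<close> of the product, the \<^term>\<open>n\<close>-th projection restricted to \<^term>\<open>H\<close>
  has a kernel \<^term>\<open>K\<close> of finite index and is constant on its cosets. The \<^term>\<open>n\<close>-th
  component of the natural map applies the induced map on \<^term>\<open>H\<close> modulo \<^term>\<open>K\<close> to the
  entry at \<^term>\<open>K\<close> of an element of the completion.
\<close>

definition natural_map ::
  "(nat \<Rightarrow> 'b monoid) \<Rightarrow> (nat \<Rightarrow> 'b) set \<Rightarrow> ((nat \<Rightarrow> 'b) set \<Rightarrow> (nat \<Rightarrow> 'b) set) \<Rightarrow> nat \<Rightarrow> 'b"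
where
  "natural_map S H c =
     (\<lambda>n\<in>{1..}. the_elem
        ((\<lambda>h. h n) ` c (kernel ((full_product S)\<lparr>carrier := H\<rparr>) (S n) (\<lambda>h. h n))))"

text \<open>
  The natural map is required to be an isomorphism of topological groups.
\<close>

definition frame_in :: "(nat \<Rightarrow> 'b monoid) \<Rightarrow> (nat \<Rightarrow> 'b) set \<Rightarrow> bool" where
  "frame_in S H \<longleftrightarrow>
     (\<forall>n\<ge>1. group (S n) \<and> finite (carrier (S n))) \<and>
     subgroup H (full_product S) \<and>
     (\<exists>A. finite A \<and> A \<subseteq> H \<and> generate (full_product S) A = H) \<and>
     carrier (sum_group {1..} S) \<subseteq> H \<and>
     (let G = (full_product S)\<lparr>carrier := H\<rparr> in
        natural_map S H \<in> iso (profinite_completion G) (full_product S) \<and>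
        homeomorphic_map (profinite_completion_topology G) (full_product_topology S)
          (natural_map S H))"


section \<open>The telescope and its group\<close>

definition Alt :: "'b set \<Rightarrow> ('b \<Rightarrow> 'b) monoid" where
  "Alt S = \<lparr>carrier = {p. p permutes S \<and> evenperm p}, mult = (\<circ>), one = id\<rparr>"

definition words :: "'a set \<Rightarrow> nat \<Rightarrow> 'a list set" where
  "words X l = {w. length w = l \<and> set w \<subseteq> X}"

definition \<iota> :: "'a set \<Rightarrow> nat \<Rightarrow> nat \<Rightarrow> ('a list \<Rightarrow> 'a list) \<Rightarrow> 'a list \<Rightarrow> 'a list" where
  "\<iota> X l k \<sigma> u = (if u \<in> words X k then \<sigma> (take l u) @ drop l u else u)"

text \<open>
  The alphabet is given by its enumeration: \<^term>\<open>x\<close> is meant to be injective on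
  \<^term>\<open>{1..d}\<close>.
\<close>

definition \<Omega> :: "(nat \<Rightarrow> 'a) \<Rightarrow> nat \<Rightarrow> nat \<Rightarrow> ('a list \<Rightarrow> 'a list) monoid" where
  "\<Omega> x d l = Alt (words (x ` {1..d}) l)"

definition base_group :: "(nat \<Rightarrow> 'a) \<Rightarrow> nat \<Rightarrow> nat \<Rightarrow> ('a list \<Rightarrow> 'a list) monoid" where
  "base_group x d r = Alt {[x i, x j] | i j. i \<in> {1..r} \<and> j \<in> {1..d}}"

definition phi ::
  "(nat \<Rightarrow> 'a) \<Rightarrow> nat \<Rightarrow> nat \<Rightarrow> ('a list \<Rightarrow> 'a list) \<Rightarrow> 'a list \<Rightarrow> 'a list" where
  "phi x d l \<sigma> u =
     (if u \<in> words (x ` {1..d}) l \<and> take (l - 2) u = replicate (l - 2) (x d)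
      then take (l - 2) u @ \<sigma> (drop (l - 2) u) else u)"

definition \<Delta>\<^sub>1 :: "(nat \<Rightarrow> 'a) \<Rightarrow> nat \<Rightarrow> ('a list \<Rightarrow> 'a list) \<Rightarrow> nat \<Rightarrow> 'a list \<Rightarrow> 'a list" where
  "\<Delta>\<^sub>1 x d \<omega> = (\<lambda>i\<in>{1..}. \<iota> (x ` {1..d}) 1 i \<omega>)"

text \<open>
  For \<^term>\<open>g \<in> carrier (base_group x d r)\<close> with \<^term>\<open>r < d\<close> the factors below have pairwise disjoint
  supports, so they commute and the order of the product is immaterial.
\<close>

definition tilde ::
  "(nat \<Rightarrow> 'a) \<Rightarrow> nat \<Rightarrow> ('a list \<Rightarrow> 'a list) \<Rightarrow> nat \<Rightarrow> 'a list \<Rightarrow> 'a list" where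
  "tilde x d g =
     (\<lambda>i\<in>{1..}. if i = 1 then \<one>\<^bsub>\<Omega> x d 1\<^esub>
        else foldr (\<lambda>k p. \<iota> (x ` {1..d}) k i (phi x d k g) \<otimes>\<^bsub>\<Omega> x d i\<^esub> p) [2..<Suc i] \<one>\<^bsub>\<Omega> x d i\<^esub>)"

definition telescope_group ::
  "(nat \<Rightarrow> 'a) \<Rightarrow> nat \<Rightarrow> nat \<Rightarrow> (nat \<Rightarrow> 'a list \<Rightarrow> 'a list) set" where
  "telescope_group x d r =
     generate (full_product (\<Omega> x d))
       (\<Delta>\<^sub>1 x d ` carrier (\<Omega> x d 1) \<union> tilde x d ` carrier (base_group x d r))"

end

theory Submission
  imports Defs "HOL-Algebra.Multiplicative_Group"
begin

text \<open>
  Put \<open>X = {x\<^sub>1, \<dots>, x\<^sub>d}\<close>. Write \<open>\<Delta>\<^sub>n\<close> for the embedding of \<open>Alt (X\<^sup>n)\<close> into the product that repeats a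
  permutation of the prefixes of length \<open>n\<close> on all levels from \<open>n\<close> on (\<open>spread n\<close>), and let \<open>directed n\<close>
  send \<open>g\<close> in the base group \<open>B\<close> to the product of the copies of \<open>g\<close> along the ray \<open>x\<^sub>d x\<^sub>d \<dots>\<close> that sit
  on the levels after \<open>n\<close>. The group \<open>tele n\<close> generated by both families is the group of the telescope
  for \<open>n = 1\<close>.

  The group \<open>tele n\<close> is the direct product of \<open>Alt (X\<^sup>n)\<close> and \<open>tele (n + 1)\<close>. Indeed a directed element
  is the product of its first copy of \<open>g\<close>, which lives below the words \<open>x\<^sub>d\<dots>x\<^sub>d x\<^sub>a\<close> with \<open>a \<le> r\<close>, and
  the rest, which lives below \<open>x\<^sub>d\<dots>x\<^sub>d\<close>. Since \<open>r \<le> d - 3\<close>, an even permutation can move \<open>x\<^sub>d\<close> out of the way while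
  fixing \<open>x\<^sub>1, \<dots>, x\<^sub>r\<close>, so a commutator of two directed elements, one of them moved, only has
  the first copy of the commutator of the two base elements. As \<open>B\<close> is perfect, all first copies
  belong to \<open>tele n\<close>. Since \<open>r \<ge> 2\<close>, their conjugates generate \<open>\<Delta>\<^sub>n\<^sub>+\<^sub>1 (Alt (X\<^sup>n\<^sup>+\<^sup>1))\<close>
  (\<open>spread_Suc_in_tele\<close>), and the splitting follows (\<open>single_in_tele\<close>, \<open>erase_tele\<close>).

  For the frame property it remains to see that a normal subgroup \<open>N\<close> of finite index contains some
  \<open>tele n\<close>. For large \<open>n\<close> it meets the simple group \<open>\<Delta>\<^sub>n (Alt (X\<^sup>n))\<close> non-trivially, hence contains it.
  For \<open>n \<ge> 2\<close> all words moved by directed elements begin with \<open>x\<^sub>d\<close>, so a directed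
  element commutes with all those moved to another first letter. Modulo \<open>N\<close> such a move does nothing, so
  the directed elements commute modulo \<open>N\<close>, and perfection of \<open>B\<close> puts them into \<open>N\<close>
  (\<open>tele_subset_of_finite_index\<close>).

  For two generators, \<open>tele 2\<close> is treated first. There \<open>Alt (X\<^sup>2)\<close> is generated by a long cycle \<open>\<alpha>\<close> and a double
  transposition \<open>\<beta>\<close>, and \<open>B\<close> by two elements \<open>g, h\<close> of odd order. There is enough room to multiply
  \<open>\<Delta>\<^sub>2 \<beta>\<close> by the directed element of \<open>g\<close> and a moved copy of the directed element of \<open>h\<close> such that the three factors
  have disjoint supports. An odd power of the product recovers \<open>\<Delta>\<^sub>2 \<beta>\<close>, and commutators recover
  the directed elements (\<open>tele_2_generators\<close>). The first level is adjoined by a Goursat argument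
  (\<open>tele_1_generated_by_two\<close>).
\<close>

section \<open>Alternating groups\<close>

lemma mem_carrier_Alt [simp]: "p \<in> carrier (Alt S) \<longleftrightarrow> p permutes S \<and> evenperm p"
  by (simp add: Alt_def)

lemma mult_Alt [simp]: "p \<otimes>\<^bsub>Alt S\<^esub> q = p \<circ> q"
  by (simp add: Alt_def)

lemma one_Alt [simp]: "\<one>\<^bsub>Alt S\<^esub> = id"
  by (simp add: Alt_def)

lemma permutes_imp_permutation: "finite S \<Longrightarrow> p permutes S \<Longrightarrow> permutation p"
  using permutation_permutes by blast

lemma group_Alt:
  assumes "finite S"
  shows "group (Alt S)"
proof (rule groupI)
  fix p assume p: "p \<in> carrier (Alt S)"
  then show "\<exists>q\<in>carrier (Alt S). q \<otimes>\<^bsub>Alt S\<^esub> p = \<one>\<^bsub>Alt S\<^esub>"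
    using assms permutes_imp_permutation[of S p]
    by (intro bexI[of _ "inv' p"]) (auto simp: permutes_inv evenperm_inv permutes_inv_o)
qed (use assms in \<open>auto simp: permutes_compose evenperm_comp permutes_imp_permutation permutes_id fun_eq_iff\<close>)

lemma inv_Alt:
  assumes "finite S" "p permutes S" "evenperm p"
  shows "m_inv (Alt S) p = inv' p"
  using assms permutes_imp_permutation[of S p]
  by (intro group.inv_equality group_Alt) (auto simp: permutes_inv evenperm_inv permutes_inv_o)

lemma finite_carrier_Alt: "finite S \<Longrightarrow> finite (carrier (Alt S))"
  by (rule finite_subset[of _ "{p. p permutes S}"]) (auto simp: finite_permutations)

lemma Alt_pow: "p [^]\<^bsub>Alt S\<^esub> (n::nat) = p ^^ n"
  by (induction n) (simp_all add: nat_pow_def funpow_swap1 fun_eq_iff Alt_def)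

context
  fixes K :: "('b \<Rightarrow> 'b) set" and S
  assumes K: "subgroup K (Alt S)" and fin: "finite S"
begin

lemma Alt_subgroup_permutes: "p \<in> K \<Longrightarrow> p permutes S"
  using subgroup.mem_carrier[OF K] by auto

lemma Alt_subgroup_comp: "p \<in> K \<Longrightarrow> q \<in> K \<Longrightarrow> p \<circ> q \<in> K"
  using subgroup.m_closed[OF K] by auto

lemma Alt_subgroup_inv: "p \<in> K \<Longrightarrow> inv' p \<in> K"
  using subgroup.m_inv_closed[OF K, of p] subgroup.mem_carrier[OF K, of p] fin by (simp add: inv_Alt)

lemma Alt_subgroup_conj: "p \<in> K \<Longrightarrow> q \<in> K \<Longrightarrow> p \<circ> q \<circ> inv' p \<in> K"
  by (simp add: Alt_subgroup_comp Alt_subgroup_inv)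

lemma Alt_subgroup_commutator: "p \<in> K \<Longrightarrow> q \<in> K \<Longrightarrow> p \<circ> q \<circ> inv' p \<circ> inv' q \<in> K"
  by (simp add: Alt_subgroup_comp Alt_subgroup_inv)

lemma Alt_subgroup_funpow: "p \<in> K \<Longrightarrow> p ^^ n \<in> K"
  using subgroup.one_closed[OF K] by (induction n) (auto intro: Alt_subgroup_comp)

end

subsection \<open>Three-cycles\<close>

definition three_cycle :: "'b \<Rightarrow> 'b \<Rightarrow> 'b \<Rightarrow> 'b \<Rightarrow> 'b" where
  "three_cycle p q s = transpose p q \<circ> transpose q s"

lemma three_cycle_apply:
  assumes "distinct [p, q, s]"
  shows "three_cycle p q s z = (if z = p then q else if z = q then s else if z = s then p else z)"
  using assms by (auto simp: three_cycle_def transpose_def)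

lemma three_cycle_rotate: "distinct [p, q, s] \<Longrightarrow> three_cycle p q s = three_cycle q s p"
  by (auto simp: three_cycle_apply fun_eq_iff)

lemma three_cycle_permutes: "{p, q, s} \<subseteq> S \<Longrightarrow> three_cycle p q s permutes S"
  by (auto simp: three_cycle_def intro!: permutes_compose permutes_swap_id)

lemma evenperm_three_cycle: "distinct [p, q, s] \<Longrightarrow> evenperm (three_cycle p q s)"
  by (auto simp: three_cycle_def evenperm_comp evenperm_swap permutation_swap_id)

lemma bij_three_cycle: "bij (three_cycle p q s)"
  by (simp add: three_cycle_def bij_comp)

lemma three_cycle_cubed: "distinct [p, q, s] \<Longrightarrow> three_cycle p q s ^^ 3 = id"
  by (auto simp: three_cycle_apply fun_eq_iff numeral_3_eq_3)

lemma inv_three_cycle: "inv' (three_cycle p q s) = three_cycle s q p"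
  by (rule inv_unique_comp) (auto simp: three_cycle_def fun_eq_iff transpose_commute)

lemma conj_three_cycle:
  fixes f :: "'b \<Rightarrow> 'b"
  assumes "bij f"
  shows "f \<circ> three_cycle p q s \<circ> inv' f = three_cycle (f p) (f q) (f s)"
proof -
  have "f \<circ> three_cycle p q s = three_cycle (f p) (f q) (f s) \<circ> f"
    using assms by (auto simp: three_cycle_def transpose_def fun_eq_iff bij_is_inj inj_eq)
  then show ?thesis
    using assms by (simp add: comp_assoc bij_is_surj surj_iff[THEN iffD1])
qed

text \<open>
  Two permutations whose supports meet in a single point almost commute: the commutator only
  moves that point and its two images. This is how subgroups are shown to contain three-cycles.
\<close>

lemma commutator_eq_three_cycle:
  fixes g h :: "'b \<Rightarrow> 'b"
  assumes "bij g" "bij h" "g c \<noteq> c" "h c \<noteq> c"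
    and meet: "\<And>z. g z \<noteq> z \<Longrightarrow> h z \<noteq> z \<Longrightarrow> z = c"
  shows "g \<circ> h \<circ> inv' g \<circ> inv' h = three_cycle c (g c) (h c)"
    and "distinct [c, g c, h c]"
proof -
  have g: "inv' g (g z) = z" "g (inv' g z) = z" for z
    using assms(1) by (simp_all add: bij_is_inj bij_is_surj surj_f_inv_f)
  have h: "inv' h (h z) = z" "h (inv' h z) = z" for z
    using assms(2) by (simp_all add: bij_is_inj bij_is_surj surj_f_inv_f)
  have n: "g (g c) \<noteq> g c" "h (h c) \<noteq> h c"
    using assms(3,4) g(1) h(1) by metis+
  then have "g c \<noteq> h c" using meet[of "h c"] assms(4) by force
  then show d: "distinct [c, g c, h c]"
    using assms(3,4) by auto
  have gfix: "g z = z" if "h z \<noteq> z" "z \<noteq> c" for z using meet that by blast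
  have hfix: "h z = z" if "g z \<noteq> z" "z \<noteq> c" for z using meet that by blast
  have 1: "g (h c) = h c" by (rule gfix) (metis assms(4) h(1))+
  have 2: "h (g c) = g c" by (rule hfix) (metis assms(3) g(1))+
  have 3: "h (inv' g c) = inv' g c" by (rule hfix) (metis assms(3) g(2))+
  have 4: "g (inv' h c) = inv' h c" by (rule gfix) (metis assms(4) h(2))+
  show "g \<circ> h \<circ> inv' g \<circ> inv' h = three_cycle c (g c) (h c)"
  proof
    fix z
    consider "z = c" | "z = g c" | "z = h c" | "z \<notin> {c, g c, h c}" "h z = z"
      | "z \<notin> {c, g c, h c}" "h z \<noteq> z" by blast
    then have "g (h (inv' g (inv' h z))) = three_cycle c (g c) (h c) z"
    proof cases
      case a: 1
      have "inv' g (inv' h c) = inv' h c" by (metis 4 g(1))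
      then show ?thesis using a d by (auto simp: h three_cycle_apply)
    next
      case a: 2
      have "inv' h (g c) = g c" by (metis 2 h(1))
      then show ?thesis using a d 1 by (auto simp: three_cycle_apply g)
    next
      case a: 3
      then show ?thesis using d 3 by (auto simp: three_cycle_apply h g)
    next
      case a: 4
      then have "inv' h z = z" by (metis h(1))
      moreover have "h (inv' g z) = inv' g z"
        using a hfix[of "inv' g z"] g by (metis insertCI)
      ultimately show ?thesis using a d by (auto simp: three_cycle_apply g)
    next
      case a: 5
      then have "inv' h z \<noteq> c" "h (inv' h z) \<noteq> inv' h z" by (metis h(2) insertCI)+
      then have "g (inv' h z) = inv' h z" using gfix by blast
      then have "inv' g (inv' h z) = inv' h z" by (metis g(1))
      moreover have "g z = z" using a gfix by blast
      ultimately show ?thesis using a d by (auto simp: three_cycle_apply h)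
    qed
    then show "(g \<circ> h \<circ> inv' g \<circ> inv' h) z = three_cycle c (g c) (h c) z" by simp
  qed
qed

text \<open>
  Three-cycles generate: composing an even permutation with a three-cycle that sends \<open>\<sigma> p\<close> back to \<open>p\<close>
  and otherwise uses a third moved point makes the support smaller. The third point exists because
  a transposition is odd.
\<close>

lemma Alt_eqI_three_cycles:
  assumes "finite S" and K: "subgroup K (Alt S)"
    and cyc: "\<And>p q s. {p, q, s} \<subseteq> S \<Longrightarrow> distinct [p, q, s] \<Longrightarrow> three_cycle p q s \<in> K"
  shows "K = carrier (Alt S)"
proof
  have "\<sigma> \<in> K" if "\<sigma> permutes S" "evenperm \<sigma>" for \<sigma>
    using that
  proof (induction "card {z. \<sigma> z \<noteq> z}" arbitrary: \<sigma> rule: less_induct)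
    case less
    have supp: "{z. \<sigma> z \<noteq> z} \<subseteq> S" using less.prems(1) by (auto simp: permutes_def)
    then have fin: "finite {z. \<sigma> z \<noteq> z}" using assms(1) finite_subset by blast
    have inj: "\<sigma> z = \<sigma> z' \<longleftrightarrow> z = z'" for z z'
      using permutes_inj[OF less.prems(1)] by (simp add: inj_eq)
    show ?case
    proof (cases "\<sigma> = id")
      case True
      then show ?thesis using subgroup.one_closed[OF K] by simp
    next
      case False
      then obtain p where p: "\<sigma> p \<noteq> p" by (auto simp: fun_eq_iff)
      define q where "q = \<sigma> p"
      have "\<exists>s. \<sigma> s \<noteq> s \<and> s \<noteq> p \<and> s \<noteq> q"
      proof (rule ccontr)
        assume "\<nexists>s. \<sigma> s \<noteq> s \<and> s \<noteq> p \<and> s \<noteq> q"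
        then have other: "\<And>s. s \<noteq> p \<Longrightarrow> s \<noteq> q \<Longrightarrow> \<sigma> s = s" by blast
        have "\<sigma> q = p" using p other inj unfolding q_def by metis
        then have "\<sigma> z = transpose p q z" for z
          using other[of z] q_def[symmetric] by (cases "z = p"; cases "z = q") simp_all
        then have "\<sigma> = transpose p q" by blast
        then show False using less.prems(2) p q_def[symmetric] evenperm_swap[of p q] by simp
      qed
      then obtain s where s: "\<sigma> s \<noteq> s" "s \<noteq> p" "s \<noteq> q" by blast
      have q: "\<sigma> q \<noteq> q" "q \<noteq> p" using p inj unfolding q_def by auto
      define \<tau> where "\<tau> = three_cycle p s q"
      have d: "distinct [p, s, q]" using s q by auto
      have \<tau>: "\<tau> permutes S" "evenperm \<tau>" "\<tau> \<in> K"
        using supp p s q d cyc[of p s q] unfolding \<tau>_def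
        by (auto intro!: three_cycle_permutes evenperm_three_cycle)
      have \<tau>z: "\<tau> z = z \<longleftrightarrow> z \<notin> {p, q, s}" for z
        using d unfolding \<tau>_def by (auto simp: three_cycle_apply)
      have "(\<tau> \<circ> \<sigma>) z = z" if "\<sigma> z = z" for z
        using that \<tau>z[of z] p q(1) s(1) by auto
      then have "{z. (\<tau> \<circ> \<sigma>) z \<noteq> z} \<subseteq> {z. \<sigma> z \<noteq> z}" by blast
      moreover have "(\<tau> \<circ> \<sigma>) p = p" using d by (auto simp: \<tau>_def three_cycle_apply q_def[symmetric])
      ultimately have "{z. (\<tau> \<circ> \<sigma>) z \<noteq> z} \<subset> {z. \<sigma> z \<noteq> z}" using p by blast
      then have "card {z. (\<tau> \<circ> \<sigma>) z \<noteq> z} < card {z. \<sigma> z \<noteq> z}" using fin psubset_card_mono by blast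
      moreover have "(\<tau> \<circ> \<sigma>) permutes S" "evenperm (\<tau> \<circ> \<sigma>)"
        using \<tau> less.prems assms(1)
        by (auto simp: permutes_compose evenperm_comp permutes_imp_permutation[of S])
      ultimately have "\<tau> \<circ> \<sigma> \<in> K" using less.hyps by blast
      then have "inv' \<tau> \<circ> (\<tau> \<circ> \<sigma>) \<in> K"
        using Alt_subgroup_comp[OF K assms(1)] Alt_subgroup_inv[OF K assms(1)] \<tau>(3) by blast
      moreover have "inv' \<tau> \<circ> (\<tau> \<circ> \<sigma>) = \<sigma>"
        using permutes_inv_o(2)[OF \<tau>(1)] by (simp add: comp_assoc[symmetric])
      ultimately show ?thesis by simp
    qed
  qed
  then show "carrier (Alt S) \<subseteq> K" by auto
  show "K \<subseteq> carrier (Alt S)" by (rule subgroup.subset[OF K])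
qed

text \<open>
  It suffices that any two points lie in a common three-cycle of the subgroup. Given distinct
  \<open>p, q, t\<close>, the subgroup contains some \<open>(p q s)\<close> and some \<open>(s t v)\<close>, and conjugating one by
  the other yields \<open>(p q t)\<close>, in a way that depends on the position of \<open>v\<close>.
\<close>

lemma Alt_eqI_linked:
  assumes "finite S" and K: "subgroup K (Alt S)"
    and link: "\<And>p q. p \<in> S \<Longrightarrow> q \<in> S \<Longrightarrow> p \<noteq> q \<Longrightarrow> \<exists>s. distinct [p, q, s] \<and> three_cycle p q s \<in> K"
  shows "K = carrier (Alt S)"
proof (rule Alt_eqI_three_cycles[OF assms(1) K])
  have inS: "s \<in> S" if "three_cycle p q s \<in> K" "distinct [p, q, s]" for p q s
    using Alt_subgroup_permutes[OF K assms(1) that(1)] that(2)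
    by (auto simp: permutes_def three_cycle_apply)
  note inv = Alt_subgroup_inv[OF K assms(1)]
  fix p q t assume pqt: "{p, q, t} \<subseteq> S" "distinct [p, q, t]"
  then obtain s where s: "distinct [p, q, s]" "three_cycle p q s \<in> K" using link[of p q] by auto
  show "three_cycle p q t \<in> K"
  proof (cases "s = t")
    case False
    then obtain v where v: "distinct [s, t, v]" "three_cycle s t v \<in> K"
      using link[of s t] inS[OF s(2,1)] pqt by auto
    consider "v \<notin> {p, q}" | "v = p" | "v = q" by blast
    then show ?thesis
    proof cases
      case 1
      then show ?thesis
        using Alt_subgroup_conj[OF K assms(1) v(2) s(2)] s(1) v(1) pqt(2)
        by (auto simp: conj_three_cycle[OF bij_three_cycle] three_cycle_apply split: if_splits)
    next
      case 2
      have "three_cycle p t q \<in> K"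
        using 2 Alt_subgroup_conj[OF K assms(1) s(2) v(2)] s(1) v(1) pqt(2)
        by (auto simp: conj_three_cycle[OF bij_three_cycle] three_cycle_apply split: if_splits)
      then have "three_cycle q t p \<in> K" using inv[of "three_cycle p t q"] by (simp add: inv_three_cycle)
      then show ?thesis using three_cycle_rotate[of p q t] pqt(2) by (simp add: eq_commute)
    next
      case 3
      have "three_cycle s q p \<in> K" using inv[OF s(2)] by (simp add: inv_three_cycle)
      from Alt_subgroup_conj[OF K assms(1) this v(2)] have "three_cycle q t p \<in> K"
        using 3 s(1) v(1) pqt(2)
        by (auto simp: conj_three_cycle[OF bij_three_cycle] three_cycle_apply split: if_splits)
      then show ?thesis using three_cycle_rotate[of p q t]  pqt(2) by (simp add: eq_commute)
    qed
  qed (use s in simp)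
qed

lemma evenperm_funpow: "permutation p \<Longrightarrow> evenperm (p ^^ n) \<longleftrightarrow> evenperm p \<or> even n"
  by (induction n) (auto simp: evenperm_comp permutation_funpow)

lemma evenperm_of_odd_order: "permutation p \<Longrightarrow> p ^^ n = id \<Longrightarrow> odd n \<Longrightarrow> evenperm p"
  using evenperm_funpow[of p n] by simp

text \<open>
  Three-cycles have odd order, hence so have their images. A homomorphism into the permutations
  of a finite set therefore preserves evenness without any count of transpositions.
\<close>

lemma evenperm_hom_image:
  assumes "finite S" "finite T"
    and perm: "\<And>p. p permutes S \<Longrightarrow> evenperm p \<Longrightarrow> f p permutes T"
    and comp: "\<And>p q. p permutes S \<Longrightarrow> q permutes S \<Longrightarrow> f (p \<circ> q) = f p \<circ> f q"
    and id: "f id = id"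
    and p: "p permutes S" "evenperm p"
  shows "evenperm (f p)"
proof -
  define K where "K = {p \<in> carrier (Alt S). evenperm (f p)}"
  interpret group "Alt S" by (rule group_Alt[OF assms(1)])
  have fperm: "permutation (f p)" if "p \<in> carrier (Alt S)" for p
    using that perm assms(2) permutes_imp_permutation[of T] by auto
  have "subgroup K (Alt S)"
  proof (rule subgroupI)
    show "inv\<^bsub>Alt S\<^esub> a \<in> K" if "a \<in> K" for a
    proof -
      have a: "a permutes S" "evenperm a" "evenperm (f a)" using that by (auto simp: K_def)
      have a': "inv' a permutes S" "evenperm (inv' a)"
        using a assms(1) permutes_imp_permutation[of S a] by (auto simp: permutes_inv evenperm_inv)
      have "f (inv' a) \<circ> f a = id" using comp[OF a'(1) a(1)] permutes_inv_o(2)[OF a(1)] id by simp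
      then have "evenperm (f (inv' a) \<circ> f a)" by simp
      then have "evenperm (f (inv' a))" using a a' fperm by (simp add: evenperm_comp)
      then show ?thesis using a a' assms(1) by (simp add: K_def inv_Alt)
    qed
    show "a \<otimes>\<^bsub>Alt S\<^esub> b \<in> K" if "a \<in> K" "b \<in> K" for a b
      using that m_closed[of a b] by (auto simp: K_def comp evenperm_comp fperm)
  qed (use id in \<open>auto simp: K_def permutes_id intro!: exI[of _ id]\<close>)
  moreover have "three_cycle p q s \<in> K" if "{p, q, s} \<subseteq> S" "distinct [p, q, s]" for p q s
  proof -
    define \<tau> where "\<tau> = three_cycle p q s"
    have \<tau>: "\<tau> permutes S" "evenperm \<tau>"
      unfolding \<tau>_def using that by (auto intro: three_cycle_permutes evenperm_three_cycle)
    have "f \<tau> ^^ n = f (\<tau> ^^ n)" for n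
      using \<tau> by (induction n) (auto simp: id comp permutes_funpow)
    then have "f \<tau> ^^ 3 = id" using three_cycle_cubed[OF that(2)] id by (simp add: \<tau>_def)
    then have "evenperm (f \<tau>)" using evenperm_of_odd_order[of "f \<tau>" 3] fperm \<tau> by simp
    then show ?thesis using \<tau> by (simp add: K_def \<tau>_def)
  qed
  ultimately have "K = carrier (Alt S)" by (rule Alt_eqI_three_cycles[OF assms(1)])
  then have "p \<in> K" using p by simp
  then show ?thesis by (simp add: K_def)
qed

subsection \<open>Double transitivity and simplicity\<close>

lemma ex_not_in_of_card_less:
  assumes "finite F" "card F < card S"
  obtains s where "s \<in> S" "s \<notin> F"
  using assms card_mono[of F S] by (meson leD subsetI)

text \<open>
  A product of at most two transpositions does this; its sign is corrected by a transposition of two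
  points away from the targets.
\<close>

lemma Alt_two_transitive:
  assumes "finite S" "card S \<ge> 4" "{p, q, p', q'} \<subseteq> S" "p \<noteq> q" "p' \<noteq> q'"
  obtains \<sigma> where "\<sigma> permutes S" "evenperm \<sigma>" "\<sigma> p = p'" "\<sigma> q = q'"
proof -
  define \<rho> where "\<rho> = transpose (transpose p p' q) q' \<circ> transpose p p'"
  have inS: "transpose p p' q \<in> S" and ne: "transpose p p' q \<noteq> p'"
    using assms(3,4) by (auto simp: transpose_def)
  have \<rho>: "\<rho> permutes S" "\<rho> p = p'" "\<rho> q = q'"
    using assms(3,5) ne inS by (auto simp: \<rho>_def intro!: permutes_compose permutes_swap_id)
  have "card {p', q'} < card S" using assms(2) by (auto simp: card_insert_if)
  then obtain s where s: "s \<in> S" "s \<notin> {p', q'}"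
    using ex_not_in_of_card_less[of "{p', q'}" S] by blast
  have "card {p', q', s} < card S" using assms(2) by (auto simp: card_insert_if)
  then obtain t where t: "t \<in> S" "t \<notin> {p', q', s}"
    using ex_not_in_of_card_less[of "{p', q', s}" S] by blast
  have st: "s \<in> S" "t \<in> S" "s \<noteq> t" "s \<notin> {p', q'}" "t \<notin> {p', q'}" using s t by auto
  show ?thesis
  proof (cases "evenperm \<rho>")
    case True
    then show ?thesis using that \<rho> by blast
  next
    case False
    have "evenperm (transpose s t \<circ> \<rho>)"
      using False \<rho>(1) assms(1) st(3) permutes_imp_permutation[of S \<rho>]
      by (simp add: evenperm_comp evenperm_swap permutation_swap_id)
    moreover have "(transpose s t \<circ> \<rho>) permutes S"
      using \<rho>(1) st by (intro permutes_compose permutes_swap_id)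
    ultimately show ?thesis using that[of "transpose s t \<circ> \<rho>"] \<rho> st by auto
  qed
qed

text \<open>
  By double transitivity the conjugates of a single three-cycle already link any two points.
\<close>

lemma Alt_normal_containing_three_cycle:
  assumes "finite S" "card S \<ge> 4" and N: "subgroup N (Alt S)"
    and normal: "\<And>\<sigma> \<nu>. \<sigma> permutes S \<Longrightarrow> evenperm \<sigma> \<Longrightarrow> \<nu> \<in> N \<Longrightarrow> \<sigma> \<circ> \<nu> \<circ> inv' \<sigma> \<in> N"
    and cyc: "three_cycle p q s \<in> N" "distinct [p, q, s]"
  shows "N = carrier (Alt S)"
proof (rule Alt_eqI_linked[OF assms(1) N])
  fix p' q' assume p'q': "p' \<in> S" "q' \<in> S" "p' \<noteq> q'"
  have "{p, q} \<subseteq> S"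
    using Alt_subgroup_permutes[OF N assms(1) cyc(1)] cyc(2)
    by (auto simp: permutes_def three_cycle_apply)
  then obtain \<sigma> where \<sigma>: "\<sigma> permutes S" "evenperm \<sigma>" "\<sigma> p = p'" "\<sigma> q = q'"
    using Alt_two_transitive[OF assms(1,2), of p q p' q'] p'q' cyc(2) by auto
  have "three_cycle p' q' (\<sigma> s) \<in> N"
    using normal[OF \<sigma>(1,2) cyc(1)] \<sigma> by (simp add: conj_three_cycle permutes_bij)
  moreover have "distinct [p', q', \<sigma> s]"
    using \<sigma>(3,4) cyc(2) permutes_inj[OF \<sigma>(1)] by (auto simp: inj_eq)
  ultimately show "\<exists>s. distinct [p', q', s] \<and> three_cycle p' q' s \<in> N" by blast
qed

text \<open>
  A commutator of a non-trivial element \<open>\<nu>\<close> of \<open>N\<close> with a three-cycle moves at most five points.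
  With two more points available, a second three-cycle meets this support in one point.
\<close>

lemma Alt_simple:
  assumes "finite S" "card S \<ge> 7" and N: "subgroup N (Alt S)"
    and normal: "\<And>\<sigma> \<nu>. \<sigma> permutes S \<Longrightarrow> evenperm \<sigma> \<Longrightarrow> \<nu> \<in> N \<Longrightarrow> \<sigma> \<circ> \<nu> \<circ> inv' \<sigma> \<in> N"
    and \<nu>: "\<nu> \<in> N" "\<nu> \<noteq> id"
  shows "N = carrier (Alt S)"
proof -
  have comm: "\<rho> \<circ> \<sigma> \<circ> inv' \<rho> \<circ> inv' \<sigma> \<in> N"
    if "\<rho> \<in> N" "\<sigma> permutes S" "evenperm \<sigma>" for \<rho> \<sigma>
    using Alt_subgroup_comp[OF N assms(1) that(1) normal[OF that(2,3) Alt_subgroup_inv[OF N assms(1) that(1)]]]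
    by (simp add: comp_assoc)
  have \<nu>S: "\<nu> permutes S" using Alt_subgroup_permutes[OF N assms(1) \<nu>(1)] .
  obtain p where p: "\<nu> p \<noteq> p" using \<nu>(2) by (auto simp: fun_eq_iff)
  define q where "q = \<nu> p"
  have "card {p, q, \<nu> q} \<le> 3" by (simp add: card_insert_if)
  then have "card {p, q, \<nu> q} < card S" using assms(2) by linarith
  then obtain s where s: "s \<in> S" "s \<notin> {p, q, \<nu> q}"
    using ex_not_in_of_card_less[of "{p, q, \<nu> q}" S] by blast
  have pS: "p \<in> S" "q \<in> S" "\<nu> q \<in> S"
    using p \<nu>S permutes_in_image[OF \<nu>S] by (auto simp: q_def permutes_def)
  have d: "distinct [p, q, s]" using p s by (auto simp: q_def)
  define \<tau> where "\<tau> = three_cycle p q s"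
  have \<tau>: "\<tau> permutes S" "evenperm \<tau>"
    unfolding \<tau>_def using d pS s by (auto intro: three_cycle_permutes evenperm_three_cycle)
  define \<rho> where "\<rho> = \<nu> \<circ> \<tau> \<circ> inv' \<nu> \<circ> inv' \<tau>"
  have \<rho>N: "\<rho> \<in> N" unfolding \<rho>_def by (rule comm[OF \<nu>(1) \<tau>])
  have \<rho>eq: "\<rho> = three_cycle q (\<nu> q) (\<nu> s) \<circ> three_cycle s q p"
    using conj_three_cycle[OF permutes_bij[OF \<nu>S], of p q s] inv_three_cycle[of p q s]
    by (simp add: \<rho>_def \<tau>_def q_def)
  have d': "distinct [q, \<nu> q, \<nu> s]"
    using d permutes_inj[OF \<nu>S] by (auto simp: q_def inj_eq)
  have "\<rho> s = \<nu> q" unfolding \<rho>eq using d d' by (auto simp: three_cycle_apply)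
  then have \<rho>s: "\<rho> s \<noteq> s" using s by auto
  define F where "F = {p, q, s, \<nu> q, \<nu> s}"
  have F: "z \<in> F" if "\<rho> z \<noteq> z" for z
    using that d d' unfolding \<rho>eq F_def by (auto simp: three_cycle_apply split: if_splits)
  have cF: "card F \<le> 5" "finite F" unfolding F_def by (simp_all add: card_insert_if)
  then have "card F < card S" "card (insert f F) < card S" for f
    using assms(2) by (auto simp: card_insert_if)
  then obtain f1 f2 where f1: "f1 \<in> S" "f1 \<notin> F" and f2: "f2 \<in> S" "f2 \<notin> insert f1 F"
    using ex_not_in_of_card_less cF(2) by (metis finite_insert)
  note f = f1 f2
  define \<tau>' where "\<tau>' = three_cycle s f1 f2"
  have dd: "distinct [s, f1, f2]" using f by (auto simp: F_def)
  have \<tau>': "\<tau>' permutes S" "evenperm \<tau>'"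
    unfolding \<tau>'_def using dd f s by (auto intro: three_cycle_permutes evenperm_three_cycle)
  have \<rho>S: "\<rho> permutes S" using Alt_subgroup_permutes[OF N assms(1) \<rho>N] .
  have "\<tau>' s \<noteq> s" using dd by (auto simp: \<tau>'_def three_cycle_apply)
  moreover have "z = s" if "\<rho> z \<noteq> z" "\<tau>' z \<noteq> z" for z
    using F[OF that(1)] that(2) dd f by (auto simp: \<tau>'_def three_cycle_apply split: if_splits)
  ultimately have "\<rho> \<circ> \<tau>' \<circ> inv' \<rho> \<circ> inv' \<tau>' = three_cycle s (\<rho> s) (\<tau>' s)" "distinct [s, \<rho> s, \<tau>' s]"
    using commutator_eq_three_cycle[OF permutes_bij[OF \<rho>S] permutes_bij[OF \<tau>'(1)] \<rho>s] by blast+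
  then show ?thesis
    using Alt_normal_containing_three_cycle[OF assms(1) _ N normal] comm[OF \<rho>N \<tau>'] assms(2)
    by simp
qed

text \<open>
  Two three-cycles with one common point have a three-cycle as commutator, and a subgroup containing
  all commutators is normal.
\<close>

lemma Alt_perfect:
  assumes "finite S" "card S \<ge> 7" and L: "subgroup L (Alt S)"
    and comm: "\<And>\<sigma> \<tau>. \<sigma> \<in> carrier (Alt S) \<Longrightarrow> \<tau> \<in> carrier (Alt S) \<Longrightarrow> \<sigma> \<circ> \<tau> \<circ> inv' \<sigma> \<circ> inv' \<tau> \<in> L"
  shows "L = carrier (Alt S)"
proof -
  have normal: "\<sigma> \<circ> \<nu> \<circ> inv' \<sigma> \<in> L" if "\<sigma> permutes S" "evenperm \<sigma>" "\<nu> \<in> L" for \<sigma> \<nu>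
  proof -
    have "\<nu> \<in> carrier (Alt S)" using subgroup.subset[OF L] that by blast
    then have "\<sigma> \<circ> \<nu> \<circ> inv' \<sigma> \<circ> inv' \<nu> \<circ> \<nu> \<in> L"
      using comm[of \<sigma> \<nu>] that Alt_subgroup_comp[OF L assms(1)] by auto
    moreover have "inv' \<nu> \<circ> \<nu> = id"
      using Alt_subgroup_permutes[OF L assms(1) that(3)] permutes_inv_o(2) by blast
    ultimately show ?thesis by (simp add: comp_assoc)
  qed
  obtain xs where xs: "distinct xs" "set xs = S" using assms(1) finite_distinct_list by blast
  then have "length xs \<ge> 5" using assms(2) distinct_card[of xs] by auto
  then obtain p q s t u ys where "xs = p # q # s # t # u # ys"
    by (auto simp: numeral_eq_Suc Suc_le_length_iff)
  then have d: "distinct [p, q, s, t, u]" "{p, q, s, t, u} \<subseteq> S" using xs by auto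
  let ?g = "three_cycle p q s" and ?h = "three_cycle p t u"
  have "?g \<circ> ?h \<circ> inv' ?g \<circ> inv' ?h = three_cycle p (?g p) (?h p)"
    by (rule commutator_eq_three_cycle(1)[OF bij_three_cycle bij_three_cycle])
       (use d in \<open>auto simp: three_cycle_apply split: if_splits\<close>)
  then have "three_cycle p q t \<in> L"
    using comm[of ?g ?h] d by (auto simp: three_cycle_apply three_cycle_permutes evenperm_three_cycle)
  then show ?thesis
    using Alt_normal_containing_three_cycle[OF assms(1) _ L normal, of p q t] assms(2) d by auto
qed

subsection \<open>Generation by two elements\<close>

text \<open>
  Lying in a common three-cycle of \<open>K\<close> is a transitive relation, so it is enough to connect
  every point with one fixed point.
\<close>

definition linked :: "('b \<Rightarrow> 'b) set \<Rightarrow> 'b \<Rightarrow> 'b \<Rightarrow> bool" where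
  "linked K p q \<longleftrightarrow> p = q \<or> (\<exists>s. distinct [p, q, s] \<and> three_cycle p q s \<in> K)"

context
  fixes K :: "('b \<Rightarrow> 'b) set" and S
  assumes K: "subgroup K (Alt S)" and fin: "finite S"
begin

lemma linked_sym: "linked K p q \<Longrightarrow> linked K q p"
  unfolding linked_def
proof (elim disjE exE conjE)
  fix s assume d: "distinct [p, q, s]" and "three_cycle p q s \<in> K"
  then have "three_cycle s q p \<in> K"
    using Alt_subgroup_inv[OF K fin] by (metis inv_three_cycle)
  moreover have "three_cycle s q p = three_cycle q p s"
    by (rule three_cycle_rotate) (use d in auto)
  ultimately show "q = p \<or> (\<exists>s. distinct [q, p, s] \<and> three_cycle q p s \<in> K)"
    using d by auto
qed auto

lemma linked_trans:
  assumes "linked K p q" "linked K q t"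
  shows "linked K p t"
proof (cases "p = q \<or> q = t \<or> p = t")
  case True
  then show ?thesis using assms by (auto simp: linked_def)
next
  case False
  then obtain s v where s: "distinct [p, q, s]" "three_cycle p q s \<in> K"
    and v: "distinct [q, t, v]" "three_cycle q t v \<in> K"
    using assms by (auto simp: linked_def)
  have c: "three_cycle p t (three_cycle q t v s) \<in> K" if "v \<noteq> p"
    using Alt_subgroup_conj[OF K fin v(2) s(2)] that v(1) False
    by (simp add: conj_three_cycle[OF bij_three_cycle]) (simp add: three_cycle_apply)
  show ?thesis
  proof (cases "v = p")
    case True
    have "three_cycle q t p = three_cycle t p q"
      by (rule three_cycle_rotate) (use v True in auto)
    then have "linked K t p" using v True by (auto simp: linked_def)
    then show ?thesis by (rule linked_sym)
  next
    case False
    have "distinct [p, t, three_cycle q t v s]"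
      using False s(1) v(1) \<open>\<not> (p = q \<or> q = t \<or> p = t)\<close> by (auto simp: three_cycle_apply)
    then show ?thesis using c[OF False] by (auto simp: linked_def)
  qed
qed

lemma Alt_eqI_linked_to_base:
  assumes "\<And>z. z \<in> S \<Longrightarrow> linked K c z"
  shows "K = carrier (Alt S)"
proof (rule Alt_eqI_linked[OF fin K])
  fix p q assume "p \<in> S" "q \<in> S" "p \<noteq> q"
  then have "linked K p q" using assms linked_sym linked_trans by blast
  with \<open>p \<noteq> q\<close> show "\<exists>s. distinct [p, q, s] \<and> three_cycle p q s \<in> K"
    by (auto simp: linked_def)
qed

text \<open>
  If the support of \<open>\<beta>\<close> meets its image under \<open>\<alpha>\<close> in one point \<open>c\<close>, then the commutator of
  \<open>\<beta>\<close> with \<open>\<alpha> \<beta> \<alpha>\<^sup>-\<^sup>1\<close> is a three-cycle through \<open>c\<close> and \<open>\<beta> c\<close>. Its conjugates by powers of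
  \<open>\<alpha>\<close> connect all points in two situations: \<open>\<alpha>\<close> fixes \<open>c\<close> and is transitive elsewhere, or
  \<open>\<alpha>\<close> is transitive and \<open>c\<close> and \<open>\<beta> c\<close> are neighbours on its cycle.
\<close>

lemma Alt_eqI_transitive_meeting:
  assumes \<alpha>: "\<alpha> \<in> K" and \<beta>: "\<beta> \<in> K" and c: "\<beta> c \<noteq> c" "\<gamma> c \<noteq> c"
    and \<gamma>: "\<gamma> = \<alpha> \<circ> \<beta> \<circ> inv' \<alpha>"
    and meet: "\<And>z. \<beta> z \<noteq> z \<Longrightarrow> \<gamma> z \<noteq> z \<Longrightarrow> z = c"
    and trans: "\<alpha> c = c \<and> (\<forall>z\<in>S. z = c \<or> (\<exists>n. z = (\<alpha> ^^ n) (\<beta> c))) \<or>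
      \<alpha> (\<beta> c) = c \<and> (\<forall>z\<in>S. \<exists>n. z = (\<alpha> ^^ n) c)"
  shows "K = carrier (Alt S)" "\<alpha> \<circ> \<beta> \<noteq> \<beta> \<circ> \<alpha>"
proof -
  have bij: "bij \<sigma>" if "\<sigma> \<in> K" for \<sigma>
    using that Alt_subgroup_permutes[OF K fin] permutes_bij by blast
  have \<gamma>K: "\<gamma> \<in> K" unfolding \<gamma> by (rule Alt_subgroup_conj[OF K fin \<alpha> \<beta>])
  have cyc: "\<beta> \<circ> \<gamma> \<circ> inv' \<beta> \<circ> inv' \<gamma> = three_cycle c (\<beta> c) (\<gamma> c)" and d: "distinct [c, \<beta> c, \<gamma> c]"
    using commutator_eq_three_cycle[OF bij[OF \<beta>] bij[OF \<gamma>K] c meet] by blast+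
  have cycK: "three_cycle c (\<beta> c) (\<gamma> c) \<in> K"
    using Alt_subgroup_commutator[OF K fin \<beta> \<gamma>K] cyc by simp
  have link: "linked K ((\<alpha> ^^ n) c) ((\<alpha> ^^ n) (\<beta> c))" for n
  proof -
    have \<alpha>n: "\<alpha> ^^ n \<in> K" by (rule Alt_subgroup_funpow[OF K fin \<alpha>])
    have "three_cycle ((\<alpha> ^^ n) c) ((\<alpha> ^^ n) (\<beta> c)) ((\<alpha> ^^ n) (\<gamma> c)) \<in> K"
      using Alt_subgroup_conj[OF K fin \<alpha>n cycK] by (simp add: conj_three_cycle[OF bij[OF \<alpha>n]])
    moreover have "distinct [(\<alpha> ^^ n) c, (\<alpha> ^^ n) (\<beta> c), (\<alpha> ^^ n) (\<gamma> c)]"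
      using d bij_is_inj[OF bij[OF \<alpha>n]] by (simp add: inj_eq)
    ultimately show ?thesis by (auto simp: linked_def)
  qed
  show "K = carrier (Alt S)"
  proof (rule Alt_eqI_linked_to_base)
    fix z assume z: "z \<in> S"
    from trans show "linked K c z"
    proof
      assume a: "\<alpha> c = c \<and> (\<forall>z\<in>S. z = c \<or> (\<exists>n. z = (\<alpha> ^^ n) (\<beta> c)))"
      have "(\<alpha> ^^ n) c = c" for n using a by (induction n) auto
      then show ?thesis using a z link by (auto simp: linked_def[of K c c])
    next
      assume a: "\<alpha> (\<beta> c) = c \<and> (\<forall>z\<in>S. \<exists>n. z = (\<alpha> ^^ n) c)"
      have "linked K c ((\<alpha> ^^ n) c)" for n
      proof (induction n)
        case (Suc n)
        have "(\<alpha> ^^ Suc n) (\<beta> c) = (\<alpha> ^^ n) c" using a by (simp del: funpow.simps add: funpow_Suc_right)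
        then show ?case using Suc link[of "Suc n"] linked_sym linked_trans by metis
      qed (simp add: linked_def)
      then show ?thesis using a z by metis
    qed
  qed
  show "\<alpha> \<circ> \<beta> \<noteq> \<beta> \<circ> \<alpha>"
  proof
    assume "\<alpha> \<circ> \<beta> = \<beta> \<circ> \<alpha>"
    then have "\<gamma> = \<beta>"
      using \<gamma> bij_is_surj[OF bij[OF \<alpha>]] by (simp add: comp_assoc surj_iff)
    then show False using d by simp
  qed
qed

end

text \<open>
  The cycle along all points of a list of odd length; for even length the head is left fixed,
  which makes the permutation even.
\<close>

definition odd_cycle :: "'b list \<Rightarrow> 'b \<Rightarrow> 'b" where
  "odd_cycle xs = cycle_of_list (if odd (length xs) then xs else tl xs)"

lemma cycle_of_list_funpow_nth:
  assumes "distinct cs" "i < length cs"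
  shows "(cycle_of_list cs ^^ n) (cs ! i) = cs ! ((n + i) mod length cs)"
  using cyclic_rotation[OF assms(1), of n] assms(2) by (metis length_map nth_map nth_rotate)

lemma cycle_of_list_nth:
  assumes "distinct cs" "Suc i < length cs"
  shows "cycle_of_list cs (cs ! i) = cs ! Suc i"
  using cycle_of_list_funpow_nth[OF assms(1), of i 1] assms(2) by simp

lemma cycle_of_list_funpow_length:
  assumes "distinct cs"
  shows "cycle_of_list cs ^^ length cs = id"
proof
  fix z
  show "(cycle_of_list cs ^^ length cs) z = id z"
  proof (cases "z \<in> set cs")
    case True
    then show ?thesis using cycle_of_list_funpow_nth[OF assms, of _ "length cs"]
      by (auto simp: in_set_conv_nth)
  next
    case False
    then have "(cycle_of_list cs ^^ n) z = z" for n by (induction n) (auto simp: id_outside_supp)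
    then show ?thesis by simp
  qed
qed

lemma cycle_of_list_transitive:
  assumes "distinct cs" "a \<in> set cs" "b \<in> set cs"
  shows "\<exists>n. b = (cycle_of_list cs ^^ n) a"
proof -
  obtain i j where ij: "i < length cs" "j < length cs" "a = cs ! i" "b = cs ! j"
    using assms by (metis in_set_conv_nth)
  have "b = (cycle_of_list cs ^^ (j + length cs - i)) a"
    using cycle_of_list_funpow_nth[OF assms(1) ij(1), of "j + length cs - i"] ij by simp
  then show ?thesis by blast
qed

lemma odd_cycle_properties:
  assumes "distinct xs" "length xs \<ge> 2"
  shows "odd_cycle xs permutes set xs" "evenperm (odd_cycle xs)"
    and "\<exists>m. odd m \<and> m \<le> length xs \<and> odd_cycle xs ^^ m = id"
    and "0 < k \<Longrightarrow> k < length xs - 1 \<Longrightarrow> odd_cycle xs ^^ k \<noteq> id"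
proof -
  define cs where "cs = (if odd (length xs) then xs else tl xs)"
  have cs: "distinct cs" "odd (length cs)" "set cs \<subseteq> set xs" "length xs - 1 \<le> length cs" "length cs \<le> length xs"
    using assms by (auto simp: cs_def distinct_tl intro: list.set_sel(2))
  have eq: "odd_cycle xs = cycle_of_list cs" by (simp add: odd_cycle_def cs_def)
  show "odd_cycle xs permutes set xs"
    unfolding eq using cs(3) permutes_subset[OF cycle_permutes] by blast
  show "evenperm (odd_cycle xs)"
    unfolding eq using evenperm_of_odd_order[OF permutation_of_cycle cycle_of_list_funpow_length[OF cs(1)] cs(2)] .
  show "\<exists>m. odd m \<and> m \<le> length xs \<and> odd_cycle xs ^^ m = id"
    unfolding eq using cs cycle_of_list_funpow_length[OF cs(1)] by blast
  show "odd_cycle xs ^^ k \<noteq> id" if "0 < k" "k < length xs - 1"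
  proof -
    have "(odd_cycle xs ^^ k) (cs ! 0) = cs ! k"
      unfolding eq using cycle_of_list_funpow_nth[OF cs(1), of 0 k] that cs(4) by (cases cs) auto
    moreover have "cs ! k \<noteq> cs ! 0"
      using that cs(1,4) by (subst nth_eq_iff_index_eq) auto
    ultimately show ?thesis by auto
  qed
qed

lemma odd_cycle_apply:
  assumes "distinct xs"
  shows "Suc i < length xs \<Longrightarrow> 0 < i \<Longrightarrow> odd_cycle xs (xs ! i) = xs ! Suc i"
    and "even (length xs) \<Longrightarrow> xs \<noteq> [] \<Longrightarrow> odd_cycle xs (xs ! 0) = xs ! 0"
    and "odd (length xs) \<Longrightarrow> Suc 0 < length xs \<Longrightarrow> odd_cycle xs (xs ! 0) = xs ! 1"
    and "even (length xs) \<Longrightarrow> a \<in> set xs \<Longrightarrow> b \<in> set xs \<Longrightarrow> a \<noteq> xs ! 0 \<Longrightarrow> b \<noteq> xs ! 0 \<Longrightarrow>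
      \<exists>n. b = (odd_cycle xs ^^ n) a"
    and "odd (length xs) \<Longrightarrow> a \<in> set xs \<Longrightarrow> b \<in> set xs \<Longrightarrow> \<exists>n. b = (odd_cycle xs ^^ n) a"
  using assms
      cycle_of_list_nth[of xs i] cycle_of_list_nth[of "tl xs" "i - 1"] id_outside_supp[of "xs ! 0" "tl xs"]
      cycle_of_list_nth[of xs 0] cycle_of_list_transitive[of "tl xs" a b] cycle_of_list_transitive[of xs a b]
  by (auto simp: odd_cycle_def; cases xs; auto simp: nth_Cons split: nat.splits)+

text \<open>
  The second generator is placed on the cycle with gaps, on the positions \<open>0, 1, 3\<close>, so that the rotated
  copy of its support meets it only once. Five points suffice for this.
\<close>

lemma Alt_generated_by_three_cycle:
  assumes "finite S" "card S \<ge> 5"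
  obtains \<alpha> \<beta> m where "\<alpha> \<in> carrier (Alt S)" "\<beta> \<in> carrier (Alt S)" "\<alpha> \<circ> \<beta> \<noteq> \<beta> \<circ> \<alpha>"
    "odd m" "m \<le> card S" "\<alpha> ^^ m = id" "\<beta> ^^ 3 = id"
    "\<And>K. subgroup K (Alt S) \<Longrightarrow> \<alpha> \<in> K \<Longrightarrow> \<beta> \<in> K \<Longrightarrow> K = carrier (Alt S)"
proof -
  obtain xs where xs: "distinct xs" "set xs = S" using assms(1) finite_distinct_list by blast
  then have len: "length xs = card S" using distinct_card by fastforce
  then have "length xs \<ge> 5" using assms(2) by simp
  then obtain x0 x1 x2 x3 x4 ys where xs_eq: "xs = x0 # x1 # x2 # x3 # x4 # ys"
    by (auto simp: numeral_eq_Suc Suc_le_length_iff)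
  then have d: "distinct [x0, x1, x2, x3, x4]" "{x0, x1, x2, x3, x4} \<subseteq> S" using xs by auto
  define \<alpha> where "\<alpha> = odd_cycle xs"
  define \<beta> where "\<beta> = three_cycle x1 x0 x3"
  have len2: "length xs \<ge> 2" using assms(2) len by simp
  obtain m where m: "odd m" "m \<le> card S" "\<alpha> ^^ m = id"
    using odd_cycle_properties(3)[OF xs(1) len2] by (auto simp: \<alpha>_def len)
  have \<alpha>: "\<alpha> \<in> carrier (Alt S)"
    using odd_cycle_properties(1,2)[OF xs(1) len2] xs(2) by (simp add: \<alpha>_def)
  have \<beta>: "\<beta> \<in> carrier (Alt S)"
    unfolding \<beta>_def using d by (auto intro!: three_cycle_permutes evenperm_three_cycle)
  have \<beta>3: "\<beta> ^^ 3 = id" unfolding \<beta>_def by (rule three_cycle_cubed) (use d in auto)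
  have x1: "\<alpha> x1 = x2" and x3: "\<alpha> x3 = x4"
    using odd_cycle_apply(1)[OF xs(1), of 1] odd_cycle_apply(1)[OF xs(1), of 3] by (simp_all add: \<alpha>_def xs_eq)
  define \<gamma> where "\<gamma> = \<alpha> \<circ> \<beta> \<circ> inv' \<alpha>"
  have \<gamma>: "\<gamma> = three_cycle x2 (\<alpha> x0) x4"
    using \<alpha> x1 x3 conj_three_cycle[of \<alpha> x1 x0 x3] permutes_bij[of \<alpha> S] by (simp add: \<gamma>_def \<beta>_def)
  have gen: "K = carrier (Alt S) \<and> \<alpha> \<circ> \<beta> \<noteq> \<beta> \<circ> \<alpha>" if K: "subgroup K (Alt S)" "\<alpha> \<in> K" "\<beta> \<in> K" for K
  proof (cases "odd (length xs)")
    case True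
    then have x0: "\<alpha> x0 = x1" using odd_cycle_apply(3)[OF xs(1)] by (simp add: \<alpha>_def xs_eq)
    have b: "\<beta> x1 \<noteq> x1" "\<gamma> x1 \<noteq> x1" "\<beta> x1 = x0"
      using d unfolding \<gamma> x0 \<beta>_def by (auto simp: three_cycle_apply)
    have meet: "z = x1" if "\<beta> z \<noteq> z" "\<gamma> z \<noteq> z" for z
      using that d unfolding \<gamma> x0 \<beta>_def by (auto simp: three_cycle_apply split: if_splits)
    have tr: "\<forall>z\<in>S. \<exists>n. z = (\<alpha> ^^ n) x1"
      using odd_cycle_apply(5)[OF xs(1) True] xs(2) d by (simp add: \<alpha>_def)
    show ?thesis
      using Alt_eqI_transitive_meeting[OF K(1) assms(1) K(2,3) b(1,2) \<gamma>_def meet] b(3) tr x0 by blast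
  next
    case False
    then have x0: "\<alpha> x0 = x0" using odd_cycle_apply(2)[OF xs(1)] by (simp add: \<alpha>_def xs_eq)
    have b: "\<beta> x0 \<noteq> x0" "\<gamma> x0 \<noteq> x0" "\<beta> x0 = x3"
      using d unfolding \<gamma> x0 \<beta>_def by (auto simp: three_cycle_apply)
    have meet: "z = x0" if "\<beta> z \<noteq> z" "\<gamma> z \<noteq> z" for z
      using that d unfolding \<gamma> x0 \<beta>_def by (auto simp: three_cycle_apply split: if_splits)
    have tr: "\<forall>z\<in>S. z = x0 \<or> (\<exists>n. z = (\<alpha> ^^ n) x3)"
    proof (intro ballI disjCI)
      fix z assume "z \<in> S" "\<not> (\<exists>n. z = (\<alpha> ^^ n) x3)"
      moreover have "x3 \<noteq> xs ! 0" "x0 = xs ! 0" "x3 \<in> set xs" using d xs_eq by auto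
      ultimately show "z = x0"
        using odd_cycle_apply(4)[OF xs(1), of x3 z] False xs(2) unfolding \<alpha>_def by blast
    qed
    show ?thesis
      using Alt_eqI_transitive_meeting[OF K(1) assms(1) K(2,3) b(1,2) \<gamma>_def meet] b(3) tr x0 by blast
  qed
  show ?thesis
    using that[OF \<alpha> \<beta> _ m \<beta>3] gen gen[OF group.subgroup_self[OF group_Alt[OF assms(1)]] \<alpha> \<beta>] by blast
qed

lemma comp_transpose_eq:
  "bij f \<Longrightarrow> f \<circ> transpose a b = transpose (f a) (f b) \<circ> f"
  by (auto simp: transpose_def fun_eq_iff bij_is_inj inj_eq)

text \<open>
  The same construction on the positions \<open>0, 1, 3, 5\<close>. An involution can be recovered from a product
  with commuting elements of odd order, and prescribing the set \<open>F\<close> makes it commute with them.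
\<close>

lemma Alt_generated_by_double_transposition:
  assumes "finite S" "F \<subseteq> S" "card F \<ge> 7"
  obtains \<alpha> \<beta> where "\<alpha> \<in> carrier (Alt S)" "\<beta> \<in> carrier (Alt S)"
    "\<And>z. z \<notin> F \<Longrightarrow> \<beta> z = z" "\<beta> \<circ> \<beta> = id"
    "\<And>k. 0 < k \<Longrightarrow> k < card S - 1 \<Longrightarrow> \<alpha> ^^ k \<noteq> id"
    "\<And>K. subgroup K (Alt S) \<Longrightarrow> \<alpha> \<in> K \<Longrightarrow> \<beta> \<in> K \<Longrightarrow> K = carrier (Alt S)"
proof -
  have finF: "finite F" using assms finite_subset by blast
  obtain fs where fs: "distinct fs" "set fs = F" using finF finite_distinct_list by blast
  obtain rs where rs: "distinct rs" "set rs = S - F"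
    using assms(1) finite_distinct_list[of "S - F"] by auto
  define xs where "xs = fs @ rs"
  have xs: "distinct xs" "set xs = S" using fs rs assms(2) by (auto simp: xs_def)
  then have len: "length xs = card S" using distinct_card by fastforce
  have "length fs \<ge> 7" using distinct_card[OF fs(1)] fs(2) assms(3) by simp
  then obtain x0 x1 x2 x3 x4 x5 x6 ys where fs_eq: "fs = x0 # x1 # x2 # x3 # x4 # x5 # x6 # ys"
    by (auto simp: numeral_eq_Suc Suc_le_length_iff)
  then have xs_eq: "xs = x0 # x1 # x2 # x3 # x4 # x5 # x6 # ys @ rs" by (simp add: xs_def)
  then have d: "distinct [x0, x1, x2, x3, x4, x5, x6]" "{x0, x1, x2, x3, x4, x5, x6} \<subseteq> F"
    "{x0, x1, x2, x3, x4, x5, x6} \<subseteq> S" using xs fs fs_eq by auto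
  define \<alpha> where "\<alpha> = odd_cycle xs"
  define \<beta> where "\<beta> = transpose x0 x1 \<circ> transpose x3 x5"
  have len2: "length xs \<ge> 2" by (simp add: xs_eq)
  have \<alpha>: "\<alpha> \<in> carrier (Alt S)"
    using odd_cycle_properties(1,2)[OF xs(1) len2] xs(2) by (simp add: \<alpha>_def)
  have \<alpha>k: "\<alpha> ^^ k \<noteq> id" if "0 < k" "k < card S - 1" for k
    using odd_cycle_properties(4)[OF xs(1) len2] that by (simp add: \<alpha>_def len)
  have \<beta>: "\<beta> \<in> carrier (Alt S)"
    unfolding \<beta>_def using d
    by (auto simp: evenperm_comp evenperm_swap permutation_swap_id intro!: permutes_compose permutes_swap_id)
  have \<beta>2: "\<beta> \<circ> \<beta> = id" and \<beta>F: "z \<notin> F \<Longrightarrow> \<beta> z = z" for z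
    unfolding \<beta>_def using d by (auto simp: fun_eq_iff transpose_def)
  have xi: "\<alpha> x1 = x2" "\<alpha> x3 = x4" "\<alpha> x5 = x6"
    using odd_cycle_apply(1)[OF xs(1), of 1] odd_cycle_apply(1)[OF xs(1), of 3]
      odd_cycle_apply(1)[OF xs(1), of 5] by (simp_all add: \<alpha>_def xs_eq)
  define \<gamma> where "\<gamma> = \<alpha> \<circ> \<beta> \<circ> inv' \<alpha>"
  have \<gamma>: "\<gamma> = transpose (\<alpha> x0) x2 \<circ> transpose x4 x6"
  proof -
    have a: "bij \<alpha>" using \<alpha> permutes_bij by auto
    have "\<alpha> \<circ> \<beta> = transpose (\<alpha> x0) x2 \<circ> transpose x4 x6 \<circ> \<alpha>"
      using comp_transpose_eq[OF a, of x0 x1] comp_transpose_eq[OF a, of x3 x5] xi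
      unfolding \<beta>_def by (metis comp_assoc)
    then show ?thesis unfolding \<gamma>_def using bij_is_surj[OF a] by (simp add: comp_assoc surj_iff)
  qed
  have gen: "K = carrier (Alt S)" if K: "subgroup K (Alt S)" "\<alpha> \<in> K" "\<beta> \<in> K" for K
  proof (cases "odd (length xs)")
    case True
    then have x0: "\<alpha> x0 = x1" using odd_cycle_apply(3)[OF xs(1)] by (simp add: \<alpha>_def xs_eq)
    have b: "\<beta> x1 \<noteq> x1" "\<gamma> x1 \<noteq> x1" "\<beta> x1 = x0"
      using d unfolding \<gamma> x0 \<beta>_def by (auto simp: transpose_def)
    have meet: "z = x1" if "\<beta> z \<noteq> z" "\<gamma> z \<noteq> z" for z
      using that d unfolding \<gamma> x0 \<beta>_def by (auto simp: transpose_def split: if_splits)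
    have tr: "\<forall>z\<in>S. \<exists>n. z = (\<alpha> ^^ n) x1"
      using odd_cycle_apply(5)[OF xs(1) True] xs(2) d by (simp add: \<alpha>_def)
    show ?thesis
      using Alt_eqI_transitive_meeting(1)[OF K(1) assms(1) K(2,3) b(1,2) \<gamma>_def meet] b(3) tr x0 by blast
  next
    case False
    then have x0: "\<alpha> x0 = x0" using odd_cycle_apply(2)[OF xs(1)] by (simp add: \<alpha>_def xs_eq)
    have b: "\<beta> x0 \<noteq> x0" "\<gamma> x0 \<noteq> x0" "\<beta> x0 = x1"
      using d unfolding \<gamma> x0 \<beta>_def by (auto simp: transpose_def)
    have meet: "z = x0" if "\<beta> z \<noteq> z" "\<gamma> z \<noteq> z" for z
      using that d unfolding \<gamma> x0 \<beta>_def by (auto simp: transpose_def split: if_splits)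
    have tr: "\<forall>z\<in>S. z = x0 \<or> (\<exists>n. z = (\<alpha> ^^ n) x1)"
    proof (intro ballI disjCI)
      fix z assume "z \<in> S" "\<not> (\<exists>n. z = (\<alpha> ^^ n) x1)"
      moreover have "x1 \<noteq> xs ! 0" "x0 = xs ! 0" "x1 \<in> set xs" using d xs_eq by auto
      ultimately show "z = x0"
        using odd_cycle_apply(4)[OF xs(1), of x1 z] False xs(2) unfolding \<alpha>_def by blast
    qed
    show ?thesis
      using Alt_eqI_transitive_meeting(1)[OF K(1) assms(1) K(2,3) b(1,2) \<gamma>_def meet] b(3) tr x0 by blast
  qed
  show ?thesis
    using that[OF \<alpha> \<beta> \<beta>F \<beta>2 \<alpha>k] gen by blast
qed

section \<open>A criterion for frames\<close>

text \<open>
  A subgroup of the product that contains the direct sum projects onto every finite subproduct.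
  If moreover every normal subgroup of finite index contains one of the kernels
  \<open>level_kernel n\<close> of these projections, then a compatible family of cosets is the same thing
  as an element of the product.
\<close>

locale congruence_subgroup =
  fixes S :: "nat \<Rightarrow> 'b monoid" and H :: "(nat \<Rightarrow> 'b) set"
  assumes group_factor: "1 \<le> n \<Longrightarrow> group (S n)"
    and finite_factor: "1 \<le> n \<Longrightarrow> finite (carrier (S n))"
    and subgroup_H: "subgroup H (full_product S)"
    and sum_subset: "carrier (sum_group {1..} S) \<subseteq> H"
    and congruence: "N \<in> finite_index_normal ((full_product S)\<lparr>carrier := H\<rparr>) \<Longrightarrow>
      \<exists>n. \<forall>h\<in>H. (\<forall>i\<in>{1..n}. h i = \<one>\<^bsub>S i\<^esub>) \<longrightarrow> h \<in> N"
begin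

abbreviation G :: "(nat \<Rightarrow> 'b) monoid" where
  "G \<equiv> (full_product S)\<lparr>carrier := H\<rparr>"

abbreviation \<N> :: "(nat \<Rightarrow> 'b) set set" where
  "\<N> \<equiv> finite_index_normal G"

definition level_kernel :: "nat \<Rightarrow> (nat \<Rightarrow> 'b) set" where
  "level_kernel n = {h \<in> H. \<forall>i\<in>{1..n}. h i = \<one>\<^bsub>S i\<^esub>}"

definition coordinate_kernel :: "nat \<Rightarrow> (nat \<Rightarrow> 'b) set" where
  "coordinate_kernel n = kernel G (S n) (\<lambda>h. h n)"

lemma group_product: "group (full_product S)"
  using group_factor by (intro product_group) simp

sublocale G: group G
  using subgroup.subgroup_is_group[OF subgroup_H group_product] .

lemma H_PiE: "h \<in> H \<Longrightarrow> h \<in> (\<Pi>\<^sub>E i\<in>{1..}. carrier (S i))"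
  using subgroup.subset[OF subgroup_H] by auto

lemma coordinate_closed: "h \<in> H \<Longrightarrow> 1 \<le> i \<Longrightarrow> h i \<in> carrier (S i)"
  using H_PiE by fastforce

lemma mult_coordinate: "1 \<le> i \<Longrightarrow> (h \<otimes>\<^bsub>G\<^esub> h') i = h i \<otimes>\<^bsub>S i\<^esub> h' i"
  by simp

lemma inv_coordinate:
  assumes "h \<in> H" "1 \<le> i"
  shows "(inv\<^bsub>G\<^esub> h) i = inv\<^bsub>S i\<^esub> (h i)"
proof -
  have "inv\<^bsub>G\<^esub> h = inv\<^bsub>full_product S\<^esub> h"
    using group.m_inv_consistent[OF group_product subgroup_H assms(1)] by simp
  also have "\<dots> = (\<lambda>i\<in>{1..}. inv\<^bsub>S i\<^esub> (h i))"
    by (rule inv_product_group[OF H_PiE[OF assms(1)]]) (use group_factor in auto)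
  finally show ?thesis using assms(2) by simp
qed

lemma quotient_coordinate:
  assumes "h \<in> H" "h' \<in> H" "1 \<le> i" "h i = h' i"
  shows "(h \<otimes>\<^bsub>G\<^esub> inv\<^bsub>G\<^esub> h') i = \<one>\<^bsub>S i\<^esub>"
  using assms coordinate_closed[of h' i] group.r_inv[OF group_factor, of i "h' i"]
  by (simp only: mult_coordinate inv_coordinate)

lemma quotient_level_kernel:
  assumes "h \<in> H" "h' \<in> H" "\<And>i. i \<in> {1..n} \<Longrightarrow> h i = h' i"
  shows "h \<otimes>\<^bsub>G\<^esub> inv\<^bsub>G\<^esub> h' \<in> level_kernel n"
proof -
  have "h \<otimes>\<^bsub>G\<^esub> inv\<^bsub>G\<^esub> h' \<in> H" using G.m_closed G.inv_closed assms(1,2) by simp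
  moreover have "(h \<otimes>\<^bsub>G\<^esub> inv\<^bsub>G\<^esub> h') i = \<one>\<^bsub>S i\<^esub>" if "i \<in> {1..n}" for i
    using quotient_coordinate[of h h' i] assms that by (metis atLeastAtMost_iff)
  ultimately show ?thesis by (simp add: level_kernel_def)
qed

lemma coset_eqI:
  assumes "subgroup N G" "level_kernel n \<subseteq> N" "h \<in> H" "h' \<in> H"
    and "\<And>i. i \<in> {1..n} \<Longrightarrow> h i = h' i"
  shows "N #>\<^bsub>G\<^esub> h = N #>\<^bsub>G\<^esub> h'"
proof -
  have "h \<otimes>\<^bsub>G\<^esub> inv\<^bsub>G\<^esub> h' \<in> N" using quotient_level_kernel[OF assms(3-5)] assms(2) by blast
  then have "h \<in> N #>\<^bsub>G\<^esub> h'"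
    using subgroup.rcos_module_rev[OF assms(1) G.is_group] assms(3,4) by simp
  then show ?thesis
    using G.repr_independence[of h N h'] assms(1,4) by simp
qed

lemma finite_index_normalI:
  assumes "N \<lhd> G" "level_kernel n \<subseteq> N"
  shows "N \<in> \<N>"
proof -
  have N: "subgroup N G" by (rule normal_imp_subgroup[OF assms(1)])
  let ?r = "\<lambda>h. restrict h {1..n}"
  define pick where "pick \<rho> = (SOME h. h \<in> H \<and> ?r h = \<rho>)" for \<rho>
  have "N #>\<^bsub>G\<^esub> h = N #>\<^bsub>G\<^esub> pick (?r h)" if h: "h \<in> H" for h
  proof -
    have p: "pick (?r h) \<in> H \<and> ?r (pick (?r h)) = ?r h"
      unfolding pick_def by (rule someI[of _ h]) (use h in simp)
    have "h i = pick (?r h) i" if "i \<in> {1..n}" for i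
      using fun_cong[OF conjunct2[OF p], of i] that by simp
    then show ?thesis using coset_eqI[OF N assms(2) h] p by blast
  qed
  moreover have "?r h \<in> (\<Pi>\<^sub>E i\<in>{1..n}. carrier (S i))" if "h \<in> H" for h
    using coordinate_closed[OF that] by auto
  ultimately have "rcosets\<^bsub>G\<^esub> N \<subseteq> (\<lambda>\<rho>. N #>\<^bsub>G\<^esub> pick \<rho>) ` (\<Pi>\<^sub>E i\<in>{1..n}. carrier (S i))"
    by (auto simp: RCOSETS_def)
  moreover have "finite (\<Pi>\<^sub>E i\<in>{1..n}. carrier (S i))"
    by (rule finite_PiE) (use finite_factor in auto)
  ultimately show ?thesis
    using assms(1) by (auto simp: finite_index_normal_def intro: finite_surj)
qed

lemma normal_kernel_of_coordinates:
  assumes "I \<subseteq> {1..}"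
  shows "{h \<in> H. \<forall>i\<in>I. h i = \<one>\<^bsub>S i\<^esub>} \<lhd> G"
  unfolding G.normal_inv_iff
proof (intro conjI ballI)
  let ?N = "{h \<in> H. \<forall>i\<in>I. h i = \<one>\<^bsub>S i\<^esub>}"
  have I: "1 \<le> i \<and> group (S i)" if "i \<in> I" for i using assms that group_factor by auto
  show "subgroup ?N G"
  proof (rule G.subgroupI)
    have "\<one>\<^bsub>G\<^esub> \<in> ?N" using G.one_closed I by auto
    then show "?N \<noteq> {}" by blast
    show "inv\<^bsub>G\<^esub> a \<in> ?N" if "a \<in> ?N" for a
    proof -
      have "(inv\<^bsub>G\<^esub> a) i = \<one>\<^bsub>S i\<^esub>" if "i \<in> I" for i
        using inv_coordinate[of a i] I[OF that] \<open>a \<in> ?N\<close> that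
        by (simp add: group.is_monoid monoid.inv_one del: One_nat_def)
      then show ?thesis using that G.inv_closed[of a] by simp
    qed
    show "a \<otimes>\<^bsub>G\<^esub> b \<in> ?N" if "a \<in> ?N" "b \<in> ?N" for a b
      using that G.m_closed[of a b] I by (auto simp: group.is_monoid)
  qed auto
  fix a h assume a: "a \<in> carrier G" "h \<in> ?N"
  then have c: "a \<otimes>\<^bsub>G\<^esub> h \<otimes>\<^bsub>G\<^esub> inv\<^bsub>G\<^esub> a \<in> H"
    using G.inv_closed[of a] G.m_closed[of a h] G.m_closed[of "a \<otimes>\<^bsub>G\<^esub> h" "inv\<^bsub>G\<^esub> a"] by simp
  have "(a \<otimes>\<^bsub>G\<^esub> h \<otimes>\<^bsub>G\<^esub> inv\<^bsub>G\<^esub> a) i = \<one>\<^bsub>S i\<^esub>" if i: "i \<in> I" for i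
  proof -
    have "a i \<in> carrier (S i)" "h i = \<one>\<^bsub>S i\<^esub>" "a \<in> H" using a i I coordinate_closed by auto
    then show ?thesis using I[OF i] a inv_coordinate[of a i]
      by (simp add: group.is_monoid group.r_inv)
  qed
  then show "a \<otimes>\<^bsub>G\<^esub> h \<otimes>\<^bsub>G\<^esub> inv\<^bsub>G\<^esub> a \<in> ?N" using c by blast
qed

lemma level_kernel_finite_index: "level_kernel n \<in> \<N>"
  using finite_index_normalI[of "level_kernel n" n] normal_kernel_of_coordinates[of "{1..n}"]
  by (auto simp: level_kernel_def)

lemma coordinate_kernel_eq: "1 \<le> n \<Longrightarrow> coordinate_kernel n = {h \<in> H. \<forall>i\<in>{n}. h i = \<one>\<^bsub>S i\<^esub>}"
  by (simp add: coordinate_kernel_def kernel_def)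

lemma level_kernel_subset: "1 \<le> i \<Longrightarrow> i \<le> n \<Longrightarrow> level_kernel n \<subseteq> coordinate_kernel i"
  by (auto simp: level_kernel_def coordinate_kernel_eq)

lemma coordinate_kernel_finite_index: "1 \<le> n \<Longrightarrow> coordinate_kernel n \<in> \<N>"
  using finite_index_normalI[of "coordinate_kernel n" n] normal_kernel_of_coordinates[of "{n}"]
    level_kernel_subset[of n n]
  by (simp add: coordinate_kernel_eq)

lemma finite_index_normalD: "N \<in> \<N> \<Longrightarrow> N \<lhd> G" "N \<in> \<N> \<Longrightarrow> subgroup N G"
  by (auto simp: finite_index_normal_def normal_imp_subgroup)

lemma set_mult_coset:
  assumes "subgroup M G" "subgroup N G" "M \<subseteq> N" "h \<in> H"
  shows "N <#>\<^bsub>G\<^esub> (M #>\<^bsub>G\<^esub> h) = N #>\<^bsub>G\<^esub> h"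
proof -
  have "N <#>\<^bsub>G\<^esub> M = N"
  proof
    show "N <#>\<^bsub>G\<^esub> M \<subseteq> N"
      using subgroup.m_closed[OF assms(2)] assms(3) unfolding set_mult_def by blast
    show "N \<subseteq> N <#>\<^bsub>G\<^esub> M"
    proof
      fix z assume z: "z \<in> N"
      then have "z = z \<otimes>\<^bsub>G\<^esub> \<one>\<^bsub>G\<^esub>" using G.r_one subgroup.mem_carrier[OF assms(2)] by metis
      then show "z \<in> N <#>\<^bsub>G\<^esub> M" using z subgroup.one_closed[OF assms(1)] unfolding set_mult_def by blast
    qed
  qed
  then show ?thesis
    using G.setmult_rcos_assoc[of N M h] subgroup.subset[OF assms(1)] subgroup.subset[OF assms(2)] assms(4)
    by simp
qed

abbreviation PC :: "((nat \<Rightarrow> 'b) set \<Rightarrow> (nat \<Rightarrow> 'b) set) monoid" where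
  "PC \<equiv> profinite_completion G"

lemma completion_representative:
  assumes "c \<in> carrier PC"
  obtains h where "h \<in> H" "c (level_kernel n) = level_kernel n #>\<^bsub>G\<^esub> h"
    "\<And>N. N \<in> \<N> \<Longrightarrow> level_kernel n \<subseteq> N \<Longrightarrow> c N = N #>\<^bsub>G\<^esub> h"
proof -
  have L: "level_kernel n \<in> \<N>" by (rule level_kernel_finite_index)
  have "c (level_kernel n) \<in> carrier (G Mod level_kernel n)"
    using assms L by (auto simp: profinite_completion_def)
  then obtain h where h: "h \<in> H" "c (level_kernel n) = level_kernel n #>\<^bsub>G\<^esub> h"
    by (auto simp: carrier_FactGroup)
  have "c N = N #>\<^bsub>G\<^esub> h" if N: "N \<in> \<N>" "level_kernel n \<subseteq> N" for N
  proof -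
    have "N <#>\<^bsub>G\<^esub> c (level_kernel n) = c N"
      using assms L N by (auto simp: profinite_completion_def)
    then show ?thesis
      using set_mult_coset[OF _ _ N(2) h(1)] finite_index_normalD N(1) L h(2) by simp
  qed
  then show ?thesis using that h by blast
qed

lemma natural_map_coset:
  assumes "1 \<le> i" "h \<in> H" "c (coordinate_kernel i) = coordinate_kernel i #>\<^bsub>G\<^esub> h"
  shows "natural_map S H c i = h i"
proof -
  have g: "group (S i)" and hi: "h i \<in> carrier (S i)" using assms group_factor coordinate_closed by auto
  have K: "subgroup (coordinate_kernel i) G"
    by (rule finite_index_normalD(2)[OF coordinate_kernel_finite_index[OF assms(1)]])
  have "(\<lambda>h. h i) ` c (coordinate_kernel i) = {h i}"
    unfolding assms(3)
  proof (intro subset_antisym subsetI)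
    fix z assume "z \<in> (\<lambda>h. h i) ` (coordinate_kernel i #>\<^bsub>G\<^esub> h)"
    then obtain k where "k \<in> coordinate_kernel i" "z = (k \<otimes>\<^bsub>G\<^esub> h) i"
      by (auto simp: r_coset_def)
    then show "z \<in> {h i}" using assms(1) g hi by (simp add: coordinate_kernel_eq group.is_monoid)
  next
    fix z assume "z \<in> {h i}"
    moreover have "h \<in> coordinate_kernel i #>\<^bsub>G\<^esub> h"
      using G.rcos_self[of h "coordinate_kernel i"] K assms(2) by simp
    ultimately show "z \<in> (\<lambda>h. h i) ` (coordinate_kernel i #>\<^bsub>G\<^esub> h)" by blast
  qed
  then show ?thesis using assms(1) by (simp add: natural_map_def coordinate_kernel_def)
qed

lemma natural_map_coordinate:
  assumes "1 \<le> i" "i \<le> n"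
    and "\<And>N. N \<in> \<N> \<Longrightarrow> level_kernel n \<subseteq> N \<Longrightarrow> c N = N #>\<^bsub>G\<^esub> h" "h \<in> H"
  shows "natural_map S H c i = h i"
  using natural_map_coset[of i h c] assms coordinate_kernel_finite_index level_kernel_subset by simp

lemma natural_map_closed:
  assumes "c \<in> carrier PC"
  shows "natural_map S H c \<in> (\<Pi>\<^sub>E i\<in>{1..}. carrier (S i))"
proof (rule PiE_I)
  fix i :: nat assume i: "i \<in> {1..}"
  obtain h where h: "h \<in> H" "\<And>N. N \<in> \<N> \<Longrightarrow> level_kernel i \<subseteq> N \<Longrightarrow> c N = N #>\<^bsub>G\<^esub> h"
    using completion_representative[OF assms] by metis
  then show "natural_map S H c i \<in> carrier (S i)"
    using natural_map_coordinate[of i i c h] i coordinate_closed by simp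
qed (simp add: natural_map_def)

lemma natural_map_hom: "natural_map S H \<in> hom PC (full_product S)"
proof (rule homI)
  fix c c' assume c: "c \<in> carrier PC" "c' \<in> carrier PC"
  show "natural_map S H (c \<otimes>\<^bsub>PC\<^esub> c') = natural_map S H c \<otimes>\<^bsub>full_product S\<^esub> natural_map S H c'"
  proof
    fix i
    show "natural_map S H (c \<otimes>\<^bsub>PC\<^esub> c') i = (natural_map S H c \<otimes>\<^bsub>full_product S\<^esub> natural_map S H c') i"
    proof (cases "1 \<le> i")
      case True
      let ?K = "coordinate_kernel i"
      have K: "?K \<in> \<N>" by (rule coordinate_kernel_finite_index[OF True])
      obtain h where h: "h \<in> H" "c ?K = ?K #>\<^bsub>G\<^esub> h"
        using completion_representative[OF c(1), of i] K level_kernel_subset[OF True] by (metis order_refl)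
      obtain h' where h': "h' \<in> H" "c' ?K = ?K #>\<^bsub>G\<^esub> h'"
        using completion_representative[OF c(2), of i] K level_kernel_subset[OF True] by (metis order_refl)
      have "(c \<otimes>\<^bsub>PC\<^esub> c') ?K = c ?K <#>\<^bsub>G\<^esub> c' ?K"
        using K by (simp add: profinite_completion_def)
      then have "(c \<otimes>\<^bsub>PC\<^esub> c') ?K = ?K #>\<^bsub>G\<^esub> (h \<otimes>\<^bsub>G\<^esub> h')"
        using normal.rcos_sum[OF finite_index_normalD(1)[OF K]] h h' by simp
      moreover have "h \<otimes>\<^bsub>G\<^esub> h' \<in> H" using G.m_closed[of h h'] h h' by simp
      ultimately have "natural_map S H (c \<otimes>\<^bsub>PC\<^esub> c') i = (h \<otimes>\<^bsub>G\<^esub> h') i"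
        using natural_map_coset[OF True] by blast
      then show ?thesis
        using natural_map_coset[of i h c, OF True h] natural_map_coset[of i h' c', OF True h'] True by simp
    qed (simp add: natural_map_def)
  qed
qed (use natural_map_closed in simp)

text \<open>
  The inverse of the natural map: the coset of \<open>N\<close> prescribed by \<open>p\<close> is the coset of a truncation
  of \<open>p\<close>, which lies in the direct sum, at any level whose kernel is contained in \<open>N\<close>.
\<close>

definition truncation :: "nat \<Rightarrow> (nat \<Rightarrow> 'b) \<Rightarrow> nat \<Rightarrow> 'b" where
  "truncation n p = (\<lambda>i\<in>{1..}. if i \<le> n then p i else \<one>\<^bsub>S i\<^esub>)"

definition congruence_level :: "(nat \<Rightarrow> 'b) set \<Rightarrow> nat" where
  "congruence_level N = (SOME n. level_kernel n \<subseteq> N)"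

definition completion_of :: "(nat \<Rightarrow> 'b) \<Rightarrow> (nat \<Rightarrow> 'b) set \<Rightarrow> (nat \<Rightarrow> 'b) set" where
  "completion_of p = (\<lambda>N\<in>\<N>. N #>\<^bsub>G\<^esub> truncation (congruence_level N) p)"

lemma congruence_level: "N \<in> \<N> \<Longrightarrow> level_kernel (congruence_level N) \<subseteq> N"
  unfolding congruence_level_def by (rule someI_ex) (use congruence level_kernel_def in blast)

lemma truncation_closed:
  assumes "p \<in> (\<Pi>\<^sub>E i\<in>{1..}. carrier (S i))"
  shows "truncation n p \<in> H"
proof -
  have "truncation n p \<in> (\<Pi>\<^sub>E i\<in>{1..}. carrier (S i))"
    using assms group_factor by (auto simp: truncation_def group.is_monoid)
  moreover have "finite {i \<in> {1..}. truncation n p i \<noteq> \<one>\<^bsub>S i\<^esub>}"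
    by (rule finite_subset[of _ "{..n}"]) (auto simp: truncation_def split: if_splits)
  ultimately show ?thesis
    using sum_subset carrier_sum_group[of "{1..}" S] group_factor by auto
qed

lemma completion_of_eq:
  assumes "p \<in> (\<Pi>\<^sub>E i\<in>{1..}. carrier (S i))" "N \<in> \<N>" "level_kernel n \<subseteq> N"
  shows "completion_of p N = N #>\<^bsub>G\<^esub> truncation n p"
proof -
  let ?m = "congruence_level N"
  have t: "truncation k p \<in> H" for k by (rule truncation_closed[OF assms(1)])
  have *: "N #>\<^bsub>G\<^esub> truncation k p = N #>\<^bsub>G\<^esub> truncation l p" if "level_kernel k \<subseteq> N" "k \<le> l" for k l
    by (rule coset_eqI[OF finite_index_normalD(2)[OF assms(2)] that(1) t t])
       (use that(2) in \<open>auto simp: truncation_def\<close>)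
  have "N #>\<^bsub>G\<^esub> truncation ?m p = N #>\<^bsub>G\<^esub> truncation n p"
    using *[OF assms(3), of ?m] *[OF congruence_level[OF assms(2)], of n] by (metis nle_le)
  then show ?thesis using assms(2) by (simp add: completion_of_def)
qed

lemma completion_of_closed:
  assumes "p \<in> (\<Pi>\<^sub>E i\<in>{1..}. carrier (S i))"
  shows "completion_of p \<in> carrier PC"
proof -
  have t: "truncation k p \<in> H" for k by (rule truncation_closed[OF assms(1)])
  have "N <#>\<^bsub>G\<^esub> completion_of p M = completion_of p N"
    if M: "M \<in> \<N>" and N: "N \<in> \<N>" "M \<subseteq> N" for M N
  proof -
    have "level_kernel (congruence_level M) \<subseteq> N" using congruence_level[OF M] N(2) by blast
    then show ?thesis
      using completion_of_eq[OF assms N(1)] completion_of_eq[OF assms M congruence_level[OF M]]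
        set_mult_coset[OF _ _ N(2) t] finite_index_normalD M N(1) by simp
  qed
  moreover have "completion_of p N \<in> carrier (G Mod N)" if "N \<in> \<N>" for N
    using that t by (auto simp: completion_of_def carrier_FactGroup)
  ultimately show ?thesis
    by (auto simp: profinite_completion_def completion_of_def[of p, THEN fun_cong] intro!: PiE_I)
qed

lemma natural_map_completion_of:
  assumes "p \<in> (\<Pi>\<^sub>E i\<in>{1..}. carrier (S i))"
  shows "natural_map S H (completion_of p) = p"
proof
  fix i
  show "natural_map S H (completion_of p) i = p i"
  proof (cases "1 \<le> i")
    case True
    then show ?thesis
      using natural_map_coordinate[OF True order_refl, of "completion_of p" "truncation i p"]
        completion_of_eq[OF assms] truncation_closed[OF assms] by (simp add: truncation_def)
  next
    case False
    then show ?thesis using assms by (auto simp: natural_map_def PiE_def extensional_def)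
  qed
qed

lemma completion_of_natural_map:
  assumes "c \<in> carrier PC"
  shows "completion_of (natural_map S H c) = c"
proof
  fix N
  show "completion_of (natural_map S H c) N = c N"
  proof (cases "N \<in> \<N>")
    case True
    let ?n = "congruence_level N" and ?p = "natural_map S H c"
    obtain h where h: "h \<in> H"
      "\<And>N. N \<in> \<N> \<Longrightarrow> level_kernel ?n \<subseteq> N \<Longrightarrow> c N = N #>\<^bsub>G\<^esub> h"
      using completion_representative[OF assms, of ?n] by metis
    have "?p i = h i" if "i \<in> {1..?n}" for i
      using natural_map_coordinate[of i ?n c h] h that by auto
    then have "N #>\<^bsub>G\<^esub> truncation ?n ?p = N #>\<^bsub>G\<^esub> h"
      by (intro coset_eqI[OF finite_index_normalD(2)[OF True] congruence_level[OF True]]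
           truncation_closed natural_map_closed assms h) (auto simp: truncation_def)
    then show ?thesis using h(2)[OF True congruence_level[OF True]] True by (simp add: completion_of_def)
  next
    case False
    then show ?thesis using assms by (auto simp: completion_of_def profinite_completion_def PiE_def extensional_def)
  qed
qed

lemma natural_map_iso: "natural_map S H \<in> iso PC (full_product S)"
proof (rule isoI[OF natural_map_hom])
  show "bij_betw (natural_map S H) (carrier PC) (carrier (full_product S))"
    by (rule bij_betw_byWitness[where f' = completion_of])
       (use natural_map_completion_of completion_of_natural_map natural_map_closed completion_of_closed in auto)
qed

lemma topspace_completion: "topspace (profinite_completion_topology G) = carrier PC"
  by (auto simp: profinite_completion_topology_def profinite_completion_def)

lemma continuous_natural_map:
  "continuous_map (profinite_completion_topology G) (full_product_topology S) (natural_map S H)"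
  unfolding continuous_map_componentwise
proof (intro conjI ballI)
  show "natural_map S H ` topspace (profinite_completion_topology G) \<subseteq> extensional {1..}"
    by (auto simp: natural_map_def)
  fix i :: nat assume i: "i \<in> {1..}"
  let ?K = "coordinate_kernel i"
  let ?X = "profinite_completion_topology G"
  let ?F = "\<lambda>C. the_elem ((\<lambda>h. h i) ` C)"
  have K: "?K \<in> \<N>" using coordinate_kernel_finite_index i by simp
  have "continuous_map ?X (discrete_topology (carrier (G Mod ?K))) (\<lambda>c. c ?K)"
    unfolding profinite_completion_topology_def
    by (rule continuous_map_from_subtopology[OF continuous_map_product_projection[OF K]])
  moreover have "?F \<in> carrier (G Mod ?K) \<rightarrow> UNIV" by simp
  then have "continuous_map (discrete_topology (carrier (G Mod ?K))) (discrete_topology UNIV) ?F"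
    by simp
  ultimately have "continuous_map ?X (discrete_topology UNIV) (?F \<circ> (\<lambda>c. c ?K))"
    by (rule continuous_map_compose)
  then have "continuous_map ?X (discrete_topology UNIV) (\<lambda>c. natural_map S H c i)"
    using i by (simp add: comp_def natural_map_def coordinate_kernel_def)
  then have "continuous_map ?X (subtopology (discrete_topology UNIV) (carrier (S i))) (\<lambda>c. natural_map S H c i)"
    using PiE_mem[OF natural_map_closed i] unfolding continuous_map_in_subtopology topspace_completion
    by blast
  then show "continuous_map ?X (discrete_topology (carrier (S i))) (\<lambda>c. natural_map S H c i)"
    by simp
qed

text \<open>
  The coset of \<open>N\<close> only depends on the coordinates up to the level of \<open>N\<close>, so it is locally constant.
\<close>

lemma continuous_completion_of:
  "continuous_map (full_product_topology S) (profinite_completion_topology G) completion_of"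
  unfolding profinite_completion_topology_def continuous_map_in_subtopology continuous_map_componentwise
proof (intro conjI ballI)
  let ?X = "full_product_topology S"
  show "completion_of ` topspace ?X \<subseteq> extensional (\<N>)"
    by (auto simp: completion_of_def)
  show "completion_of \<in> topspace ?X \<rightarrow> carrier PC"
    using completion_of_closed by simp
  fix N assume N: "N \<in> \<N>"
  let ?n = "congruence_level N"
  show "continuous_map ?X (discrete_topology (carrier (G Mod N))) (\<lambda>p. completion_of p N)"
    unfolding continuous_map_def
  proof (intro conjI allI impI)
    show "(\<lambda>p. completion_of p N) \<in> topspace ?X \<rightarrow> topspace (discrete_topology (carrier (G Mod N)))"
      using completion_of_closed N by (auto simp: profinite_completion_def)
    fix U
    show "openin ?X {p \<in> topspace ?X. completion_of p N \<in> U}"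
    proof (subst openin_subopen, intro ballI)
      fix p assume p: "p \<in> {p \<in> topspace ?X. completion_of p N \<in> U}"
      define B where "B i = (if 1 \<le> i \<and> i \<le> ?n then {p i} else carrier (S i))" for i
      \<comment> \<open>the box of all elements that agree with \<open>p\<close> up to the level of \<open>N\<close>\<close>
      have "openin ?X (Pi\<^sub>E {1..} B)"
      proof (rule product_topology_basis)
        show "openin (discrete_topology (carrier (S i))) (B i)" for i
          using p by (auto simp: B_def PiE_iff)
        show "finite {i. B i \<noteq> topspace (discrete_topology (carrier (S i)))}"
          by (rule finite_subset[of _ "{1..?n}"]) (auto simp: B_def split: if_splits)
      qed
      moreover have "p \<in> Pi\<^sub>E {1..} B" using p by (auto simp: B_def PiE_iff)
      moreover have box: "q \<in> topspace ?X \<and> completion_of q N = completion_of p N" if q: "q \<in> Pi\<^sub>E {1..} B" for q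
      proof -
        have "q i \<in> carrier (S i)" if "1 \<le> i" for i
        proof -
          have "q i \<in> B i" using q that by (auto simp: PiE_iff)
          then show ?thesis using p that by (auto simp: B_def PiE_iff split: if_splits)
        qed
        then have "q \<in> topspace ?X" using q by (auto simp: PiE_iff)
        moreover have "q i = p i" if "1 \<le> i" "i \<le> ?n" for i
        proof -
          have "q i \<in> B i" using q that by (auto simp: PiE_iff)
          then show ?thesis using that by (simp add: B_def)
        qed
        then have "truncation ?n q = truncation ?n p" by (auto simp: truncation_def fun_eq_iff)
        ultimately show ?thesis using N by (simp add: completion_of_def)
      qed
      moreover have "Pi\<^sub>E {1..} B \<subseteq> {p \<in> topspace ?X. completion_of p N \<in> U}"
      proof
        fix q assume "q \<in> Pi\<^sub>E {1..} B"
        then have "q \<in> topspace ?X" "completion_of q N = completion_of p N" using box by blast+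
        then show "q \<in> {p \<in> topspace ?X. completion_of p N \<in> U}" using p by simp
      qed
      ultimately show "\<exists>T. openin ?X T \<and> p \<in> T \<and> T \<subseteq> {p \<in> topspace ?X. completion_of p N \<in> U}"
        by blast
    qed
  qed
qed

theorem frame_in_of_congruence:
  assumes "finite A" "A \<subseteq> H" "generate (full_product S) A = H"
  shows "frame_in S H"
proof -
  have top: "topspace (full_product_topology S) = (\<Pi>\<^sub>E i\<in>{1..}. carrier (S i))" by simp
  have "homeomorphic_maps (profinite_completion_topology G) (full_product_topology S)
      (natural_map S H) completion_of"
    using continuous_natural_map continuous_completion_of natural_map_completion_of completion_of_natural_map
    unfolding homeomorphic_maps_def topspace_completion top by blast
  then have "homeomorphic_map (profinite_completion_topology G) (full_product_topology S) (natural_map S H)"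
    by (rule homeomorphic_maps_imp_map)
  then show ?thesis
    unfolding frame_in_def Let_def
    using group_factor finite_factor subgroup_H sum_subset natural_map_iso assms by auto
qed

end

lemma Alt_iso_alt_group:
  assumes "finite S"
  shows "Alt S \<cong> alt_group (card S)"
proof -
  obtain e where e: "bij_betw e S {1..card S}"
    using finite_same_card_bij[OF assms finite_atLeastAtMost, of 1 "card S"] by auto
  let ?e' = "inv_into S e"
  have e': "bij_betw ?e' {1..card S} S" using e by (rule bij_betw_inv_into)
  have inj: "inj_on e S" "inj_on ?e' {1..card S}" using e e' by (auto simp: bij_betw_def)
  have "map_permutation S e \<in> iso (Alt S) (alt_group (card S))"
  proof (rule isoI)
    show "map_permutation S e \<in> hom (Alt S) (alt_group (card S))"
      using map_permutation_permutes[OF e] evenperm_map_permutation[OF inj(1) _ assms]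
        map_permutation_compose'[OF inj(1)]
      by (auto simp: hom_def alt_group_carrier alt_group_mult Alt_def)
    show "bij_betw (map_permutation S e) (carrier (Alt S)) (carrier (alt_group (card S)))"
    proof (rule bij_betw_byWitness[where f' = "map_permutation {1..card S} ?e'"])
      show "\<forall>p\<in>carrier (Alt S). map_permutation {1..card S} ?e' (map_permutation S e p) = p"
        using map_permutation_compose_inv[OF e] inj(1) by (auto simp: Alt_def)
      show "\<forall>p\<in>carrier (alt_group (card S)). map_permutation S e (map_permutation {1..card S} ?e' p) = p"
        using map_permutation_compose_inv[OF e'] e by (auto simp: alt_group_carrier bij_betw_inv_into_right)
    qed (use map_permutation_permutes[OF e] map_permutation_permutes[OF e']
        evenperm_map_permutation[OF inj(1) _ assms] evenperm_map_permutation[OF inj(2)] in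
        \<open>auto simp: alt_group_carrier Alt_def\<close>)
  qed
  then show ?thesis by (auto simp: is_iso_def)
qed

section \<open>Words and the two families of embeddings\<close>

lemma permutes_iff_bij: "p permutes S \<longleftrightarrow> bij p \<and> (\<forall>z. z \<notin> S \<longrightarrow> p z = z)"
  by (auto simp: permutes_def bij_iff)

lemma finite_words: "finite X \<Longrightarrow> finite (words X n)"
  using finite_lists_length_eq[of X n] by (simp add: words_def conj_commute)

lemma card_words: "finite X \<Longrightarrow> card (words X n) = card X ^ n"
  using card_lists_length_eq[of X n] by (simp add: words_def conj_commute)

lemma take_words: "u \<in> words X k \<Longrightarrow> l \<le> k \<Longrightarrow> take l u \<in> words X l"
  by (auto simp: words_def dest: in_set_takeD)

lemma drop_words: "u \<in> words X k \<Longrightarrow> drop l u \<in> words X (k - l)"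
  by (auto simp: words_def dest: in_set_dropD)

lemma append_words: "v \<in> words X l \<Longrightarrow> w \<in> words X m \<Longrightarrow> v @ w \<in> words X (l + m)"
  by (auto simp: words_def)

lemma length_words: "u \<in> words X k \<Longrightarrow> length u = k"
  by (simp add: words_def)

lemma permutes_words: "\<sigma> permutes words X l \<Longrightarrow> u \<in> words X l \<Longrightarrow> \<sigma> u \<in> words X l"
  using permutes_in_image by metis

lemma iota_words:
  assumes "\<sigma> permutes words X l" "l \<le> k" "u \<in> words X k"
  shows "\<iota> X l k \<sigma> u \<in> words X k" "take l (\<iota> X l k \<sigma> u) = \<sigma> (take l u)" "drop l (\<iota> X l k \<sigma> u) = drop l u"
proof -
  have s: "\<sigma> (take l u) \<in> words X l" using permutes_words take_words assms by metis
  show "\<iota> X l k \<sigma> u \<in> words X k"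
    using append_words[OF s drop_words[OF assms(3), of l]] assms by (simp add: \<iota>_def)
  show "take l (\<iota> X l k \<sigma> u) = \<sigma> (take l u)" "drop l (\<iota> X l k \<sigma> u) = drop l u"
    using length_words[OF s] assms by (simp_all add: \<iota>_def)
qed

lemma iota_comp:
  assumes "\<tau> permutes words X l" "l \<le> k"
  shows "\<iota> X l k (\<sigma> \<circ> \<tau>) = \<iota> X l k \<sigma> \<circ> \<iota> X l k \<tau>"
proof
  fix u
  show "\<iota> X l k (\<sigma> \<circ> \<tau>) u = (\<iota> X l k \<sigma> \<circ> \<iota> X l k \<tau>) u"
    using iota_words[OF assms, of u]
    by (cases "u \<in> words X k") (simp_all add: \<iota>_def)
qed

lemma iota_id: "\<iota> X l k id = id"
  by (auto simp: \<iota>_def)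

lemma iota_permutes:
  assumes "\<sigma> permutes words X l" "l \<le> k"
  shows "\<iota> X l k \<sigma> permutes words X k"
proof -
  have "\<iota> X l k \<sigma> \<circ> \<iota> X l k (inv' \<sigma>) = id" "\<iota> X l k (inv' \<sigma>) \<circ> \<iota> X l k \<sigma> = id"
    using iota_comp[OF permutes_inv[OF assms(1)] assms(2), of \<sigma>] iota_comp[OF assms, of "inv' \<sigma>"]
    by (simp_all add: permutes_inv_o[OF assms(1)] iota_id)
  then have "bij (\<iota> X l k \<sigma>)" using o_bij by blast
  then show ?thesis by (simp add: permutes_iff_bij \<iota>_def)
qed

lemma iota_evenperm:
  assumes "finite X" "\<sigma> permutes words X l" "evenperm \<sigma>" "l \<le> k"
  shows "evenperm (\<iota> X l k \<sigma>)"
  by (rule evenperm_hom_image[where f = "\<iota> X l k", OF finite_words[OF assms(1)]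
          finite_words[OF assms(1)] _ _ iota_id assms(2,3)])
     (use iota_permutes iota_comp assms(4) in blast)+

lemma iota_iota:
  assumes "\<sigma> permutes words X l" "l \<le> k" "k \<le> m"
  shows "\<iota> X k m (\<iota> X l k \<sigma>) = \<iota> X l m \<sigma>"
proof
  fix u
  show "\<iota> X k m (\<iota> X l k \<sigma>) u = \<iota> X l m \<sigma> u"
  proof (cases "u \<in> words X m")
    case True
    have "drop l (take k u) @ drop k u = drop l u"
      using assms(2) by (metis append_take_drop_id drop_drop drop_take le_add_diff_inverse2)
    then show ?thesis
      using True take_words[OF True assms(3)] assms(2) by (simp add: \<iota>_def min_def)
  qed (simp add: \<iota>_def)
qed

lemma iota_self: "\<sigma> permutes words X l \<Longrightarrow> \<iota> X l l \<sigma> = \<sigma>"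
  by (auto simp: \<iota>_def fun_eq_iff length_words permutes_def)

locale telescope =
  fixes x :: "nat \<Rightarrow> 'a" and d r :: nat
  assumes d_ge: "d \<ge> 5" and r_ge: "2 \<le> r" and r_le: "r \<le> d - 3"
    and inj_x: "inj_on x {1..d}"
begin

definition X :: "'a set" where "X = x ` {1..d}"

abbreviation W :: "nat \<Rightarrow> 'a list set" where "W \<equiv> words X"

definition base_points :: "'a list set" where
  "base_points = {[x i, x j] | i j. i \<in> {1..r} \<and> j \<in> {1..d}}"

lemma x_eq_iff: "i \<in> {1..d} \<Longrightarrow> j \<in> {1..d} \<Longrightarrow> x i = x j \<longleftrightarrow> i = j"
  by (rule inj_on_eq_iff[OF inj_x])

lemma x_mem: "i \<in> {1..d} \<Longrightarrow> x i \<in> X"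
  by (simp add: X_def)

lemma finite_W: "finite (W n)"
  by (simp add: finite_words X_def)

lemma card_W: "card (W n) = d ^ n"
  using card_words[of X n] card_image[OF inj_x] by (simp add: X_def)

lemma card_W_ge: "1 \<le> n \<Longrightarrow> card (W n) \<ge> 5"
  using power_increasing[of 1 n d] d_ge unfolding card_W by simp

lemma card_W_ge_2: "2 \<le> n \<Longrightarrow> card (W n) \<ge> d * d"
  using power_increasing[of 2 n d] d_ge unfolding card_W by (simp add: power2_eq_square)

lemma Omega_eq: "\<Omega> x d n = Alt (W n)"
  by (simp add: \<Omega>_def X_def)

lemma base_group_eq: "base_group x d r = Alt base_points"
  by (simp add: base_group_def base_points_def)

lemma r_less: "r + 3 \<le> d"
  using r_le d_ge by simp

lemma base_points_subset: "base_points \<subseteq> W 2"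
  using r_less by (auto simp: base_points_def words_def intro!: x_mem)

lemma finite_base_points: "finite base_points"
  using base_points_subset finite_W finite_subset by blast

lemma base_pointsI: "i \<in> {1..r} \<Longrightarrow> b \<in> X \<Longrightarrow> [x i, b] \<in> base_points"
  unfolding base_points_def X_def by blast

lemma card_base_points: "card base_points \<ge> 7"
proof -
  have "(\<lambda>(i, j). [x i, x j]) ` ({1..r} \<times> {1..d}) = base_points"
    unfolding base_points_def by fast
  moreover have "inj_on (\<lambda>(i, j). [x i, x j]) ({1..r} \<times> {1..d})"
    using r_less by (intro inj_onI) (auto simp: x_eq_iff)
  ultimately have "card base_points = r * d"
    using card_image by fastforce
  moreover have "2 * 5 \<le> r * d" by (rule mult_le_mono) (use r_ge d_ge in auto)
  ultimately show ?thesis by simp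
qed

abbreviation ray :: "nat \<Rightarrow> 'a list" where "ray n \<equiv> replicate n (x d)"

lemma xd: "x d \<in> X"
  using d_ge by (intro x_mem) simp

lemma ray_words: "ray n \<in> W n"
  using xd by (auto simp: words_def)

lemma phi_ray:
  assumes "\<sigma> permutes W 2" "2 \<le> l" "u \<in> W 2"
  shows "phi x d l \<sigma> (ray (l - 2) @ u) = ray (l - 2) @ \<sigma> u"
proof -
  have "l - 2 + 2 = l" using assms(2) by simp
  then show ?thesis
    using append_words[OF ray_words[of "l - 2"] assms(3)] by (simp add: phi_def X_def[symmetric] del: One_nat_def)
qed

lemma phi_cases:
  assumes "2 \<le> l"
  obtains v where "v \<in> W 2" "u = ray (l - 2) @ v" | "\<And>\<sigma>. phi x d l \<sigma> u = u"
proof (cases "u \<in> W l \<and> take (l - 2) u = ray (l - 2)")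
  case True
  then have "drop (l - 2) u \<in> W 2" using drop_words[of u X l "l - 2"] assms by simp
  moreover have "u = ray (l - 2) @ drop (l - 2) u" using True by (metis append_take_drop_id)
  ultimately show ?thesis using that(1) by blast
next
  case False
  then show ?thesis by (intro that(2)) (auto simp: phi_def X_def)
qed

lemma phi_comp:
  assumes "\<sigma> permutes W 2" "\<tau> permutes W 2" "2 \<le> l"
  shows "phi x d l (\<sigma> \<circ> \<tau>) = phi x d l \<sigma> \<circ> phi x d l \<tau>"
proof
  fix u
  show "phi x d l (\<sigma> \<circ> \<tau>) u = (phi x d l \<sigma> \<circ> phi x d l \<tau>) u"
    by (cases u rule: phi_cases[OF assms(3)])
       (use assms permutes_words[OF assms(2)] permutes_compose[OF assms(2,1)] in \<open>auto simp: phi_ray\<close>)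
qed

lemma phi_id: "phi x d l id = id"
  by (simp add: phi_def fun_eq_iff) (metis append_take_drop_id)

lemma phi_permutes:
  assumes "\<sigma> permutes W 2" "2 \<le> l"
  shows "phi x d l \<sigma> permutes W l"
proof -
  have "phi x d l \<sigma> \<circ> phi x d l (inv' \<sigma>) = id" "phi x d l (inv' \<sigma>) \<circ> phi x d l \<sigma> = id"
    using phi_comp[OF assms(1) permutes_inv[OF assms(1)] assms(2)]
      phi_comp[OF permutes_inv[OF assms(1)] assms]
    by (simp_all add: permutes_inv_o[OF assms(1)] phi_id)
  then have "bij (phi x d l \<sigma>)" using o_bij by blast
  then show ?thesis by (simp add: permutes_iff_bij phi_def X_def)
qed

lemma phi_evenperm:
  assumes "\<sigma> permutes W 2" "evenperm \<sigma>" "2 \<le> l"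
  shows "evenperm (phi x d l \<sigma>)"
  by (rule evenperm_hom_image[where f = "phi x d l", OF finite_W finite_W _ _ phi_id assms(1,2)])
     (use phi_permutes phi_comp assms(3) in blast)+

abbreviation Om :: "nat \<Rightarrow> ('a list \<Rightarrow> 'a list) set" where "Om n \<equiv> carrier (Alt (W n))"

abbreviation B :: "('a list \<Rightarrow> 'a list) set" where "B \<equiv> carrier (Alt base_points)"

lemma B_permutes_W: "g \<in> B \<Longrightarrow> g permutes W 2"
  using base_points_subset permutes_subset by auto

lemma phi_Om: "g \<in> B \<Longrightarrow> 2 \<le> l \<Longrightarrow> phi x d l g \<in> Om l"
  using B_permutes_W phi_permutes phi_evenperm by auto

lemma iota_Om: "\<sigma> \<in> Om l \<Longrightarrow> l \<le> k \<Longrightarrow> \<iota> X l k \<sigma> \<in> Om k"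
  by (simp add: iota_permutes iota_evenperm X_def)

lemma group_Om: "group (Alt (W n))"
  by (rule group_Alt[OF finite_W])

lemma group_B: "group (Alt base_points)"
  by (rule group_Alt[OF finite_base_points])

lemma comp_Om: "\<sigma> \<in> Om n \<Longrightarrow> \<tau> \<in> Om n \<Longrightarrow> \<sigma> \<circ> \<tau> \<in> Om n"
  using group.subgroup_self[OF group_Om] Alt_subgroup_comp finite_W by blast

lemma inv_Om: "\<sigma> \<in> Om n \<Longrightarrow> inv' \<sigma> \<in> Om n"
  using group.subgroup_self[OF group_Om] Alt_subgroup_inv finite_W by blast

lemma id_Om: "id \<in> Om n"
  by (simp add: permutes_id)

lemma comp_B: "\<sigma> \<in> B \<Longrightarrow> \<tau> \<in> B \<Longrightarrow> \<sigma> \<circ> \<tau> \<in> B"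
  using group.subgroup_self[OF group_B] Alt_subgroup_comp finite_base_points by blast

lemma inv_B: "\<sigma> \<in> B \<Longrightarrow> inv' \<sigma> \<in> B"
  using group.subgroup_self[OF group_B] Alt_subgroup_inv finite_base_points by blast

section \<open>The product\<close>

definition P :: "(nat \<Rightarrow> 'a list \<Rightarrow> 'a list) monoid" where
  "P = full_product (\<Omega> x d)"

lemma P_mem: "p \<in> carrier P \<longleftrightarrow> p \<in> extensional {1..} \<and> (\<forall>i\<ge>1. p i \<in> Om i)"
  by (auto simp: P_def Omega_eq PiE_iff simp del: mem_carrier_Alt)

lemma P_component: "p \<in> carrier P \<Longrightarrow> 1 \<le> i \<Longrightarrow> p i \<in> Om i"
  by (simp only: P_mem)

lemma P_permutes: "p \<in> carrier P \<Longrightarrow> 1 \<le> i \<Longrightarrow> p i permutes W i"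
  using P_component[of p i] by simp

lemma P_mult: "1 \<le> i \<Longrightarrow> (p \<otimes>\<^bsub>P\<^esub> q) i = p i \<circ> q i"
  by (simp add: P_def Omega_eq)

lemma P_one: "1 \<le> i \<Longrightarrow> \<one>\<^bsub>P\<^esub> i = id"
  by (simp add: P_def Omega_eq)

lemma group_P: "group P"
  unfolding P_def by (intro product_group) (simp add: Omega_eq group_Om)

abbreviation mult_P (infixl "\<cdot>" 70) where "p \<cdot> q \<equiv> p \<otimes>\<^bsub>P\<^esub> q"

sublocale P: group P
  by (rule group_P)

lemma P_inv:
  assumes "p \<in> carrier P" "1 \<le> i"
  shows "(inv\<^bsub>P\<^esub> p) i = inv' (p i)"
proof -
  have "inv\<^bsub>P\<^esub> p = (\<lambda>i\<in>{1..}. inv\<^bsub>\<Omega> x d i\<^esub> (p i))"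
    unfolding P_def
    by (rule inv_product_group) (use assms(1) group_Om in \<open>simp_all add: P_def Omega_eq\<close>)
  then have "(inv\<^bsub>P\<^esub> p) i = inv\<^bsub>Alt (W i)\<^esub> (p i)"
    using assms(2) by (simp add: Omega_eq)
  then show ?thesis
    using P_component[OF assms] inv_Alt[OF finite_W] by simp
qed

lemma P_eqI:
  assumes "p \<in> carrier P" "q \<in> carrier P" "\<And>i. 1 \<le> i \<Longrightarrow> p i = q i"
  shows "p = q"
proof
  fix i show "p i = q i"
    using assms by (cases "1 \<le> i") (auto simp: P_mem extensional_def)
qed


section \<open>Spread and directed elements\<close>

text \<open>
  At \<open>n = 1\<close> these are the two families of generators of the group of the telescope.
\<close>

definition spread :: "nat \<Rightarrow> ('a list \<Rightarrow> 'a list) \<Rightarrow> nat \<Rightarrow> 'a list \<Rightarrow> 'a list" where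
  "spread n \<omega> = (\<lambda>i\<in>{1..}. if i < n then id else \<iota> X n i \<omega>)"

definition directed :: "nat \<Rightarrow> ('a list \<Rightarrow> 'a list) \<Rightarrow> nat \<Rightarrow> 'a list \<Rightarrow> 'a list" where
  "directed n g = (\<lambda>i\<in>{1..}. foldr (\<lambda>k p. \<iota> X k i (phi x d k g) \<circ> p) [Suc n..<Suc i] id)"

text \<open>
  An analogue of the rigid stabilizers of a group acting on a rooted tree. Elements for disjoint sets of
  prefixes commute (\<open>rist_commute\<close>), and all computations of commutators below rest on this.
\<close>

definition rist :: "nat \<Rightarrow> 'a list set \<Rightarrow> (nat \<Rightarrow> 'a list \<Rightarrow> 'a list) set" where
  "rist n A = {p \<in> carrier P. \<forall>i\<ge>1. \<forall>u. i < n \<or> take n u \<notin> A \<longrightarrow> p i u = u}"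

lemma spread_apply: "1 \<le> i \<Longrightarrow> spread n \<omega> i = (if i < n then id else \<iota> X n i \<omega>)"
  by (simp add: spread_def)

lemma spread_closed: "\<omega> \<in> Om n \<Longrightarrow> spread n \<omega> \<in> carrier P"
  using iota_Om[of \<omega> n] id_Om by (auto simp: P_mem spread_def simp del: mem_carrier_Alt)

lemma spread_hom: "spread n \<in> hom (Alt (W n)) P"
proof (rule homI)
  fix \<omega> \<tau> assume o: "\<omega> \<in> Om n" "\<tau> \<in> Om n"
  show "spread n (\<omega> \<otimes>\<^bsub>Alt (W n)\<^esub> \<tau>) = spread n \<omega> \<cdot> spread n \<tau>"
  proof (rule P_eqI)
    fix i :: nat assume "1 \<le> i"
    then show "spread n (\<omega> \<otimes>\<^bsub>Alt (W n)\<^esub> \<tau>) i = (spread n \<omega> \<cdot> spread n \<tau>) i"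
      using iota_comp[of \<tau> X n i \<omega>] o by (simp add: P_mult spread_apply)
  qed (use o comp_Om spread_closed P.m_closed in \<open>auto simp del: mem_carrier_Alt\<close>)
qed (rule spread_closed)

lemma spread_group_hom: "group_hom (Alt (W n)) P (spread n)"
  using spread_hom group_Om group_P by (simp add: group_hom_def group_hom_axioms_def)

lemma spread_mult: "\<omega> \<in> Om n \<Longrightarrow> \<tau> \<in> Om n \<Longrightarrow> spread n (\<omega> \<circ> \<tau>) = spread n \<omega> \<cdot> spread n \<tau>"
  using hom_mult[OF spread_hom] by simp

lemma spread_inv: "\<omega> \<in> Om n \<Longrightarrow> spread n (inv' \<omega>) = inv\<^bsub>P\<^esub> (spread n \<omega>)"
  using group_hom.hom_inv[OF spread_group_hom, of \<omega> n] inv_Alt[OF finite_W] by simp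

text \<open>
  The recursion is on the level \<open>n\<close> at a fixed coordinate \<open>i\<close>; it ends because \<open>directed n g\<close> is trivial up
  to level \<open>n\<close>.
\<close>

lemma directed_step:
  assumes "1 \<le> i"
  shows "directed n g i = (if i \<le> n then id else \<iota> X (Suc n) i (phi x d (Suc n) g) \<circ> directed (Suc n) g i)"
  using assms upt_conv_Cons[of "Suc n" "Suc i"] by (auto simp: directed_def simp del: upt_Suc)

lemma directed_closed:
  assumes g: "g \<in> B" and n: "1 \<le> n"
  shows "directed n g \<in> carrier P"
proof -
  have "directed n g i \<in> Om i" if i: "1 \<le> i" for i
    using n
  proof (induction "i - n" arbitrary: n)
    case 0
    then have "directed n g i = id" using directed_step[OF i, of n g] by simp
    then show ?case using id_Om by metis
  next
    case (Suc m)
    have "\<iota> X (Suc n) i (phi x d (Suc n) g) \<in> Om i"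
      by (rule iota_Om[OF phi_Om[OF g]]) (use Suc in auto)
    moreover have "directed (Suc n) g i \<in> Om i" using Suc by simp
    ultimately show ?case
      using comp_Om id_Om directed_step[OF i, of n g] by metis
  qed
  then show ?thesis by (simp add: P_mem directed_def del: mem_carrier_Alt)
qed

lemma spread_phi_closed: "g \<in> B \<Longrightarrow> 1 \<le> n \<Longrightarrow> spread (Suc n) (phi x d (Suc n) g) \<in> carrier P"
  by (rule spread_closed[OF phi_Om]) auto

lemma directed_split:
  assumes "g \<in> B" "1 \<le> n"
  shows "directed n g = spread (Suc n) (phi x d (Suc n) g) \<cdot> directed (Suc n) g"
proof (rule P_eqI)
  fix i :: nat assume i: "1 \<le> i"
  show "directed n g i = (spread (Suc n) (phi x d (Suc n) g) \<cdot> directed (Suc n) g) i"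
    using directed_step[OF i, of n g] directed_step[OF i, of "Suc n" g] i
    by (auto simp: P_mult spread_apply)
qed (use assms directed_closed spread_phi_closed P.m_closed in auto)

subsection \<open>Supports\<close>

lemma rist_closed: "p \<in> rist n A \<Longrightarrow> p \<in> carrier P"
  by (simp add: rist_def)

lemma rist_fixed: "p \<in> rist n A \<Longrightarrow> 1 \<le> i \<Longrightarrow> i < n \<or> take n u \<notin> A \<Longrightarrow> p i u = u"
  unfolding rist_def by blast

lemma rist_mono: "A \<subseteq> A' \<Longrightarrow> rist n A \<subseteq> rist n A'"
  by (auto simp: rist_def)

lemma rist_mult: "p \<in> rist n A \<Longrightarrow> q \<in> rist n A \<Longrightarrow> p \<cdot> q \<in> rist n A"
  by (simp add: rist_def P_mult)

lemma rist_commute: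
  assumes p: "p \<in> rist n A" and q: "q \<in> rist n A'" and disj: "A \<inter> A' = {}"
  shows "p \<cdot> q = q \<cdot> p"
proof (rule P_eqI)
  fix i :: nat assume i: "1 \<le> i"
  have inj: "p i z = p i z' \<longleftrightarrow> z = z'" "q i z = q i z' \<longleftrightarrow> z = z'" for z z'
    using P_permutes[OF rist_closed[OF p] i] P_permutes[OF rist_closed[OF q] i] permutes_inj
    by (metis inj_eq)+
  have "p i (q i u) = q i (p i u)" for u
  proof (cases "p i u = u")
    case True
    show ?thesis
    proof (cases "q i u = u")
      case False
      then have "q i (q i u) \<noteq> q i u" using inj by metis
      then have "take n (q i u) \<in> A'" using rist_fixed[OF q i] by blast
      moreover have "\<not> i < n" using rist_fixed[OF q i] False by blast
      ultimately have "p i (q i u) = q i u" using rist_fixed[OF p i] disj by blast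
      then show ?thesis using True by simp
    qed (use True in simp)
  next
    case False
    then have "p i (p i u) \<noteq> p i u" using inj by metis
    then have "take n (p i u) \<in> A" "take n u \<in> A" using False rist_fixed[OF p i] by blast+
    then have "q i (p i u) = p i u" "q i u = u" using rist_fixed[OF q i] disj by blast+
    then show ?thesis by simp
  qed
  then show "(p \<cdot> q) i = (q \<cdot> p) i" using i by (auto simp: P_mult)
qed (use rist_closed[OF p] rist_closed[OF q] P.m_closed in auto)

lemma rist_conj:
  assumes \<omega>: "\<omega> \<in> Om n" and p: "p \<in> rist n A"
  shows "spread n \<omega> \<cdot> p \<cdot> inv\<^bsub>P\<^esub> (spread n \<omega>) \<in> rist n (\<omega> ` A)"
  unfolding rist_def
proof (intro CollectI conjI allI impI)
  show "spread n \<omega> \<cdot> p \<cdot> inv\<^bsub>P\<^esub> spread n \<omega> \<in> carrier P"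
    using spread_closed[OF \<omega>] rist_closed[OF p] by simp
  fix i :: nat and u assume i: "1 \<le> i" and u: "i < n \<or> take n u \<notin> \<omega> ` A"
  define f where "f = spread n \<omega> i"
  have f: "f permutes W i" unfolding f_def by (rule P_permutes[OF spread_closed[OF \<omega>] i])
  define v where "v = inv' f u"
  have fv: "f v = u" unfolding v_def using f by (simp add: permutes_inverses)
  have pv: "p i v = v"
  proof (cases "i < n \<or> v \<notin> W i")
    case True
    then show ?thesis
      using rist_fixed[OF p i] P_permutes[OF rist_closed[OF p] i] by (auto simp: permutes_def)
  next
    case False
    have "\<omega> permutes W n" using \<omega> by simp
    then have "take n u = \<omega> (take n v)"
      using iota_words(2)[of \<omega> X n i v] False fv i unfolding f_def by (simp add: spread_apply)
    then show ?thesis using u False rist_fixed[OF p i] by blast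
  qed
  have "(spread n \<omega> \<cdot> p \<cdot> inv\<^bsub>P\<^esub> spread n \<omega>) i u = f (p i v)"
    using i P_inv[OF spread_closed[OF \<omega>] i] by (simp add: P_mult f_def v_def)
  then show "(spread n \<omega> \<cdot> p \<cdot> inv\<^bsub>P\<^esub> spread n \<omega>) i u = u"
    using pv fv by simp
qed

lemma spread_rist:
  assumes "\<omega> \<in> Om n" "\<And>v. v \<notin> A \<Longrightarrow> \<omega> v = v"
  shows "spread n \<omega> \<in> rist n A"
  unfolding rist_def
proof (intro CollectI conjI allI impI spread_closed assms(1))
  fix i :: nat and u assume "1 \<le> i" "i < n \<or> take n u \<notin> A"
  then show "spread n \<omega> i u = u" using assms(2)[of "take n u"] by (auto simp: spread_apply \<iota>_def)
qed

text \<open>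
  The first copy of \<open>g\<close> in \<open>directed n g\<close> moves words below the branches \<open>a \<le> r\<close>, the other copies
  move words below the branch \<open>a = d\<close>, which is the ray itself.
\<close>

definition branch :: "nat \<Rightarrow> nat \<Rightarrow> 'a list" where
  "branch n a = ray (n - 1) @ [x a]"

definition side :: "nat \<Rightarrow> 'a list set" where
  "side n = branch n ` {1..r}"

definition directed_support :: "nat \<Rightarrow> 'a list set" where
  "directed_support n = insert (ray n) (side n)"

lemma branch_eq_iff: "a \<in> {1..d} \<Longrightarrow> b \<in> {1..d} \<Longrightarrow> branch n a = branch n b \<longleftrightarrow> a = b"
  by (simp add: branch_def x_eq_iff)

lemma branch_d: "1 \<le> n \<Longrightarrow> branch n d = ray n"
  by (cases n) (simp_all add: branch_def replicate_append_same)

lemma branch_words: "a \<in> {1..d} \<Longrightarrow> 1 \<le> n \<Longrightarrow> branch n a \<in> W n"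
  using append_words[OF ray_words[of "n - 1"], of "[x a]" 1] x_mem[of a] by (simp add: branch_def words_def)

lemma spread_phi_rist:
  assumes g: "g \<in> B" and n: "1 \<le> n"
  shows "spread (Suc n) (phi x d (Suc n) g) \<in> rist n (side n)"
  unfolding rist_def
proof (intro CollectI conjI allI impI spread_phi_closed g n)
  fix i :: nat and u assume i: "1 \<le> i" and u: "i < n \<or> take n u \<notin> side n"
  show "spread (Suc n) (phi x d (Suc n) g) i u = u"
  proof (cases "i < Suc n \<or> u \<notin> W i")
    case False
    define u' where "u' = take (Suc n) u"
    have tk: "take n u' \<notin> side n" using u False by (simp add: u'_def min_def)
    have l: "2 \<le> Suc n" using n by simp
    have "phi x d (Suc n) g u' = u'"
    proof (cases u' rule: phi_cases[OF l])
      case (1 v)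
      have "v \<notin> base_points"
      proof
        assume "v \<in> base_points"
        then obtain a b where ab: "v = [x a, x b]" "a \<in> {1..r}" by (auto simp: base_points_def)
        then have "take n u' = branch n a" using 1 n by (cases n) (auto simp: branch_def)
        then show False using tk ab by (auto simp: side_def)
      qed
      then have "g v = v" using g by (auto simp: permutes_def)
      then show ?thesis using phi_ray[OF B_permutes_W[OF g], of "Suc n" v] 1 n by simp
    qed auto
    then show ?thesis using False i by (simp add: spread_apply \<iota>_def u'_def[symmetric]) (simp add: u'_def)
  qed (auto simp: spread_apply[OF i] \<iota>_def)
qed

lemma directed_rist_ray:
  assumes g: "g \<in> B" and n: "1 \<le> n" "n < m"
  shows "directed m g \<in> rist n {ray n}"
  unfolding rist_def
proof (intro CollectI conjI allI impI)
  show "directed m g \<in> carrier P" using directed_closed[OF g] n by simp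
  fix i :: nat and u assume i: "1 \<le> i" and u: "i < n \<or> take n u \<notin> {ray n}"
  have factor: "\<iota> X k i (phi x d k g) u = u" if k: "m < k" "k \<le> i" for k
  proof -
    have l: "2 \<le> k" using k n by simp
    have "phi x d k g (take k u) = take k u"
    proof (cases "take k u" rule: phi_cases[OF l])
      case (1 v)
      have "take n (take k u) = take n (ray (k - 2) @ v)" using 1 by simp
      then have "take n u = ray n" using k n by (simp add: min_def)
      then show ?thesis using u k n by simp
    qed auto
    then show ?thesis by (simp add: \<iota>_def)
  qed
  have fold: "foldr (\<lambda>k p. f k \<circ> p) ks id u = u" if "\<forall>k\<in>set ks. f k u = u"
    for f :: "nat \<Rightarrow> 'a list \<Rightarrow> 'a list" and ks
    using that by (induction ks) auto
  show "directed m g i u = u"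
    unfolding directed_def restrict_apply'[OF atLeast_iff[THEN iffD2, OF i]]
    by (rule fold) (use factor in auto)
qed

lemma directed_rist:
  assumes g: "g \<in> B" and n: "1 \<le> n"
  shows "directed n g \<in> rist n (directed_support n)"
proof -
  have "spread (Suc n) (phi x d (Suc n) g) \<in> rist n (directed_support n)"
    by (rule subsetD[OF rist_mono spread_phi_rist[OF assms]]) (auto simp: directed_support_def)
  moreover have "directed (Suc n) g \<in> rist n (directed_support n)"
    by (rule subsetD[OF rist_mono directed_rist_ray[OF g n]]) (auto simp: directed_support_def)
  ultimately show ?thesis using directed_split[OF assms] rist_mult by simp
qed

lemma ray_not_side: "1 \<le> n \<Longrightarrow> ray n \<notin> side n"
proof
  assume n: "1 \<le> n" and "ray n \<in> side n"
  then obtain a where "a \<in> {1..r}" "branch n a = branch n d"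
    using branch_d by (auto simp: side_def)
  then show False using branch_eq_iff[of a d n] r_less by simp
qed

text \<open>
  The copies of \<open>g\<close> and \<open>h\<close> on different levels have disjoint supports, so the two products can be
  interleaved.
\<close>

lemma directed_hom_pointwise:
  assumes gh: "g \<in> B" "h \<in> B" and i: "1 \<le> i" and n: "1 \<le> n"
  shows "directed n (g \<circ> h) i = directed n g i \<circ> directed n h i"
  using n
proof (induction "i - n" arbitrary: n)
  case 0
  then show ?case using i by (simp add: directed_step)
next
  case (Suc m)
  let ?s = "\<lambda>g. spread (Suc n) (phi x d (Suc n) g)"
  have ni: "n < i" using Suc.hyps(2) by linarith
  have s: "?s g i = \<iota> X (Suc n) i (phi x d (Suc n) g)" for g
    using ni by (simp add: spread_apply[OF i])
  have g2: "g permutes W 2" "h permutes W 2" using gh B_permutes_W by auto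
  have "?s (g \<circ> h) i = ?s g i \<circ> ?s h i"
    unfolding s using phi_comp[OF g2, of "Suc n"] iota_comp[OF phi_permutes[OF g2(2)], of "Suc n" i] Suc.prems ni by simp
  moreover have "directed (Suc n) (g \<circ> h) i = directed (Suc n) g i \<circ> directed (Suc n) h i"
    using Suc by simp
  moreover have "?s h i \<circ> directed (Suc n) g i = directed (Suc n) g i \<circ> ?s h i"
    using rist_commute[OF spread_phi_rist[OF gh(2)] directed_rist_ray[OF gh(1)], of n "Suc n"]
      ray_not_side[of n] Suc.prems P_mult[OF i] by (metis Int_insert_right inf_bot_right lessI)
  moreover have "directed n k i = ?s k i \<circ> directed (Suc n) k i" for k
    using directed_step[OF i, of n k] s ni by simp
  ultimately show ?case by (simp add: fun_eq_iff)
qed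

lemma directed_hom:
  assumes "1 \<le> n"
  shows "directed n \<in> hom (Alt base_points) P"
proof (rule homI)
  fix g h assume gh: "g \<in> B" "h \<in> B"
  show "directed n (g \<otimes>\<^bsub>Alt base_points\<^esub> h) = directed n g \<cdot> directed n h"
  proof (rule P_eqI)
    fix i :: nat assume "1 \<le> i"
    then show "directed n (g \<otimes>\<^bsub>Alt base_points\<^esub> h) i = (directed n g \<cdot> directed n h) i"
      using directed_hom_pointwise[OF gh _ assms] by (simp add: P_mult)
  qed (use gh comp_B directed_closed assms P.m_closed in \<open>auto simp del: mem_carrier_Alt\<close>)
qed (rule directed_closed[OF _ assms])

lemma directed_group_hom: "1 \<le> n \<Longrightarrow> group_hom (Alt base_points) P (directed n)"
  using directed_hom group_B group_P by (simp add: group_hom_def group_hom_axioms_def)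

lemma directed_mult:
  "1 \<le> n \<Longrightarrow> g \<in> B \<Longrightarrow> h \<in> B \<Longrightarrow> directed n (g \<circ> h) = directed n g \<cdot> directed n h"
  using hom_mult[OF directed_hom] by simp

lemma directed_inv: "1 \<le> n \<Longrightarrow> g \<in> B \<Longrightarrow> directed n (inv' g) = inv\<^bsub>P\<^esub> (directed n g)"
  using group_hom.hom_inv[OF directed_group_hom, of n g] inv_Alt[OF finite_base_points] by simp

lemma directed_id: "1 \<le> n \<Longrightarrow> directed n id = \<one>\<^bsub>P\<^esub>"
  using group_hom.hom_one[OF directed_group_hom, of n] by simp

end

section \<open>The groups generated from a level on\<close>

lemma (in group) mult_commuting_pairs:
  assumes "a \<in> carrier G" "b \<in> carrier G" "c \<in> carrier G" "e \<in> carrier G" "b \<otimes> c = c \<otimes> b"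
  shows "(a \<otimes> b) \<otimes> (c \<otimes> e) = (a \<otimes> c) \<otimes> (b \<otimes> e)"
  using assms by (metis m_assoc m_closed)

lemma (in group) commutator_eq_quotient:
  assumes "a \<in> carrier G" "b \<in> carrier G"
  shows "a \<otimes> b \<otimes> inv a \<otimes> inv b = (a \<otimes> b) \<otimes> inv (b \<otimes> a)"
  using assms by (simp add: inv_mult_group m_assoc)

lemma (in group) commutator_commuting_factors:
  assumes c: "a \<in> carrier G" "a' \<in> carrier G" "b \<in> carrier G" "b' \<in> carrier G"
    and comm: "a' \<otimes> b = b \<otimes> a'" "a' \<otimes> b' = b' \<otimes> a'" "b' \<otimes> a = a \<otimes> b'"
  shows "(a \<otimes> a') \<otimes> (b \<otimes> b') \<otimes> inv (a \<otimes> a') \<otimes> inv (b \<otimes> b') = a \<otimes> b \<otimes> inv a \<otimes> inv b"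
proof -
  let ?z = "a' \<otimes> b'"
  have "(a \<otimes> a') \<otimes> (b \<otimes> b') \<otimes> inv (a \<otimes> a') \<otimes> inv (b \<otimes> b') =
      (a \<otimes> a') \<otimes> (b \<otimes> b') \<otimes> inv ((b \<otimes> b') \<otimes> (a \<otimes> a'))"
    using c by (simp add: commutator_eq_quotient)
  also have "\<dots> = (a \<otimes> b \<otimes> ?z) \<otimes> inv (b \<otimes> a \<otimes> ?z)"
    using mult_commuting_pairs[OF c comm(1)] mult_commuting_pairs[OF c(3,4,1,2) comm(3)] comm(2) by simp
  also have "\<dots> = (a \<otimes> b) \<otimes> inv (b \<otimes> a)"
  proof -
    have "u \<otimes> z \<otimes> inv (v \<otimes> z) = u \<otimes> inv v"
      if "u \<in> carrier G" "v \<in> carrier G" "z \<in> carrier G" for u v z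
    proof -
      have "z \<otimes> (inv z \<otimes> inv v) = inv v" using that by (simp add: m_assoc[symmetric])
      then show ?thesis using that by (simp add: inv_mult_group m_assoc)
    qed
    then show ?thesis using c by simp
  qed
  finally show ?thesis using c by (simp add: commutator_eq_quotient)
qed

text \<open>
  Modulo a normalized subgroup containing \<open>t\<close>, the element \<open>b\<close> equals its conjugate by \<open>t\<close>. If \<open>a\<close>
  commutes with the conjugate, it commutes with \<open>b\<close> modulo the subgroup.
\<close>

lemma (in group) commutator_in_normalized:
  assumes N: "subgroup N G" and c: "a \<in> carrier G" "b \<in> carrier G"
    and normal: "\<And>\<nu>. \<nu> \<in> N \<Longrightarrow> a \<otimes> \<nu> \<otimes> inv a \<in> N" "\<And>\<nu>. \<nu> \<in> N \<Longrightarrow> b \<otimes> \<nu> \<otimes> inv b \<in> N"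
    and t: "t \<in> N" and comm: "a \<otimes> (t \<otimes> b \<otimes> inv t) = (t \<otimes> b \<otimes> inv t) \<otimes> a"
  shows "a \<otimes> b \<otimes> inv a \<otimes> inv b \<in> N"
proof -
  define b' where "b' = t \<otimes> b \<otimes> inv t"
  have tc: "t \<in> carrier G" using t subgroup.mem_carrier[OF N] by blast
  have b'c: "b' \<in> carrier G" unfolding b'_def using c tc by simp
  define \<nu> where "\<nu> = b' \<otimes> inv b"
  have "\<nu> = t \<otimes> (b \<otimes> inv t \<otimes> inv b)" unfolding \<nu>_def b'_def using c tc by (simp add: m_assoc)
  then have \<nu>: "\<nu> \<in> N"
    using normal(2)[OF subgroup.m_inv_closed[OF N t]] subgroup.m_closed[OF N t] by simp
  have "a \<otimes> inv b' = inv b' \<otimes> a"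
    using comm b'c c(1) unfolding b'_def[symmetric] by (metis inv_solve_left inv_solve_right inv_closed m_closed m_assoc)
  then have "inv b' \<otimes> inv a = inv a \<otimes> inv b'"
    using b'c c(1) by (metis inv_solve_left inv_solve_right inv_closed m_closed m_assoc)
  moreover have "inv b' \<otimes> (b' \<otimes> inv b) = inv b"
    using c b'c by (simp add: m_assoc[symmetric])
  ultimately have "a \<otimes> inv \<nu> \<otimes> inv a \<otimes> \<nu> = a \<otimes> b \<otimes> inv a \<otimes> inv b"
    unfolding \<nu>_def using c b'c by (simp add: inv_mult_group m_assoc)
  then show ?thesis
    using subgroup.m_closed[OF N normal(1)[OF subgroup.m_inv_closed[OF N \<nu>]] \<nu>] by simp
qed

lemma (in group_hom) subgroup_preimage:
  assumes "subgroup K H"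
  shows "subgroup {a \<in> carrier G. h a \<in> K} G"
proof (rule G.subgroupI)
  show "{a \<in> carrier G. h a \<in> K} \<noteq> {}"
    using subgroup.one_closed[OF assms] hom_one G.one_closed by force
qed (use subgroup.m_closed[OF assms] subgroup.m_inv_closed[OF assms] in auto)

context telescope begin

text \<open>
  The group of the telescope, with its construction started at level \<open>n\<close> instead of level one.
\<close>

definition tele :: "nat \<Rightarrow> (nat \<Rightarrow> 'a list \<Rightarrow> 'a list) set" where
  "tele n = generate P (spread n ` Om n \<union> directed n ` B)"

lemma tele_generators: "1 \<le> n \<Longrightarrow> spread n ` Om n \<union> directed n ` B \<subseteq> carrier P"
  using spread_closed directed_closed by blast

lemma tele_subgroup: "1 \<le> n \<Longrightarrow> subgroup (tele n) P"
  unfolding tele_def by (rule P.generate_is_subgroup[OF tele_generators])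

lemma tele_least:
  assumes "subgroup N P" "\<And>\<omega>. \<omega> \<in> Om n \<Longrightarrow> spread n \<omega> \<in> N" "\<And>g. g \<in> B \<Longrightarrow> directed n g \<in> N"
  shows "tele n \<subseteq> N"
  unfolding tele_def by (rule P.generate_subgroup_incl[OF _ assms(1)]) (use assms in blast)

lemma spread_in_tele: "\<omega> \<in> Om n \<Longrightarrow> spread n \<omega> \<in> tele n"
  unfolding tele_def by (rule generate.incl) blast

lemma directed_in_tele: "g \<in> B \<Longrightarrow> directed n g \<in> tele n"
  unfolding tele_def by (rule generate.incl) blast

abbreviation local_part :: "nat \<Rightarrow> ('a list \<Rightarrow> 'a list) \<Rightarrow> nat \<Rightarrow> 'a list \<Rightarrow> 'a list" where
  "local_part n g \<equiv> spread (Suc n) (phi x d (Suc n) g)"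

lemma local_part_group_hom:
  assumes "1 \<le> n"
  shows "group_hom (Alt base_points) P (local_part n)"
proof -
  have "local_part n \<in> hom (Alt base_points) P"
  proof (rule homI)
    fix g h assume gh: "g \<in> B" "h \<in> B"
    have "phi x d (Suc n) (g \<circ> h) = phi x d (Suc n) g \<circ> phi x d (Suc n) h"
      by (rule phi_comp) (use gh B_permutes_W assms in auto)
    moreover have "phi x d (Suc n) g \<in> Om (Suc n)" "phi x d (Suc n) h \<in> Om (Suc n)"
      using phi_Om gh assms by (simp_all del: mem_carrier_Alt)
    ultimately show "local_part n (g \<otimes>\<^bsub>Alt base_points\<^esub> h) = local_part n g \<cdot> local_part n h"
      using spread_mult by simp
  qed (use assms spread_phi_closed in blast)
  then show ?thesis using group_B group_P by (simp add: group_hom_def group_hom_axioms_def)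
qed

text \<open>
  Rotating \<open>x\<^sub>d\<close> through the letters with indices \<open>d - 1\<close> and \<open>d - 2\<close>, which are not among the first
  \<open>r\<close>, moves the deeper part of a directed element away and leaves its local part in place. The
  commutator of two directed elements, one of them rotated, is therefore local.
\<close>

lemma commutator_local_part:
  assumes gh: "g \<in> B" "h \<in> B" and n: "1 \<le> n"
  shows "local_part n (g \<circ> h \<circ> inv' g \<circ> inv' h) \<in> tele n"
proof -
  define \<omega> where "\<omega> = three_cycle (ray n) (branch n (d - 1)) (branch n (d - 2))"
  have dd: "d - 1 \<in> {1..d}" "d - 2 \<in> {1..d}" "d \<in> {1..d}" using d_ge by auto
  have dist: "distinct [ray n, branch n (d - 1), branch n (d - 2)]"
    using branch_eq_iff dd d_ge branch_d[OF n] by (auto simp: branch_eq_iff[of d, symmetric])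
  have \<omega>: "\<omega> \<in> Om n"
    unfolding \<omega>_def using dist branch_words[OF _ n] dd ray_words[of n]
    by (auto intro!: three_cycle_permutes evenperm_three_cycle)
  have sub: "{ray n, branch n (d - 1), branch n (d - 2)} \<inter> side n = {}"
  proof -
    have "branch n k \<notin> side n" if "k \<in> {1..d}" "r < k" for k
    proof
      assume "branch n k \<in> side n"
      then obtain a where "a \<in> {1..r}" "branch n k = branch n a" by (auto simp: side_def)
      then show False using branch_eq_iff[OF that(1), of a n] that r_less by simp
    qed
    from this[OF dd(1)] this[OF dd(2)] show ?thesis using ray_not_side[OF n] r_less by simp
  qed
  let ?t = "spread n \<omega>"
  have t: "?t \<in> rist n {ray n, branch n (d - 1), branch n (d - 2)}"
    by (rule spread_rist[OF \<omega>]) (use dist in \<open>auto simp: \<omega>_def three_cycle_apply\<close>)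
  have tc: "?t \<in> carrier P" by (rule spread_closed[OF \<omega>])
  let ?a = "local_part n g" and ?a' = "directed (Suc n) g"
  let ?b = "local_part n h" and ?b' = "directed (Suc n) h"
  let ?c = "?t \<cdot> ?b' \<cdot> inv\<^bsub>P\<^esub> ?t"
  have ab: "?a \<in> rist n (side n)" "?b \<in> rist n (side n)" using gh n spread_phi_rist by auto
  have a'b': "?a' \<in> rist n {ray n}" "?b' \<in> rist n {ray n}" using gh n directed_rist_ray by auto
  have "\<omega> ` {ray n} = {branch n (d - 1)}" using dist by (simp add: \<omega>_def three_cycle_apply)
  then have c: "?c \<in> rist n {branch n (d - 1)}" using rist_conj[OF \<omega> a'b'(2)] by simp
  note cl = ab[THEN rist_closed] a'b'[THEN rist_closed] rist_closed[OF c]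
  have comm1: "?a' \<cdot> ?b = ?b \<cdot> ?a'"
    by (rule rist_commute[OF a'b'(1) ab(2)]) (use sub in auto)
  have comm2: "?a' \<cdot> ?c = ?c \<cdot> ?a'"
    by (rule rist_commute[OF a'b'(1) c]) (use dist in auto)
  have comm3: "?c \<cdot> ?a = ?a \<cdot> ?c"
    by (rule rist_commute[OF c ab(1)]) (use sub in auto)
  have comm4: "?t \<cdot> ?b = ?b \<cdot> ?t"
    by (rule rist_commute[OF t ab(2) sub])
  have "?t \<cdot> directed n h \<cdot> inv\<^bsub>P\<^esub> ?t = ?b \<cdot> ?c"
    unfolding directed_split[OF gh(2) n]
    using comm4 tc cl by (metis P.m_assoc P.m_closed P.inv_closed)
  moreover have "directed n g = ?a \<cdot> ?a'" by (rule directed_split[OF gh(1) n])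
  moreover have "directed n g \<cdot> (?t \<cdot> directed n h \<cdot> inv\<^bsub>P\<^esub> ?t) \<cdot> inv\<^bsub>P\<^esub> directed n g
      \<cdot> inv\<^bsub>P\<^esub> (?t \<cdot> directed n h \<cdot> inv\<^bsub>P\<^esub> ?t) \<in> tele n"
    using subgroup.m_closed[OF tele_subgroup[OF n]] subgroup.m_inv_closed[OF tele_subgroup[OF n]]
      spread_in_tele[OF \<omega>] directed_in_tele[of _ n] gh by simp
  ultimately have "?a \<cdot> ?b \<cdot> inv\<^bsub>P\<^esub> ?a \<cdot> inv\<^bsub>P\<^esub> ?b \<in> tele n"
    using P.commutator_commuting_factors[OF cl(1,3,2,5) comm1 comm2 comm3] by simp
  moreover interpret l: group_hom "Alt base_points" P "local_part n" by (rule local_part_group_hom[OF n])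
  have lp_inv: "local_part n (inv' k) = inv\<^bsub>P\<^esub> (local_part n k)" if "k \<in> B" for k
    using l.hom_inv[of k] inv_Alt[OF finite_base_points, of k] that by simp
  have "local_part n (g \<circ> h \<circ> inv' g \<circ> inv' h) = ?a \<cdot> ?b \<cdot> inv\<^bsub>P\<^esub> ?a \<cdot> inv\<^bsub>P\<^esub> ?b"
    using l.hom_mult[of "g \<circ> h \<circ> inv' g" "inv' h"] l.hom_mult[of "g \<circ> h" "inv' g"] l.hom_mult[of g h]
      lp_inv[OF gh(1)] lp_inv[OF gh(2)] comp_B[OF gh] comp_B[OF comp_B[OF gh] inv_B[OF gh(1)]]
      inv_B[OF gh(1)] inv_B[OF gh(2)] gh
    by (simp del: mem_carrier_Alt)
  ultimately show ?thesis by simp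
qed

lemma local_part_in_tele:
  assumes "g \<in> B" "1 \<le> n"
  shows "local_part n g \<in> tele n"
proof -
  let ?L = "{g \<in> B. local_part n g \<in> tele n}"
  have "?L = B"
  proof (rule Alt_perfect[OF finite_base_points card_base_points])
    show "subgroup ?L (Alt base_points)"
      by (rule group_hom.subgroup_preimage[OF local_part_group_hom[OF assms(2)] tele_subgroup[OF assms(2)]])
    show "\<sigma> \<circ> \<tau> \<circ> inv' \<sigma> \<circ> inv' \<tau> \<in> ?L" if "\<sigma> \<in> B" "\<tau> \<in> B" for \<sigma> \<tau>
      using commutator_local_part[OF that assms(2)] comp_B inv_B that by blast
  qed
  then show ?thesis using assms(1) by blast
qed

lemma spread_conj:
  assumes \<omega>: "\<omega> \<in> Om n" and \<sigma>: "\<sigma> \<in> Om (Suc n)" and n: "1 \<le> n"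
  shows "spread n \<omega> \<cdot> spread (Suc n) \<sigma> \<cdot> inv\<^bsub>P\<^esub> (spread n \<omega>) =
    spread (Suc n) (\<iota> X n (Suc n) \<omega> \<circ> \<sigma> \<circ> inv' (\<iota> X n (Suc n) \<omega>))"
proof -
  let ?o = "\<iota> X n (Suc n) \<omega>"
  have o: "?o \<in> Om (Suc n)" by (rule iota_Om[OF \<omega>]) simp
  have "spread (Suc n) (?o \<circ> \<sigma> \<circ> inv' ?o) =
      spread (Suc n) ?o \<cdot> spread (Suc n) \<sigma> \<cdot> inv\<^bsub>P\<^esub> (spread (Suc n) ?o)"
    using spread_mult[OF comp_Om[OF o \<sigma>] inv_Om[OF o]] spread_mult[OF o \<sigma>] spread_inv[OF o] by simp
  also have "\<dots> = spread n \<omega> \<cdot> spread (Suc n) \<sigma> \<cdot> inv\<^bsub>P\<^esub> (spread n \<omega>)"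
  proof (rule P_eqI)
    fix i :: nat assume i: "1 \<le> i"
    have bij: "p i \<circ> inv' (p i) = id" if "p \<in> carrier P" for p
      using permutes_inv_o(1)[OF P_permutes[OF that i]] .
    show "(spread (Suc n) ?o \<cdot> spread (Suc n) \<sigma> \<cdot> inv\<^bsub>P\<^esub> (spread (Suc n) ?o)) i =
        (spread n \<omega> \<cdot> spread (Suc n) \<sigma> \<cdot> inv\<^bsub>P\<^esub> (spread n \<omega>)) i"
    proof (cases "i \<le> n")
      case True
      then have "spread (Suc n) \<sigma> i = id" using spread_apply[OF i] by simp
      then show ?thesis
        using bij[OF spread_closed[OF o]] bij[OF spread_closed[OF \<omega>]] i
        by (simp add: P_mult P_inv spread_closed[OF o] spread_closed[OF \<omega>] del: mem_carrier_Alt)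
    next
      case False
      then have "spread (Suc n) ?o i = spread n \<omega> i"
        using iota_iota[of \<omega> X n "Suc n" i] \<omega> spread_apply[OF i] by simp
      then show ?thesis
        using i by (simp add: P_mult P_inv spread_closed[OF o] spread_closed[OF \<omega>] del: mem_carrier_Alt)
    qed
  qed (use spread_closed[OF \<omega>] spread_closed[OF o] spread_closed[OF \<sigma>] in auto)
  finally show ?thesis by simp
qed

lemma phi_three_cycle:
  assumes "{p, q, s} \<subseteq> W 2" "distinct [p, q, s]" "2 \<le> l"
  shows "phi x d l (three_cycle p q s) = three_cycle (ray (l - 2) @ p) (ray (l - 2) @ q) (ray (l - 2) @ s)"
proof
  fix u
  have \<tau>: "three_cycle p q s permutes W 2" by (rule three_cycle_permutes[OF assms(1)])
  have dist: "distinct [ray (l - 2) @ p, ray (l - 2) @ q, ray (l - 2) @ s]" using assms(2) by simp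
  show "phi x d l (three_cycle p q s) u = three_cycle (ray (l - 2) @ p) (ray (l - 2) @ q) (ray (l - 2) @ s) u"
  proof (cases u rule: phi_cases[OF assms(3)])
    case (1 v)
    show ?thesis
      unfolding 1(2) phi_ray[OF \<tau> assms(3) 1(1)] three_cycle_apply[OF dist] three_cycle_apply[OF assms(2)]
      by simp
  next
    case 2
    have "u \<noteq> ray (l - 2) @ z" if "z \<in> {p, q, s}" for z
    proof
      assume u: "u = ray (l - 2) @ z"
      have z: "z \<in> W 2" using that assms(1) by blast
      then have "three_cycle p q s z = z" using 2[of "three_cycle p q s"] phi_ray[OF \<tau> assms(3) z] u by simp
      then show False using that assms(2) by (auto simp: three_cycle_apply split: if_splits)
    qed
    then show ?thesis using 2 by (simp add: three_cycle_apply[OF dist])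
  qed
qed

text \<open>
  The local parts give the three-cycles on words that extend the branches \<open>1\<close> and \<open>2\<close> by one letter. An even
  permutation takes these two branches to any two words of length \<open>n\<close>, so the conjugates link any two
  words of length \<open>n + 1\<close>.
\<close>

lemma spread_Suc_in_tele:
  assumes "\<sigma> \<in> Om (Suc n)" and n: "1 \<le> n"
  shows "spread (Suc n) \<sigma> \<in> tele n"
proof -
  define K where "K = {\<sigma> \<in> Om (Suc n). spread (Suc n) \<sigma> \<in> tele n}"
  have K: "subgroup K (Alt (W (Suc n)))"
    unfolding K_def by (rule group_hom.subgroup_preimage[OF spread_group_hom tele_subgroup[OF n]])
  note tele = subgroup.m_closed[OF tele_subgroup[OF n]] subgroup.m_inv_closed[OF tele_subgroup[OF n]]
  have conj: "\<iota> X n (Suc n) \<omega> \<circ> \<sigma> \<circ> inv' (\<iota> X n (Suc n) \<omega>) \<in> K" if "\<omega> \<in> Om n" "\<sigma> \<in> K" for \<omega> \<sigma>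
  proof -
    have "\<sigma> \<in> Om (Suc n)" "spread (Suc n) \<sigma> \<in> tele n" using that(2) by (auto simp: K_def)
    moreover have "\<iota> X n (Suc n) \<omega> \<in> Om (Suc n)" by (rule iota_Om[OF that(1)]) simp
    ultimately show ?thesis
      using spread_conj[OF that(1) _ n, of \<sigma>, symmetric] spread_in_tele[OF that(1)] tele comp_Om inv_Om
      by (simp add: K_def del: mem_carrier_Alt)
  qed
  have iota: "\<iota> X n (Suc n) \<omega> (ray (n - 1) @ [x a, b]) = \<omega> (branch n a) @ [b]"
    if "\<omega> \<in> Om n" "a \<in> {1..d}" "b \<in> X" for \<omega> a b
  proof -
    have eq: "ray (n - 1) @ [x a, b] = branch n a @ [b]" by (simp add: branch_def)
    have "branch n a @ [b] \<in> W (Suc n)" "length (branch n a) = n"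
      using append_words[OF branch_words[OF that(2) n], of "[b]" 1] that n by (auto simp: words_def branch_def)
    then show ?thesis unfolding eq by (simp add: \<iota>_def)
  qed
  have base: "three_cycle (\<omega> (branch n a) @ [b]) (\<omega> (branch n a') @ [b']) (\<omega> (branch n a'') @ [b'']) \<in> K"
    if "\<omega> \<in> Om n" and dist: "distinct [[x a, b], [x a', b'], [x a'', b'']]"
      and mem: "{a, a', a''} \<subseteq> {1..r}" "{b, b', b''} \<subseteq> X"
    for \<omega> a b a' b' a'' b''
  proof -
    let ?\<tau> = "three_cycle [x a, b] [x a', b'] [x a'', b'']"
    let ?o = "\<iota> X n (Suc n) \<omega>"
    have pts: "{[x a, b], [x a', b'], [x a'', b'']} \<subseteq> base_points" using mem base_pointsI by auto
    have \<tau>: "?\<tau> \<in> B" using three_cycle_permutes[OF pts] evenperm_three_cycle[OF dist] by simp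
    have "phi x d (Suc n) ?\<tau> \<in> K"
      unfolding K_def using local_part_in_tele[OF \<tau> n] phi_Om[OF \<tau>] n by simp
    moreover have "phi x d (Suc n) ?\<tau> = three_cycle (ray (n - 1) @ [x a, b]) (ray (n - 1) @ [x a', b']) (ray (n - 1) @ [x a'', b''])"
      using phi_three_cycle[OF subset_trans[OF pts base_points_subset] dist, of "Suc n"] n by simp
    ultimately have "?o \<circ> three_cycle (ray (n - 1) @ [x a, b]) (ray (n - 1) @ [x a', b']) (ray (n - 1) @ [x a'', b'']) \<circ> inv' ?o \<in> K"
      using conj[OF that(1)] by simp
    moreover have bij: "bij ?o" using iota_Om[OF that(1), of "Suc n"] permutes_bij by auto
    have ad: "{a, a', a''} \<subseteq> {1..d}" using mem(1) r_less by auto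
    have e: "?o (ray (n - 1) @ [x a, b]) = \<omega> (branch n a) @ [b]"
      "?o (ray (n - 1) @ [x a', b']) = \<omega> (branch n a') @ [b']"
      "?o (ray (n - 1) @ [x a'', b'']) = \<omega> (branch n a'') @ [b'']"
      by (rule iota[OF that(1)], use ad mem(2) in blast, use ad mem(2) in blast)+
    ultimately show ?thesis by (simp only: conj_three_cycle[OF bij] e)
  qed
  have r2: "1 \<in> {1..r}" "2 \<in> {1..r}" "1 \<in> {1..d}" "2 \<in> {1..d}" using r_ge d_ge by auto
  have x12: "x 1 \<noteq> x 2" using x_eq_iff[OF r2(3,4)] by simp
  have "K = Om (Suc n)"
  proof (rule Alt_eqI_linked[OF finite_W K])
    fix p q assume pq: "p \<in> W (Suc n)" "q \<in> W (Suc n)" "p \<noteq> q"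
    obtain v b where p: "p = v @ [b]" using pq(1) by (cases p rule: rev_cases) (auto simp: words_def)
    obtain v' b' where q: "q = v' @ [b']" using pq(2) by (cases q rule: rev_cases) (auto simp: words_def)
    have vb: "v \<in> W n" "b \<in> X" "v' \<in> W n" "b' \<in> X" using pq p q by (auto simp: words_def)
    have br: "branch n 1 \<in> W n" "branch n 2 \<in> W n" "branch n 1 \<noteq> branch n 2"
      using branch_words[OF _ n] r2 branch_eq_iff[OF r2(3,4)] by auto
    have card: "card (W n) \<ge> 4" using card_W_ge[OF n] by simp
    show "\<exists>s. distinct [p, q, s] \<and> three_cycle p q s \<in> K"
    proof (cases "v = v'")
      case True
      obtain w where w: "w \<in> W n" "w \<notin> {v}"
        using ex_not_in_of_card_less[of "{v}" "W n"] card by auto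
      obtain \<omega> where \<omega>: "\<omega> permutes W n" "evenperm \<omega>" "\<omega> (branch n 1) = v" "\<omega> (branch n 2) = w"
        using Alt_two_transitive[OF finite_W card, of "branch n 1" "branch n 2" v w] br vb w by auto
      have "three_cycle (v @ [b]) (v @ [b']) (w @ [b]) \<in> K"
        using base[of \<omega> 1 b 1 b' 2 b] \<omega> True p q pq(3) x12 r2 vb by simp
      then show ?thesis using p q True pq(3) w by auto
    next
      case False
      obtain \<omega> where \<omega>: "\<omega> permutes W n" "evenperm \<omega>" "\<omega> (branch n 1) = v" "\<omega> (branch n 2) = v'"
        using Alt_two_transitive[OF finite_W card, of "branch n 1" "branch n 2" v v'] br vb False by auto
      have "card {b} < card X" using card_image[OF inj_x] d_ge by (simp add: X_def)
      then obtain b'' where b'': "b'' \<in> X" "b'' \<noteq> b" using ex_not_in_of_card_less[of "{b}" X] by auto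
      have "three_cycle (v @ [b]) (v' @ [b']) (v @ [b'']) \<in> K"
        using base[of \<omega> 1 b 2 b' 1 b''] \<omega> x12 r2 vb b'' by simp
      then show ?thesis using p q False b'' by auto
    qed
  qed
  then have "\<sigma> \<in> K" using assms(1) by simp
  then show ?thesis by (simp add: K_def)
qed


section \<open>Splitting off one level\<close>

lemma tele_Suc_subset:
  assumes "1 \<le> n"
  shows "tele (Suc n) \<subseteq> tele n"
proof (rule tele_least[OF tele_subgroup[OF assms]])
  show "spread (Suc n) \<omega> \<in> tele n" if "\<omega> \<in> Om (Suc n)" for \<omega>
    using spread_Suc_in_tele that assms by simp
  show "directed (Suc n) g \<in> tele n" if g: "g \<in> B" for g
  proof -
    have "local_part n g \<in> carrier P" "directed (Suc n) g \<in> carrier P"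
      using spread_phi_closed[OF g assms] directed_closed[OF g] by auto
    then have "directed (Suc n) g = inv\<^bsub>P\<^esub> (local_part n g) \<cdot> directed n g"
      unfolding directed_split[OF g assms] by (simp add: P.m_assoc[symmetric])
    then show ?thesis
      using subgroup.m_closed[OF tele_subgroup[OF assms]] subgroup.m_inv_closed[OF tele_subgroup[OF assms]]
        local_part_in_tele[OF g assms] directed_in_tele[OF g] by simp
  qed
qed

lemma tele_antimono: "m \<le> n \<Longrightarrow> 1 \<le> m \<Longrightarrow> tele n \<subseteq> tele m"
proof (induction n rule: dec_induct)
  case (step n)
  then show ?case using tele_Suc_subset[of n] by auto
qed simp

definition single :: "nat \<Rightarrow> ('a list \<Rightarrow> 'a list) \<Rightarrow> nat \<Rightarrow> 'a list \<Rightarrow> 'a list" where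
  "single n \<omega> = (\<lambda>i\<in>{1..}. if i = n then \<omega> else id)"

lemma single_apply: "1 \<le> i \<Longrightarrow> single n \<omega> i = (if i = n then \<omega> else id)"
  by (simp add: single_def)

lemma single_closed: "\<omega> \<in> Om n \<Longrightarrow> single n \<omega> \<in> carrier P"
  using id_Om by (auto simp: P_mem single_def simp del: mem_carrier_Alt)

lemma spread_eq_single_mult:
  assumes "\<omega> \<in> Om n" "1 \<le> n"
  shows "spread n \<omega> = single n \<omega> \<cdot> spread (Suc n) (\<iota> X n (Suc n) \<omega>)"
proof (rule P_eqI)
  have o: "\<iota> X n (Suc n) \<omega> \<in> Om (Suc n)" by (rule iota_Om[OF assms(1)]) simp
  show "single n \<omega> \<cdot> spread (Suc n) (\<iota> X n (Suc n) \<omega>) \<in> carrier P"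
    using single_closed[OF assms(1)] spread_closed[OF o] by simp
  fix i :: nat assume i: "1 \<le> i"
  have "\<omega> permutes W n" using assms(1) by simp
  then show "spread n \<omega> i = (single n \<omega> \<cdot> spread (Suc n) (\<iota> X n (Suc n) \<omega>)) i"
    using i iota_iota[of \<omega> X n "Suc n" i] iota_self[of \<omega> X n]
    by (cases "i = n") (auto simp: P_mult single_apply spread_apply)
qed (rule spread_closed[OF assms(1)])

lemma single_in_tele:
  assumes "\<omega> \<in> Om n" "1 \<le> n"
  shows "single n \<omega> \<in> tele n"
proof -
  have o: "\<iota> X n (Suc n) \<omega> \<in> Om (Suc n)" by (rule iota_Om[OF assms(1)]) simp
  have "single n \<omega> = spread n \<omega> \<cdot> inv\<^bsub>P\<^esub> (spread (Suc n) (\<iota> X n (Suc n) \<omega>))"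
    unfolding spread_eq_single_mult[OF assms]
    using single_closed[OF assms(1)] spread_closed[OF o] by (simp add: P.m_assoc)
  then show ?thesis
    using subgroup.m_closed[OF tele_subgroup[OF assms(2)]] subgroup.m_inv_closed[OF tele_subgroup[OF assms(2)]]
      spread_Suc_in_tele[OF o assms(2)] spread_in_tele[OF assms(1)] by simp
qed

definition erase :: "nat \<Rightarrow> (nat \<Rightarrow> 'a list \<Rightarrow> 'a list) \<Rightarrow> nat \<Rightarrow> 'a list \<Rightarrow> 'a list" where
  "erase n p = (\<lambda>i\<in>{1..}. if i \<le> n then id else p i)"

lemma erase_apply: "1 \<le> i \<Longrightarrow> erase n p i = (if i \<le> n then id else p i)"
  by (simp add: erase_def)

lemma erase_closed: "p \<in> carrier P \<Longrightarrow> erase n p \<in> carrier P"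
  using id_Om by (auto simp: P_mem erase_def simp del: mem_carrier_Alt)

lemma erase_eqI:
  assumes "p \<in> carrier P" "\<And>i. 1 \<le> i \<Longrightarrow> i \<le> n \<Longrightarrow> p i = id"
  shows "erase n p = p"
  by (rule P_eqI[OF erase_closed[OF assms(1)] assms(1)]) (simp add: erase_apply assms(2))

lemma erase_group_hom: "group_hom P P (erase n)"
proof -
  have "erase n \<in> hom P P"
  proof (rule homI)
    fix p q assume pq: "p \<in> carrier P" "q \<in> carrier P"
    show "erase n (p \<cdot> q) = erase n p \<cdot> erase n q"
      by (rule P_eqI) (use pq erase_closed in \<open>auto simp: P_mult erase_apply\<close>)
  qed (rule erase_closed)
  then show ?thesis using group_P by (simp add: group_hom_def group_hom_axioms_def)
qed

lemma erase_spread: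
  assumes "\<omega> \<in> Om n"
  shows "erase n (spread n \<omega>) = spread (Suc n) (\<iota> X n (Suc n) \<omega>)"
proof (rule P_eqI)
  fix i :: nat assume i: "1 \<le> i"
  have "\<omega> permutes W n" using assms by simp
  then show "erase n (spread n \<omega>) i = spread (Suc n) (\<iota> X n (Suc n) \<omega>) i"
    using i iota_iota[of \<omega> X n "Suc n" i] by (auto simp: erase_apply spread_apply)
next
  have o: "\<iota> X n (Suc n) \<omega> \<in> Om (Suc n)" by (rule iota_Om[OF assms]) simp
  show "spread (Suc n) (\<iota> X n (Suc n) \<omega>) \<in> carrier P" by (rule spread_closed[OF o])
qed (rule erase_closed[OF spread_closed[OF assms]])

lemma directed_trivial: "1 \<le> i \<Longrightarrow> i \<le> n \<Longrightarrow> directed n g i = id"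
  using directed_step[of i n g] by simp

lemma tele_trivial:
  assumes "p \<in> tele n" "1 \<le> i" "i < n"
  shows "p i = id"
proof -
  have n: "1 \<le> n" using assms by simp
  let ?N = "{p \<in> carrier P. p i = id}"
  have "subgroup ?N P"
    by (rule P.subgroupI) (use assms(2) in \<open>auto simp: P_mult P_inv P_one intro!: exI[of _ "\<one>\<^bsub>P\<^esub>"]\<close>)
  then have "tele n \<subseteq> ?N"
    by (rule tele_least)
       (use assms spread_closed directed_closed[OF _ n] directed_trivial[of i n] in \<open>auto simp: spread_apply simp del: mem_carrier_Alt\<close>)
  then show ?thesis using assms(1) by blast
qed

lemma tele_closed: "1 \<le> n \<Longrightarrow> p \<in> tele n \<Longrightarrow> p \<in> carrier P"
  using subgroup.mem_carrier[OF tele_subgroup] by blast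

text \<open>Together with \<open>single_in_tele\<close> this says that \<open>tele n\<close> is the direct product of its
  \<open>n\<close>-th factor and \<open>tele (n + 1)\<close>.\<close>

lemma erase_tele:
  assumes n: "1 \<le> n" and p: "p \<in> tele n"
  shows "erase n p \<in> tele (Suc n)"
proof -
  have "subgroup {p \<in> carrier P. erase n p \<in> tele (Suc n)} P"
    by (rule group_hom.subgroup_preimage[OF erase_group_hom tele_subgroup]) simp
  then have "tele n \<subseteq> {p \<in> carrier P. erase n p \<in> tele (Suc n)}"
  proof (rule tele_least)
    fix \<omega> assume "\<omega> \<in> Om n"
    then show "spread n \<omega> \<in> {p \<in> carrier P. erase n p \<in> tele (Suc n)}"
      using erase_spread[of \<omega> n] spread_closed[of \<omega> n] iota_Om[of \<omega> n "Suc n"] spread_in_tele[of _ "Suc n"]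
      by (simp del: mem_carrier_Alt)
  next
    fix g assume g: "g \<in> B"
    have "erase n (directed n g) = directed n g"
      by (rule erase_eqI[OF directed_closed[OF g n] directed_trivial])
    moreover have "directed n g \<in> tele (Suc n)"
      unfolding directed_split[OF g n]
      by (intro subgroup.m_closed[OF tele_subgroup] spread_in_tele phi_Om g directed_in_tele) (use n in auto)
    ultimately show "directed n g \<in> {p \<in> carrier P. erase n p \<in> tele (Suc n)}"
      using directed_closed[OF g n] by simp
  qed
  then show ?thesis using p by blast
qed

text \<open>
  So the kernels of the projections onto the first factors are the groups \<open>tele (n + 1)\<close>, and the
  congruence property only has to be shown for these.
\<close>

lemma level_kernel_subset_tele:
  assumes "p \<in> tele 1" "\<And>i. 1 \<le> i \<Longrightarrow> i \<le> n \<Longrightarrow> p i = id"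
  shows "p \<in> tele (Suc n)"
  using assms(2)
proof (induction n)
  case (Suc n)
  then have "p \<in> tele (Suc n)" by simp
  then have "erase (Suc n) p \<in> tele (Suc (Suc n))" by (intro erase_tele) auto
  moreover have "erase (Suc n) p = p"
    by (rule erase_eqI) (use Suc.prems assms(1) tele_closed in auto)
  ultimately show ?case by simp
qed (use assms(1) in simp)

lemma finite_support_in_tele:
  assumes "p \<in> carrier P" "\<And>i. m < i \<Longrightarrow> p i = id"
  shows "p \<in> tele 1"
  using assms
proof (induction m arbitrary: p)
  case 0
  then have "p = \<one>\<^bsub>P\<^esub>" by (intro P_eqI) (auto simp: P_one)
  then show ?case using subgroup.one_closed[OF tele_subgroup[of 1]] by simp
next
  case (Suc m)
  define q where "q = (\<lambda>i\<in>{1..}. if i \<le> m then p i else id)"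
  have q: "q \<in> carrier P"
    using Suc.prems(1) id_Om by (auto simp: q_def P_mem simp del: mem_carrier_Alt)
  have "q \<in> tele 1" by (rule Suc.IH[OF q]) (simp add: q_def)
  moreover have o: "p (Suc m) \<in> Om (Suc m)" using P_component[OF Suc.prems(1)] by simp
  then have "single (Suc m) (p (Suc m)) \<in> tele 1"
    using single_in_tele[OF o] tele_antimono[of 1 "Suc m"] by auto
  moreover have "p = q \<cdot> single (Suc m) (p (Suc m))"
  proof (rule P_eqI[OF Suc.prems(1)])
    fix i :: nat assume "1 \<le> i"
    then show "p i = (q \<cdot> single (Suc m) (p (Suc m))) i"
      using Suc.prems(2)[of i] by (auto simp: P_mult q_def single_apply)
  qed (use q single_closed[OF o] in simp)
  ultimately show ?case using subgroup.m_closed[OF tele_subgroup[of 1]] by (metis le_refl)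
qed

section \<open>Normal subgroups\<close>

text \<open>
  A permutation of the first letter alone; it and its inverse send \<open>x\<^sub>d\<close> to two different letters.
\<close>

definition turn :: "nat \<Rightarrow> 'a list \<Rightarrow> 'a list" where
  "turn n = \<iota> X 1 n (three_cycle [x d] [x 1] [x 2])"

lemma turn_cycle: "distinct [[x d], [x 1], [x 2]]" "three_cycle [x d] [x 1] [x 2] \<in> Om 1"
proof -
  have mem: "1 \<in> {1..d}" "2 \<in> {1..d}" "d \<in> {1..d}" using d_ge by auto
  show dist: "distinct [[x d], [x 1], [x 2]]"
    using x_eq_iff[OF mem(3,1)] x_eq_iff[OF mem(3,2)] x_eq_iff[OF mem(1,2)] d_ge by simp
  have "{[x d], [x 1], [x 2]} \<subseteq> W 1" using mem[THEN x_mem] by (simp add: words_def)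
  then show "three_cycle [x d] [x 1] [x 2] \<in> Om 1"
    using three_cycle_permutes[of "[x d]" "[x 1]" "[x 2]" "W 1"] evenperm_three_cycle[OF dist] by simp
qed

lemma turn_Om: "1 \<le> n \<Longrightarrow> turn n \<in> Om n"
  unfolding turn_def by (rule iota_Om[OF turn_cycle(2)])

lemma inv_turn: "1 \<le> n \<Longrightarrow> inv' (turn n) = \<iota> X 1 n (three_cycle [x 2] [x 1] [x d])"
proof (rule inv_unique_comp)
  let ?c = "three_cycle [x d] [x 1] [x 2]" and ?c' = "three_cycle [x 2] [x 1] [x d]"
  assume n: "1 \<le> n"
  have c: "?c permutes W 1" using turn_cycle(2) by simp
  have c': "?c' = inv' ?c" by (simp add: inv_three_cycle)
  then have c'p: "?c' permutes W 1" using permutes_inv[OF c] by simp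
  show "turn n \<circ> \<iota> X 1 n ?c' = id"
    using iota_comp[OF c'p n, of ?c] permutes_inv_o(1)[OF c] c' by (simp add: turn_def iota_id)
  show "\<iota> X 1 n ?c' \<circ> turn n = id"
    using iota_comp[OF c n, of ?c'] permutes_inv_o(2)[OF c] c' by (simp add: turn_def iota_id)
qed

text \<open>
  On level one the branches \<open>a \<le> r\<close> are other letters than \<open>x\<^sub>d\<close>, and there may be no room to move them
  all away. This is why the normal closure and the two generators are first treated from level two on.
\<close>

lemma directed_support_prefix:
  assumes "2 \<le> n" "v \<in> directed_support n"
  shows "v \<in> W n" "take 1 v = [x d]"
proof -
  have "v = ray n \<or> (\<exists>a\<in>{1..r}. v = branch n a)"
    using assms(2) by (auto simp: directed_support_def side_def)
  moreover have "branch n a \<in> W n" if "a \<in> {1..r}" for a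
    by (rule branch_words) (use that r_less assms(1) in auto)
  moreover obtain m where "n = Suc (Suc m)"
    using le_Suc_ex[OF assms(1)] by auto
  then have "take 1 (branch n a) = [x d]" for a by (simp add: branch_def)
  moreover have "take 1 (ray n) = [x d]" using assms(1) by (cases n) auto
  ultimately show "v \<in> W n" "take 1 v = [x d]" using ray_words[of n] by metis+
qed

lemma turn_support:
  assumes n: "2 \<le> n"
  shows "directed_support n \<inter> turn n ` directed_support n = {}"
    "directed_support n \<inter> inv' (turn n) ` directed_support n = {}"
    "turn n ` directed_support n \<inter> inv' (turn n) ` directed_support n = {}"
proof -
  have n1: "1 \<le> n" using n by simp
  note d = turn_cycle(1)
  have c: "three_cycle [x d] [x 1] [x 2] permutes W 1" using turn_cycle(2) by simp
  have c': "three_cycle [x 2] [x 1] [x d] permutes W 1"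
    using permutes_inv[OF c] by (simp add: inv_three_cycle)
  have 1: "take 1 (turn n v) = [x 1]" if "v \<in> directed_support n" for v
    using iota_words(2)[OF c n1 directed_support_prefix(1)[OF n that]] directed_support_prefix(2)[OF n that] d
    by (simp add: turn_def three_cycle_apply)
  have 2: "take 1 (inv' (turn n) v) = [x 2]" if "v \<in> directed_support n" for v
  proof -
    have "distinct [[x 2], [x 1], [x d]]" using d by auto
    then show ?thesis
      using iota_words(2)[OF c' n1 directed_support_prefix(1)[OF n that]] directed_support_prefix(2)[OF n that] d
      by (simp add: inv_turn[OF n1] three_cycle_apply)
  qed
  have 3: "take 1 v = [x d]" if "v \<in> directed_support n" for v
    by (rule directed_support_prefix(2)[OF n that])
  have neq: "[x 1] \<noteq> [x d]" "[x 2] \<noteq> [x d]" "[x 1] \<noteq> [x 2]" using d by auto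
  show "directed_support n \<inter> turn n ` directed_support n = {}" using 1 3 neq by force
  show "directed_support n \<inter> inv' (turn n) ` directed_support n = {}" using 2 3 neq by force
  show "turn n ` directed_support n \<inter> inv' (turn n) ` directed_support n = {}" using 1 2 neq by force
qed

text \<open>
  Modulo \<open>N\<close>, a directed element agrees with its turned copy, which commutes with all directed elements.
  So the directed elements have an abelian image, and they form a perfect group.
\<close>

lemma tele_subset_of_spread:
  assumes n: "2 \<le> n" and N: "subgroup N P"
    and normal: "\<And>q \<nu>. q \<in> tele n \<Longrightarrow> \<nu> \<in> N \<Longrightarrow> q \<cdot> \<nu> \<cdot> inv\<^bsub>P\<^esub> q \<in> N"
    and spread: "\<And>\<omega>. \<omega> \<in> Om n \<Longrightarrow> spread n \<omega> \<in> N"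
  shows "tele n \<subseteq> N"
proof (rule tele_least[OF N spread])
  have n1: "1 \<le> n" using n by simp
  interpret D: group_hom "Alt base_points" P "directed n" by (rule directed_group_hom[OF n1])
  let ?L = "{g \<in> B. directed n g \<in> N}"
  have "?L = B"
  proof (rule Alt_perfect[OF finite_base_points card_base_points])
    show "subgroup ?L (Alt base_points)" by (rule D.subgroup_preimage[OF N])
    fix g h assume gh: "g \<in> B" "h \<in> B"
    let ?a = "directed n g" and ?b = "directed n h" and ?t = "spread n (turn n)"
    have "?t \<cdot> ?b \<cdot> inv\<^bsub>P\<^esub> ?t \<in> rist n (turn n ` directed_support n)"
      by (rule rist_conj[OF turn_Om[OF n1] directed_rist[OF gh(2) n1]])
    then have "?a \<cdot> (?t \<cdot> ?b \<cdot> inv\<^bsub>P\<^esub> ?t) = (?t \<cdot> ?b \<cdot> inv\<^bsub>P\<^esub> ?t) \<cdot> ?a"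
      using rist_commute[OF directed_rist[OF gh(1) n1]] turn_support(1)[OF n] by blast
    then have "?a \<cdot> ?b \<cdot> inv\<^bsub>P\<^esub> ?a \<cdot> inv\<^bsub>P\<^esub> ?b \<in> N"
      using P.commutator_in_normalized[OF N directed_closed[OF gh(1) n1] directed_closed[OF gh(2) n1]]
        normal directed_in_tele gh spread[OF turn_Om[OF n1]] by blast
    moreover have "directed n (g \<circ> h \<circ> inv' g \<circ> inv' h) = ?a \<cdot> ?b \<cdot> inv\<^bsub>P\<^esub> ?a \<cdot> inv\<^bsub>P\<^esub> ?b"
      using gh comp_B inv_B directed_mult[OF n1] directed_inv[OF n1] by (simp del: mem_carrier_Alt)
    ultimately show "g \<circ> h \<circ> inv' g \<circ> inv' h \<in> ?L"
      using gh comp_B inv_B by (simp del: mem_carrier_Alt)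
  qed
  then show "directed n g \<in> N" if "g \<in> B" for g using that by blast
qed

lemma tele_subset_of_nontrivial:
  assumes n: "2 \<le> n" and N: "subgroup N P"
    and normal: "\<And>q \<nu>. q \<in> tele n \<Longrightarrow> \<nu> \<in> N \<Longrightarrow> q \<cdot> \<nu> \<cdot> inv\<^bsub>P\<^esub> q \<in> N"
    and \<sigma>: "\<sigma> \<in> Om n" "\<sigma> \<noteq> id" "spread n \<sigma> \<in> N"
  shows "tele n \<subseteq> N"
proof (rule tele_subset_of_spread[OF n N normal])
  let ?K = "{\<omega> \<in> Om n. spread n \<omega> \<in> N}"
  have "?K = Om n"
  proof (rule Alt_simple[OF finite_W])
    have "5 * 5 \<le> d * d" using mult_le_mono[OF d_ge d_ge] .
    then show "7 \<le> card (W n)" using card_W_ge_2[OF n] by simp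
    show "subgroup ?K (Alt (W n))" by (rule group_hom.subgroup_preimage[OF spread_group_hom N])
    show "\<sigma> \<in> ?K" "\<sigma> \<noteq> id" using \<sigma> by auto
    fix \<tau> \<nu> assume "\<tau> permutes W n" "evenperm \<tau>" and \<nu>: "\<nu> \<in> ?K"
    then have \<tau>: "\<tau> \<in> Om n" by simp
    have "spread n (\<tau> \<circ> \<nu> \<circ> inv' \<tau>) = spread n \<tau> \<cdot> spread n \<nu> \<cdot> inv\<^bsub>P\<^esub> spread n \<tau>"
      using \<tau> \<nu> comp_Om inv_Om by (simp add: spread_mult spread_inv del: mem_carrier_Alt)
    then show "\<tau> \<circ> \<nu> \<circ> inv' \<tau> \<in> ?K"
      using normal[OF spread_in_tele[OF \<tau>], of "spread n \<nu>"] \<tau> \<nu> comp_Om inv_Om by (simp del: mem_carrier_Alt)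
  qed
  then show "spread n \<omega> \<in> N" if "\<omega> \<in> Om n" for \<omega> using that by blast
qed

lemma spread_pow: "\<omega> \<in> Om n \<Longrightarrow> spread n \<omega> [^]\<^bsub>P\<^esub> (k::nat) = spread n (\<omega> ^^ k)"
  using group_hom.hom_nat_pow[OF spread_group_hom, of \<omega> n k] by (simp add: Alt_pow)

text \<open>
  In a quotient of order \<open>k\<close> all \<open>k\<close>-th powers are trivial, while the alternating groups of the
  higher levels contain elements of larger order.
\<close>

lemma tele_subset_of_finite_index:
  assumes "N \<in> finite_index_normal (P\<lparr>carrier := tele 1\<rparr>)"
  shows "\<exists>n. tele (Suc n) \<subseteq> N"
proof -
  let ?G = "P\<lparr>carrier := tele 1\<rparr>"
  have sub1: "subgroup (tele 1) P" by (rule tele_subgroup) simp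
  have N: "N \<lhd> ?G" and fin: "finite (rcosets\<^bsub>?G\<^esub> N)"
    using assms by (auto simp: finite_index_normal_def)
  have NG: "subgroup N ?G" by (rule normal_imp_subgroup[OF N])
  have NP: "subgroup N P" by (rule P.incl_subgroup[OF sub1 NG])
  interpret G: group ?G by (rule subgroup.subgroup_is_group[OF sub1 group_P])
  interpret Q: group "?G Mod N" by (rule normal.factorgroup_is_group[OF N])
  define k where "k = order (?G Mod N)"
  have k: "0 < k"
    unfolding k_def using fin Q.order_gt_0_iff_finite by (simp add: FactGroup_def)
  have pow: "q [^]\<^bsub>P\<^esub> k \<in> N" if q: "q \<in> tele 1" for q
  proof -
    have qc: "q [^]\<^bsub>?G\<^esub> k \<in> carrier ?G" using q G.nat_pow_closed by simp
    have "N #>\<^bsub>?G\<^esub> q \<in> carrier (?G Mod N)" using q by (auto simp: carrier_FactGroup)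
    then have "N #>\<^bsub>?G\<^esub> (q [^]\<^bsub>?G\<^esub> k) = N"
      using Q.pow_order_eq_1[of "N #>\<^bsub>?G\<^esub> q"] normal.FactGroup_pow[OF N, of q k] q by (simp add: k_def)
    then have "q [^]\<^bsub>?G\<^esub> k \<in> N" by (rule G.coset_join1[OF _ qc NG])
    then show ?thesis by (simp add: P.nat_pow_consistent[symmetric])
  qed
  \<comment> \<open>a level at least two on which the long cycle has order larger than \<open>k\<close>\<close>
  define n where "n = k + 2"
  have n: "2 \<le> n" "1 \<le> n" by (auto simp: n_def)
  obtain xs where xs: "distinct xs" "set xs = W n" using finite_distinct_list[OF finite_W] by blast
  have "n < 2 ^ n" by (rule less_exp)
  also have "2 ^ n \<le> d ^ n" by (rule power_mono) (use d_ge in auto)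
  also have "d ^ n = length xs" using card_W[of n] distinct_card[OF xs(1)] xs(2) by simp
  finally have len: "n < length xs" .
  let ?\<sigma> = "odd_cycle xs"
  have len2: "2 \<le> length xs" using len n by simp
  have \<sigma>: "?\<sigma> \<in> Om n" using odd_cycle_properties(1,2)[OF xs(1) len2] xs(2) by simp
  have \<sigma>k: "?\<sigma> ^^ k \<noteq> id" by (rule odd_cycle_properties(4)[OF xs(1) len2 k]) (use len n_def in simp)
  have sub: "tele n \<subseteq> tele 1" by (rule tele_antimono) (use n in auto)
  have "tele n \<subseteq> N"
  proof (rule tele_subset_of_nontrivial[OF n(1) NP])
    show "?\<sigma> ^^ k \<in> Om n" using Alt_subgroup_funpow[OF group.subgroup_self[OF group_Om] finite_W \<sigma>] .
    show "spread n (?\<sigma> ^^ k) \<in> N"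
      using pow[of "spread n ?\<sigma>"] spread_in_tele[OF \<sigma>] sub spread_pow[OF \<sigma>] by auto
    show "q \<cdot> \<nu> \<cdot> inv\<^bsub>P\<^esub> q \<in> N" if "q \<in> tele n" "\<nu> \<in> N" for q \<nu>
    proof -
      have q: "q \<in> tele 1" using that(1) sub by blast
      then show ?thesis
        using normal.inv_op_closed2[OF N, of q \<nu>] that(2) P.m_inv_consistent[OF sub1 q] by simp
    qed
  qed (rule \<sigma>k)
  then show ?thesis using n by (intro exI[of _ "n - 1"]) simp
qed

end

section \<open>Two generators\<close>

lemma subgroup_nat_pow: "subgroup H G \<Longrightarrow> p \<in> H \<Longrightarrow> p [^]\<^bsub>G\<^esub> (n::nat) \<in> H"
  by (induction n) (auto simp: subgroup.one_closed subgroup.m_closed)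

lemma (in group) conj_nat_pow:
  assumes "t \<in> carrier G" "b \<in> carrier G"
  shows "(t \<otimes> b \<otimes> inv t) [^] (n::nat) = t \<otimes> b [^] n \<otimes> inv t"
proof (induction n)
  case (Suc n)
  have "inv t \<otimes> (t \<otimes> y) = y" if "y \<in> carrier G" for y
    using assms that by (simp add: m_assoc[symmetric])
  then show ?case using Suc assms by (simp add: m_assoc)
qed (use assms in simp)

context telescope begin

lemma rist_inv:
  assumes "p \<in> rist n A"
  shows "inv\<^bsub>P\<^esub> p \<in> rist n A"
  unfolding rist_def
proof (intro CollectI conjI allI impI)
  show "inv\<^bsub>P\<^esub> p \<in> carrier P" using rist_closed[OF assms] by simp
  fix i :: nat and u assume i: "1 \<le> i" and u: "i < n \<or> take n u \<notin> A"
  have "p i permutes W i" by (rule P_permutes[OF rist_closed[OF assms] i])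
  then show "(inv\<^bsub>P\<^esub> p) i u = u"
    using P_inv[OF rist_closed[OF assms] i] rist_fixed[OF assms i u] by (metis permutes_inverses(2))
qed

lemma directed_pow: "1 \<le> n \<Longrightarrow> g \<in> B \<Longrightarrow> directed n g [^]\<^bsub>P\<^esub> (k::nat) = directed n (g ^^ k)"
  using group_hom.hom_nat_pow[OF directed_group_hom, of n g k] by (simp add: Alt_pow)

lemma directed_commutator:
  assumes "1 \<le> n" "g \<in> B" "h \<in> B"
  shows "directed n (g \<circ> h \<circ> inv' g \<circ> inv' h) =
    directed n g \<cdot> directed n h \<cdot> inv\<^bsub>P\<^esub> directed n g \<cdot> inv\<^bsub>P\<^esub> directed n h"
  using assms comp_B inv_B directed_mult[OF assms(1)] directed_inv[OF assms(1)] by (simp del: mem_carrier_Alt)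

lemma card_directed_support: "card (directed_support n) \<le> d - 2"
proof -
  have "card (side n) \<le> r" using card_image_le[of "{1..r}" "branch n"] by (simp add: side_def)
  then show ?thesis
    using card_insert_le_m1[of "Suc r" "side n" "ray n"] r_less by (simp add: directed_support_def)
qed

lemma finite_directed_support: "finite (directed_support n)"
  by (simp add: directed_support_def side_def)

text \<open>
  The factors \<open>e\<close> and \<open>e'\<close> commute with each other and with all directed elements, so they cancel in the
  commutator of the two given members of \<open>H\<close>, and \<open>H\<close> contains the directed element of a non-trivial commutator. The
  base elements whose directed elements lie in \<open>H\<close> form a normal subgroup: conjugation by any \<open>\<sigma>\<close>
  in the base group is realized in \<open>H\<close> because \<open>H\<close> contains the directed element of \<open>\<sigma>\<close> up to a factor with
  disjoint support (the set \<open>M\<close> in the proof).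
\<close>

lemma directed_in_of_generators:
  assumes n: "1 \<le> n" and H: "subgroup H P"
    and gh: "g \<in> B" "h \<in> B" "g \<circ> h \<noteq> h \<circ> g"
    and gen: "\<And>K. subgroup K (Alt base_points) \<Longrightarrow> g \<in> K \<Longrightarrow> h \<in> K \<Longrightarrow> K = B"
    and e: "e \<in> rist n E" "e' \<in> rist n E'" "directed_support n \<inter> E = {}" "directed_support n \<inter> E' = {}" "E \<inter> E' = {}"
    and mem: "directed n g \<cdot> e \<in> H" "directed n h \<cdot> e' \<in> H"
    and c: "c \<in> B"
  shows "directed n c \<in> H"
proof -
  let ?D = "directed n" and ?C = "- directed_support n"
  have DR: "?D c \<in> rist n (directed_support n)" if "c \<in> B" for c using directed_rist[OF that n] .
  have Dc: "?D c \<in> carrier P" if "c \<in> B" for c using directed_closed[OF that n] .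
  have comm: "?D c \<cdot> z = z \<cdot> ?D c" if "c \<in> B" "z \<in> rist n ?C" for c z
    by (rule rist_commute[OF DR[OF that(1)] that(2)]) simp
  have eC: "e \<in> rist n ?C" "e' \<in> rist n ?C"
    using e rist_mono[of E ?C n] rist_mono[of E' ?C n] by blast+
  have ec: "e \<in> carrier P" "e' \<in> carrier P" using e rist_closed by auto
  define M where "M = {c \<in> B. \<exists>z\<in>rist n ?C. ?D c \<cdot> z \<in> H}"
  have "subgroup M (Alt base_points)"
  proof (rule group.subgroupI[OF group_B])
    show "M \<subseteq> B" by (auto simp: M_def)
    show "M \<noteq> {}" using gh eC mem by (auto simp: M_def)
    fix a assume "a \<in> M"
    then obtain z where a: "a \<in> B" "z \<in> rist n ?C" "?D a \<cdot> z \<in> H" by (auto simp: M_def)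
    have zc: "z \<in> carrier P" using a rist_closed by auto
    have "?D (inv' a) \<cdot> inv\<^bsub>P\<^esub> z = inv\<^bsub>P\<^esub> (z \<cdot> ?D a)"
      using a zc Dc[OF a(1)] by (simp add: directed_inv[OF n] P.inv_mult_group del: mem_carrier_Alt)
    then have "?D (inv' a) \<cdot> inv\<^bsub>P\<^esub> z \<in> H"
      using subgroup.m_inv_closed[OF H a(3)] comm[OF a(1,2)] by simp
    then have "inv' a \<in> M" using inv_B[OF a(1)] rist_inv[OF a(2)] by (auto simp: M_def simp del: mem_carrier_Alt)
    then show "inv\<^bsub>Alt base_points\<^esub> a \<in> M" using a(1) inv_Alt[OF finite_base_points] by simp
    fix b assume "b \<in> M"
    then obtain y where b: "b \<in> B" "y \<in> rist n ?C" "?D b \<cdot> y \<in> H" by (auto simp: M_def)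
    have yc: "y \<in> carrier P" using b rist_closed by auto
    have "?D (a \<circ> b) \<cdot> (z \<cdot> y) = (?D a \<cdot> z) \<cdot> (?D b \<cdot> y)"
      using P.mult_commuting_pairs[OF Dc[OF a(1)] zc Dc[OF b(1)] yc comm[OF b(1) a(2), symmetric]]
        directed_mult[OF n a(1) b(1)] by simp
    then have "?D (a \<circ> b) \<cdot> (z \<cdot> y) \<in> H" using subgroup.m_closed[OF H a(3) b(3)] by simp
    then show "a \<otimes>\<^bsub>Alt base_points\<^esub> b \<in> M"
      using comp_B[OF a(1) b(1)] rist_mult[OF a(2) b(2)] by (auto simp: M_def simp del: mem_carrier_Alt)
  qed
  then have M: "M = B" by (rule gen) (use gh eC mem in \<open>auto simp: M_def\<close>)
  let ?L = "{c \<in> B. ?D c \<in> H}"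
  have "?L = B"
  proof (rule Alt_simple[OF finite_base_points card_base_points])
    show "subgroup ?L (Alt base_points)"
      by (rule group_hom.subgroup_preimage[OF directed_group_hom[OF n] H])
    fix \<sigma> \<nu> assume "\<sigma> permutes base_points" "evenperm \<sigma>" and \<nu>: "\<nu> \<in> ?L"
    then have \<sigma>: "\<sigma> \<in> B" by simp
    then have "\<sigma> \<in> M" using M by simp
    then obtain z where z: "z \<in> rist n ?C" "?D \<sigma> \<cdot> z \<in> H" unfolding M_def by blast
    have zc: "z \<in> carrier P" using z rist_closed by auto
    have \<nu>': "\<nu> \<in> B" using \<nu> by blast
    have "z \<cdot> ?D \<nu> \<cdot> inv\<^bsub>P\<^esub> z = ?D \<nu>"
      using comm[OF \<nu>' z(1)] zc Dc[OF \<nu>'] by (metis P.inv_closed P.m_assoc P.r_inv P.r_one)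
    then have "(?D \<sigma> \<cdot> z) \<cdot> ?D \<nu> \<cdot> inv\<^bsub>P\<^esub> (?D \<sigma> \<cdot> z) = ?D \<sigma> \<cdot> ?D \<nu> \<cdot> inv\<^bsub>P\<^esub> ?D \<sigma>"
      using zc Dc[OF \<nu>'] Dc[OF \<sigma>] by (simp add: P.inv_mult_group P.m_assoc) (metis P.inv_closed P.m_assoc P.m_closed)
    moreover have "(?D \<sigma> \<cdot> z) \<cdot> ?D \<nu> \<cdot> inv\<^bsub>P\<^esub> (?D \<sigma> \<cdot> z) \<in> H"
      using subgroup.m_closed[OF H subgroup.m_closed[OF H z(2)] subgroup.m_inv_closed[OF H z(2)]] \<nu> by blast
    moreover have "?D (\<sigma> \<circ> \<nu> \<circ> inv' \<sigma>) = ?D \<sigma> \<cdot> ?D \<nu> \<cdot> inv\<^bsub>P\<^esub> ?D \<sigma>"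
      using \<sigma> \<nu>' comp_B inv_B by (simp add: directed_mult[OF n] directed_inv[OF n] del: mem_carrier_Alt)
    ultimately show "\<sigma> \<circ> \<nu> \<circ> inv' \<sigma> \<in> ?L"
      using comp_B[OF comp_B[OF \<sigma> \<nu>'] inv_B[OF \<sigma>]] by simp
  next
    let ?k = "g \<circ> h \<circ> inv' g \<circ> inv' h"
    have "(?D g \<cdot> e) \<cdot> (?D h \<cdot> e') \<cdot> inv\<^bsub>P\<^esub> (?D g \<cdot> e) \<cdot> inv\<^bsub>P\<^esub> (?D h \<cdot> e')
        = ?D g \<cdot> ?D h \<cdot> inv\<^bsub>P\<^esub> ?D g \<cdot> inv\<^bsub>P\<^esub> ?D h"
      by (rule P.commutator_commuting_factors[OF Dc[OF gh(1)] ec(1) Dc[OF gh(2)] ec(2)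
            comm[OF gh(2) eC(1), symmetric] rist_commute[OF e(1,2,5)] comm[OF gh(1) eC(2), symmetric]])
    moreover have "(?D g \<cdot> e) \<cdot> (?D h \<cdot> e') \<cdot> inv\<^bsub>P\<^esub> (?D g \<cdot> e) \<cdot> inv\<^bsub>P\<^esub> (?D h \<cdot> e') \<in> H"
      by (intro subgroup.m_closed[OF H] subgroup.m_inv_closed[OF H] mem)
    ultimately have "?D ?k \<in> H" using directed_commutator[OF n gh(1,2)] by simp
    then show "?k \<in> ?L" using comp_B[OF comp_B[OF comp_B[OF gh(1,2)] inv_B[OF gh(1)]] inv_B[OF gh(2)]] by simp
    show "?k \<noteq> id"
    proof
      assume k: "?k = id"
      have p: "g permutes base_points" "h permutes base_points" using gh by auto
      have "g \<circ> h = ?k \<circ> (h \<circ> g)"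
        using permutes_inv_o(2)[OF p(1)] permutes_inv_o(2)[OF p(2)] by (simp add: fun_eq_iff)
      then show False using gh(3) k by simp
    qed
  qed
  then show ?thesis using c by blast
qed

lemma funpow_identity: "(id :: 'c \<Rightarrow> 'c) ^^ n = id"
  by (induction n) auto

text \<open>
  The second generator is the product of \<open>\<Delta>\<^sub>2 \<beta>\<close>, the directed element of \<open>g\<close> and a turned copy of
  the directed element of \<open>h\<close>, with pairwise disjoint supports. Turning it back exchanges
  the roles of \<open>g\<close> and \<open>h\<close>. That no small power of \<open>\<alpha>\<close> is trivial serves to adjoin the first level.
\<close>

lemma tele_2_generators:
  obtains \<alpha> z where "\<alpha> \<in> Om 2" "\<And>k. 0 < k \<Longrightarrow> k < d * d - 1 \<Longrightarrow> \<alpha> ^^ k \<noteq> id"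
    "z \<in> tele 2" "generate P {spread 2 \<alpha>, z} = tele 2"
proof -
  let ?A = "directed_support 2" and ?T = "turn 2"
  have n: "(1::nat) \<le> 2" "(2::nat) \<le> 2" by auto
  have sub2: "subgroup (tele 2) P" by (rule tele_subgroup[OF n(1)])
  have T: "?T \<in> Om 2" by (rule turn_Om[OF n(1)])
  \<comment> \<open>the words left for \<open>\<beta>\<close>: those moved neither by directed elements nor by their turned copies\<close>
  define F where "F = W 2 - (?A \<union> ?T ` ?A)"
  have F: "F \<subseteq> W 2" "F \<inter> (?A \<union> ?T ` ?A) = {}" by (auto simp: F_def)
  have F7: "card F \<ge> 7"
  proof -
    have "card (?A \<union> ?T ` ?A) \<le> (d - 2) + (d - 2)"
      using card_Un_le[of ?A "?T ` ?A"] card_image_le[OF finite_directed_support, of ?T 2] card_directed_support[of 2]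
      by linarith
    moreover have "card (W 2) - card (?A \<union> ?T ` ?A) \<le> card F"
      unfolding F_def by (rule diff_card_le_card_Diff) (simp add: finite_directed_support)
    moreover have "card (W 2) \<ge> 5 * d" using card_W_ge_2[OF n(2)] mult_le_mono1[OF d_ge, of d] by linarith
    ultimately show ?thesis using d_ge by linarith
  qed
  have five: "5 \<le> card base_points" using card_base_points by simp
  show ?thesis
  proof (rule Alt_generated_by_double_transposition[OF finite_W F(1) F7],
      rule Alt_generated_by_three_cycle[OF finite_base_points five])
    fix \<alpha> \<beta> g h m
    assume \<alpha>\<beta>: "\<alpha> \<in> Om 2" "\<beta> \<in> Om 2" "\<And>z. z \<notin> F \<Longrightarrow> \<beta> z = z" "\<beta> \<circ> \<beta> = id"
      and \<alpha>k: "\<And>k. 0 < k \<Longrightarrow> k < card (W 2) - 1 \<Longrightarrow> \<alpha> ^^ k \<noteq> id"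
      and gen: "\<And>K. subgroup K (Alt (W 2)) \<Longrightarrow> \<alpha> \<in> K \<Longrightarrow> \<beta> \<in> K \<Longrightarrow> K = Om 2"
      and gh: "g \<in> B" "h \<in> B" "g \<circ> h \<noteq> h \<circ> g"
      and m: "odd m" "g ^^ m = id" "h ^^ 3 = id"
      and genB: "\<And>K. subgroup K (Alt base_points) \<Longrightarrow> g \<in> K \<Longrightarrow> h \<in> K \<Longrightarrow> K = B"
    let ?s = "spread 2 \<beta>" and ?a = "directed 2 g" and ?b = "directed 2 h" and ?t = "spread 2 ?T"
    let ?b' = "?t \<cdot> ?b \<cdot> inv\<^bsub>P\<^esub> ?t" and ?a' = "inv\<^bsub>P\<^esub> ?t \<cdot> ?a \<cdot> ?t"
    let ?z = "?s \<cdot> (?a \<cdot> ?b')"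
    have cl: "?s \<in> carrier P" "?a \<in> carrier P" "?b \<in> carrier P" "?t \<in> carrier P" "spread 2 \<alpha> \<in> carrier P"
      using \<alpha>\<beta> gh T spread_closed directed_closed[OF _ n(1)] by auto
    have sR: "?s \<in> rist 2 F" by (rule spread_rist[OF \<alpha>\<beta>(2,3)])
    have aR: "?a \<in> rist 2 ?A" "?b \<in> rist 2 ?A" using gh directed_rist[OF _ n(1)] by auto
    have b'R: "?b' \<in> rist 2 (?T ` ?A)" by (rule rist_conj[OF T aR(2)])
    have a'R: "?a' \<in> rist 2 (inv' ?T ` ?A)"
      using rist_conj[OF inv_Om[OF T] aR(1)] spread_inv[OF T] cl by simp
    have abR: "?a \<cdot> ?b' \<in> rist 2 (?A \<union> ?T ` ?A)"
      by (rule rist_mult[OF subsetD[OF rist_mono aR(1)] subsetD[OF rist_mono b'R]]) auto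
    define H where "H = generate P {spread 2 \<alpha>, ?z}"
    have z: "?z \<in> tele 2"
      using subgroup.m_closed[OF sub2] subgroup.m_inv_closed[OF sub2] \<alpha>\<beta> gh T spread_in_tele directed_in_tele by simp
    have H: "subgroup H P"
      unfolding H_def by (rule P.generate_is_subgroup) (use cl z tele_closed[OF n(1)] in auto)
    have inH: "spread 2 \<alpha> \<in> H" "?z \<in> H" unfolding H_def by (auto intro: generate.incl)
    note Hcl = subgroup.m_closed[OF H] subgroup.m_inv_closed[OF H]
    \<comment> \<open>an odd power kills both directed factors but not the involution\<close>
    let ?N = "3 * m"
    have sN: "\<beta> ^^ ?N = \<beta>"
    proof -
      have "odd ?N" using m(1) by simp
      then obtain j where j: "?N = 2 * j + 1" by (rule oddE)
      have "\<beta> ^^ (2 * j) = (\<beta> ^^ 2) ^^ j" by (simp add: funpow_mult)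
      also have "\<dots> = id" using \<alpha>\<beta>(4) by (simp add: numeral_2_eq_2 funpow_identity)
      finally show ?thesis unfolding j by simp
    qed
    have gN: "g ^^ ?N = id" "h ^^ ?N = id"
    proof -
      have "g ^^ (m * 3) = (g ^^ m) ^^ 3" "h ^^ (3 * m) = (h ^^ 3) ^^ m" by (simp_all add: funpow_mult)
      then show "g ^^ ?N = id" "h ^^ ?N = id" using m by (simp_all add: funpow_identity mult.commute)
    qed
    have "?z [^]\<^bsub>P\<^esub> ?N = ?s [^]\<^bsub>P\<^esub> ?N \<cdot> (?a \<cdot> ?b') [^]\<^bsub>P\<^esub> ?N"
      by (rule P.pow_mult_distrib[OF rist_commute[OF sR abR F(2)] cl(1) rist_closed[OF abR]])
    also have "(?a \<cdot> ?b') [^]\<^bsub>P\<^esub> ?N = ?a [^]\<^bsub>P\<^esub> ?N \<cdot> ?b' [^]\<^bsub>P\<^esub> ?N"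
      by (rule P.pow_mult_distrib[OF rist_commute[OF aR(1) b'R turn_support(1)[OF n(2)]] cl(2) rist_closed[OF b'R]])
    also have "?b' [^]\<^bsub>P\<^esub> ?N = \<one>\<^bsub>P\<^esub>"
      unfolding P.conj_nat_pow[OF cl(4,3)] directed_pow[OF n(1) gh(2)] gN directed_id[OF n(1)] using cl by simp
    also have "?a [^]\<^bsub>P\<^esub> ?N = \<one>\<^bsub>P\<^esub>"
      unfolding directed_pow[OF n(1) gh(1)] gN directed_id[OF n(1)] by simp
    also have "?s [^]\<^bsub>P\<^esub> ?N = ?s"
      unfolding spread_pow[OF \<alpha>\<beta>(2)] sN by simp
    finally have "?z [^]\<^bsub>P\<^esub> ?N = ?s" using cl by simp
    then have sH: "?s \<in> H" using subgroup_nat_pow[OF H inH(2), of ?N] by simp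
    have "{\<omega> \<in> Om 2. spread 2 \<omega> \<in> H} = Om 2"
      by (rule gen[OF group_hom.subgroup_preimage[OF spread_group_hom H]]) (use \<alpha>\<beta> inH sH in auto)
    then have spreadH: "spread 2 \<omega> \<in> H" if "\<omega> \<in> Om 2" for \<omega> using that by blast
    have abH: "?a \<cdot> ?b' \<in> H"
    proof -
      have "?a \<cdot> ?b' = inv\<^bsub>P\<^esub> ?s \<cdot> ?z"
        using cl rist_closed[OF abR] by (simp only: P.m_assoc[symmetric] P.inv_closed P.l_inv P.l_one)
      moreover have "inv\<^bsub>P\<^esub> ?s \<cdot> ?z \<in> H" by (intro Hcl sH inH)
      ultimately show ?thesis by (simp only:)
    qed
    have baH: "?b \<cdot> ?a' \<in> H"
    proof -
      have "inv\<^bsub>P\<^esub> ?t \<cdot> (?a \<cdot> ?b') \<cdot> ?t = ?a' \<cdot> ?b"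
      proof -
        have "?t \<cdot> (inv\<^bsub>P\<^esub> ?t \<cdot> y) = y" "inv\<^bsub>P\<^esub> ?t \<cdot> (?t \<cdot> y) = y" if "y \<in> carrier P" for y
          using that cl(4) by (simp_all add: P.m_assoc[symmetric])
        then show ?thesis using cl by (simp add: P.m_assoc)
      qed
      also have "\<dots> = ?b \<cdot> ?a'"
        by (rule rist_commute[OF a'R aR(2)]) (use turn_support(2)[OF n(2)] in blast)
      finally have "inv\<^bsub>P\<^esub> ?t \<cdot> (?a \<cdot> ?b') \<cdot> ?t = ?b \<cdot> ?a'" .
      moreover have "inv\<^bsub>P\<^esub> ?t \<cdot> (?a \<cdot> ?b') \<cdot> ?t \<in> H"
        by (intro Hcl abH spreadH[OF T])
      ultimately show ?thesis by (simp only:)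
    qed
    have "directed 2 c \<in> H" if "c \<in> B" for c
      by (rule directed_in_of_generators[OF n(1) H gh genB b'R a'R turn_support(1,2)[OF n(2)] turn_support(3)[OF n(2)] abH baH that])
    then have "tele 2 \<subseteq> H" by (intro tele_least[OF H spreadH])
    moreover have "H \<subseteq> tele 2"
      unfolding H_def by (rule P.generate_subgroup_incl[OF _ sub2]) (use z spread_in_tele[OF \<alpha>\<beta>(1)] in auto)
    ultimately have "generate P {spread 2 \<alpha>, ?z} = tele 2" by (auto simp: H_def)
    moreover have "\<alpha> ^^ k \<noteq> id" if "0 < k" "k < d * d - 1" for k
      using \<alpha>k[of k] that card_W_ge_2[OF n(2)] by linarith
    ultimately show ?thesis using that[of \<alpha> ?z] \<alpha>\<beta>(1) z by blast
  qed
qed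

lemma single_commute:
  assumes "c \<in> Om 1" "q \<in> carrier P" "q 1 = id"
  shows "single 1 c \<cdot> q = q \<cdot> single 1 c"
proof (rule P_eqI)
  fix i :: nat assume "1 \<le> i"
  then show "(single 1 c \<cdot> q) i = (q \<cdot> single 1 c) i"
    using assms(3) by (simp add: P_mult single_apply)
qed (use single_closed[OF assms(1)] assms(2) in auto)

lemma single_pow: "c \<in> Om n \<Longrightarrow> 1 \<le> n \<Longrightarrow> single n c [^]\<^bsub>P\<^esub> (k::nat) = single n (c ^^ k)"
proof (rule P_eqI)
  assume c: "c \<in> Om n" and n: "1 \<le> n"
  show "single n c [^]\<^bsub>P\<^esub> k \<in> carrier P" using single_closed[OF c] by simp
  show "single n (c ^^ k) \<in> carrier P"
    by (rule single_closed[OF Alt_subgroup_funpow[OF group.subgroup_self[OF group_Om] finite_W c]])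
  fix i :: nat assume i: "1 \<le> i"
  show "(single n c [^]\<^bsub>P\<^esub> k) i = single n (c ^^ k) i"
  proof (induction k)
    case 0
    then show ?case using i by (simp add: single_apply P_one fun_eq_iff)
  next
    case (Suc k)
    then show ?case using i by (simp add: single_apply P_mult fun_eq_iff funpow_swap1)
  qed
qed

lemma component_group_hom: "1 \<le> i \<Longrightarrow> group_hom P (Alt (W i)) (\<lambda>p. p i)"
  using P_component P_mult group_P group_Om
  by (auto simp: group_hom_def group_hom_axioms_def hom_def simp del: mem_carrier_Alt)

text \<open>
  The first factor is adjoined by a Goursat argument: the generators are multiplied by generators
  of the first alternating group, whose cycle has smaller order than the one at level two. A power
  therefore gives a non-trivial spread element at level two, and its normal closure under \<open>tele 2\<close>,
  onto which the generated group projects, is \<open>tele 2\<close>.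
\<close>

theorem tele_1_generated_by_two: "\<exists>u\<in>tele 1. \<exists>v\<in>tele 1. generate P {u, v} = tele 1"
proof -
  have n: "(1::nat) \<le> 1" "(1::nat) \<le> 2" by auto
  have sub1: "subgroup (tele 1) P" by (rule tele_subgroup[OF n(1)])
  have sub2: "subgroup (tele 2) P" by (rule tele_subgroup[OF n(2)])
  have t21: "tele 2 \<subseteq> tele 1" by (rule tele_antimono) auto
  show ?thesis
  proof (rule tele_2_generators, rule Alt_generated_by_three_cycle[OF finite_W card_W_ge[OF n(1)]])
    fix \<alpha> z \<alpha>1 \<beta>1 m
    assume \<alpha>: "\<alpha> \<in> Om 2" "\<And>k. 0 < k \<Longrightarrow> k < d * d - 1 \<Longrightarrow> \<alpha> ^^ k \<noteq> id"
      and z: "z \<in> tele 2" and gen2: "generate P {spread 2 \<alpha>, z} = tele 2"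
      and ab: "\<alpha>1 \<in> Om 1" "\<beta>1 \<in> Om 1" and m: "odd m" "m \<le> card (W 1)" "\<alpha>1 ^^ m = id"
      and gen1: "\<And>K. subgroup K (Alt (W 1)) \<Longrightarrow> \<alpha>1 \<in> K \<Longrightarrow> \<beta>1 \<in> K \<Longrightarrow> K = Om 1"
    define u where "u = single 1 \<alpha>1 \<cdot> spread 2 \<alpha>"
    define v where "v = single 1 \<beta>1 \<cdot> z"
    define H where "H = generate P {u, v}"
    have cl: "single 1 \<alpha>1 \<in> carrier P" "single 1 \<beta>1 \<in> carrier P" "spread 2 \<alpha> \<in> carrier P" "z \<in> carrier P"
      using ab single_closed spread_closed[OF \<alpha>(1)] tele_closed[OF n(2) z] by auto
    have z1: "z 1 = id" using tele_trivial[OF z] by simp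
    have s1: "spread 2 \<alpha> 1 = id" by (simp add: spread_apply)
    have uv: "u \<in> tele 1" "v \<in> tele 1"
      unfolding u_def v_def using subgroup.m_closed[OF sub1] single_in_tele ab t21 z spread_in_tele[OF \<alpha>(1)] by auto
    have H: "subgroup H P"
      unfolding H_def by (rule P.generate_is_subgroup) (use uv tele_closed[OF n(1)] in auto)
    have uvH: "u \<in> H" "v \<in> H" unfolding H_def by (auto intro: generate.incl)
    have Hsub: "H \<subseteq> tele 1" unfolding H_def by (rule P.generate_subgroup_incl[OF _ sub1]) (use uv in auto)
    have Hc: "p \<in> carrier P" if "p \<in> H" for p using subgroup.mem_carrier[OF H that] .
    note Hcl = subgroup.m_closed[OF H] subgroup.m_inv_closed[OF H]
    have eu: "erase 1 u = spread 2 \<alpha>" "erase 1 v = z"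
      using cl z1 s1 by (auto intro!: P_eqI erase_closed simp: erase_apply P_mult single_apply u_def v_def le_eq_less_or_eq)
    have "tele 2 \<subseteq> erase 1 ` H"
      unfolding gen2[symmetric]
      by (rule P.generate_subgroup_incl[OF _ group_hom.subgroup_img_is_subgroup[OF erase_group_hom H]])
         (use uvH eu in \<open>metis empty_subsetI imageI insert_subset\<close>)
    then have lift: "\<exists>p\<in>H. erase 1 p = q" if "q \<in> tele 2" for q using that by blast
    have im1: "(\<lambda>p. p 1) ` H = Om 1"
    proof (rule gen1[OF group_hom.subgroup_img_is_subgroup[OF component_group_hom[OF n(1)] H]])
      have "u 1 = \<alpha>1" "v 1 = \<beta>1" using z1 s1 by (simp_all add: u_def v_def P_mult single_apply)
      then show "\<alpha>1 \<in> (\<lambda>p. p 1) ` H" "\<beta>1 \<in> (\<lambda>p. p 1) ` H" using uvH by force+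
    qed
    have lift1: "\<exists>p\<in>H. p 1 = c" if "c \<in> Om 1" for c
    proof -
      have "c \<in> (\<lambda>p. p 1) ` H" unfolding im1 by (rule that)
      then show ?thesis by (auto simp del: One_nat_def)
    qed
    have "u [^]\<^bsub>P\<^esub> m = single 1 \<alpha>1 [^]\<^bsub>P\<^esub> m \<cdot> spread 2 \<alpha> [^]\<^bsub>P\<^esub> m"
      unfolding u_def by (rule P.pow_mult_distrib[OF single_commute[OF ab(1) cl(3) s1] cl(1,3)])
    also have "single 1 \<alpha>1 [^]\<^bsub>P\<^esub> m = \<one>\<^bsub>P\<^esub>"
      unfolding single_pow[OF ab(1) n(1)] m(3)
      by (rule P_eqI) (use single_closed[OF id_Om] in \<open>auto simp: single_apply P_one\<close>)
    finally have um: "u [^]\<^bsub>P\<^esub> m = spread 2 (\<alpha> ^^ m)"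
      using P.l_one[OF P.nat_pow_closed[OF cl(3)], of m] spread_pow[OF \<alpha>(1)] by simp
    have tele2: "tele 2 \<subseteq> H \<inter> tele 2"
    proof (rule tele_subset_of_nontrivial)
      show "subgroup (H \<inter> tele 2) P" by (rule P.subgroups_Inter_pair[OF H tele_subgroup[OF n(2)]])
      show "\<alpha> ^^ m \<in> Om 2" by (rule Alt_subgroup_funpow[OF group.subgroup_self[OF group_Om] finite_W \<alpha>(1)])
      then show "spread 2 (\<alpha> ^^ m) \<in> H \<inter> tele 2"
        using subgroup_nat_pow[OF H uvH(1), of m] um spread_in_tele by simp
      have "0 < m" using m(1) by (rule odd_pos)
      moreover have "m < d * d - 1"
      proof -
        have "5 * d \<le> d * d" using d_ge by simp
        moreover have "m \<le> d" using m(2) card_W[of 1] by simp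
        ultimately show ?thesis using d_ge by linarith
      qed
      ultimately show "\<alpha> ^^ m \<noteq> id" by (rule \<alpha>(2))
      fix q \<nu> assume q: "q \<in> tele 2" and \<nu>: "\<nu> \<in> H \<inter> tele 2"
      obtain p where p: "p \<in> H" "erase 1 p = q" using lift[OF q] by blast
      have qc: "q \<in> carrier P" "\<nu> \<in> carrier P" using q \<nu> tele_closed[OF n(2)] by auto
      have "q \<cdot> \<nu> \<cdot> inv\<^bsub>P\<^esub> q = p \<cdot> \<nu> \<cdot> inv\<^bsub>P\<^esub> p"
      proof (rule P_eqI)
        fix i :: nat assume i: "1 \<le> i"
        show "(q \<cdot> \<nu> \<cdot> inv\<^bsub>P\<^esub> q) i = (p \<cdot> \<nu> \<cdot> inv\<^bsub>P\<^esub> p) i"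
        proof (cases "i = 1")
          case True
          have "\<nu> 1 = id" "q 1 = id" using tele_trivial[of _ 2 1] \<nu> q by auto
          then show ?thesis
            using True permutes_inv_o(1)[OF P_permutes[OF Hc[OF p(1)] n(1)]] qc Hc[OF p(1)]
            by (simp add: P_mult P_inv)
        next
          case False
          then have "q i = p i" using p(2) i erase_apply[OF i, of 1 p] by simp
          then show ?thesis using i qc Hc[OF p(1)] by (simp add: P_mult P_inv)
        qed
      qed (use qc Hc[OF p(1)] in auto)
      moreover have "p \<cdot> \<nu> \<cdot> inv\<^bsub>P\<^esub> p \<in> H"
        using Hcl p(1) \<nu> by blast
      moreover have "q \<cdot> \<nu> \<cdot> inv\<^bsub>P\<^esub> q \<in> tele 2"
        using subgroup.m_closed[OF sub2] subgroup.m_inv_closed[OF sub2] q \<nu> by blast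
      ultimately show "q \<cdot> \<nu> \<cdot> inv\<^bsub>P\<^esub> q \<in> H \<inter> tele 2" by simp
    qed simp
    have singleH: "single 1 c \<in> H" if c: "c \<in> Om 1" for c
    proof -
      obtain p where p: "p \<in> H" "p 1 = c" using lift1[OF c] by blast
      have e: "erase 1 p \<in> H"
        using erase_tele[OF n(1), of p] p(1) Hsub tele2 by (auto simp: numeral_2_eq_2)
      have "single 1 c = p \<cdot> inv\<^bsub>P\<^esub> (erase 1 p)"
      proof (rule P_eqI)
        fix i :: nat assume i: "1 \<le> i"
        show "single 1 c i = (p \<cdot> inv\<^bsub>P\<^esub> (erase 1 p)) i"
          using i permutes_inv_o(1)[OF P_permutes[OF Hc[OF p(1)] i]] p(2) P_inv[OF Hc[OF e] i]
          by (auto simp: P_mult single_apply erase_apply)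
      qed (use single_closed[OF c] Hc[OF p(1)] Hc[OF e] in auto)
      then show ?thesis using Hcl p(1) e by simp
    qed
    have "tele 1 \<subseteq> H"
    proof (rule tele_least[OF H])
      fix \<omega> assume o: "\<omega> \<in> Om 1"
      have "\<iota> X 1 2 \<omega> \<in> Om 2" by (rule iota_Om[OF o]) simp
      then show "spread 1 \<omega> \<in> H"
        using spread_eq_single_mult[OF o n(1)] singleH[OF o] spread_in_tele[of "\<iota> X 1 2 \<omega>" 2] tele2 Hcl(1)
        by (auto simp: numeral_2_eq_2)
    next
      fix g assume g: "g \<in> B"
      have "phi x d 2 g \<in> Om 2" by (rule phi_Om[OF g]) simp
      then show "directed 1 g \<in> H"
        using directed_split[OF g n(1)] spread_in_tele[of "phi x d 2 g" 2] directed_in_tele[OF g, of 2] tele2 Hcl(1)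
        by (auto simp: numeral_2_eq_2)
    qed
    then have "generate P {u, v} = tele 1" using Hsub by (auto simp: H_def)
    then show ?thesis using uv by blast
  qed
qed

section \<open>The group of the telescope\<close>

lemma Delta_eq_spread: "\<Delta>\<^sub>1 x d \<omega> = spread 1 \<omega>"
  by (auto simp: \<Delta>\<^sub>1_def spread_def X_def fun_eq_iff)

lemma tilde_eq_directed: "tilde x d g = directed 1 g"
proof
  fix i
  have "(\<otimes>\<^bsub>Alt S\<^esub>) = (\<circ>)" for S :: "'a list set" by (simp add: Alt_def)
  then show "tilde x d g i = directed 1 g i"
    by (cases "1 \<le> i") (auto simp: tilde_def directed_def Omega_eq X_def numeral_2_eq_2)
qed

lemma telescope_group_eq: "telescope_group x d r = tele 1"
  unfolding telescope_group_def tele_def Delta_eq_spread tilde_eq_directed P_def Omega_eq base_group_eq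
  by simp

lemma telescope_congruence: "congruence_subgroup (\<Omega> x d) (tele 1)"
proof (rule congruence_subgroup.intro)
  show "Group.group (\<Omega> x d n)" if "1 \<le> n" for n
    unfolding Omega_eq by (rule group_Om)
  show "finite (carrier (\<Omega> x d n))" if "1 \<le> n" for n
    unfolding Omega_eq by (rule finite_carrier_Alt[OF finite_W])
  show "subgroup (tele 1) (full_product (\<Omega> x d))"
    using tele_subgroup[of 1] by (simp add: P_def)
  show "carrier (sum_group {1..} (\<Omega> x d)) \<subseteq> tele 1"
  proof
    fix p assume p: "p \<in> carrier (sum_group {1..} (\<Omega> x d))"
    have sum: "carrier (sum_group {1..} (\<Omega> x d)) =
        {p \<in> \<Pi>\<^sub>E i\<in>{1..}. carrier (\<Omega> x d i). finite {i \<in> {1..}. p i \<noteq> \<one>\<^bsub>\<Omega> x d i\<^esub>}}"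
      by (rule carrier_sum_group) (simp only: Omega_eq group_Om)
    have pc: "p \<in> carrier P" using p unfolding sum by (simp add: P_def)
    have fin: "finite {i \<in> {1..}. p i \<noteq> id}" using p unfolding sum by (simp add: Omega_eq)
    have "p i = id" if "Max (insert 0 {i \<in> {1..}. p i \<noteq> id}) < i" for i
    proof (rule ccontr)
      assume "p i \<noteq> id"
      then have "i \<le> Max (insert 0 {i \<in> {1..}. p i \<noteq> id})"
        using fin that by (intro Max_ge) auto
      then show False using that by simp
    qed
    then show "p \<in> tele 1" by (rule finite_support_in_tele[OF pc])
  qed
  fix N assume "N \<in> finite_index_normal ((full_product (\<Omega> x d))\<lparr>carrier := tele 1\<rparr>)"
  then obtain n where n: "tele (Suc n) \<subseteq> N"
    using tele_subset_of_finite_index unfolding P_def by blast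
  have "h \<in> N" if h: "h \<in> tele 1" "\<forall>i\<in>{1..n}. h i = \<one>\<^bsub>\<Omega> x d i\<^esub>" for h
  proof -
    have "h \<in> tele (Suc n)"
      by (rule level_kernel_subset_tele[OF h(1)]) (use h(2) in \<open>simp add: Omega_eq\<close>)
    then show ?thesis using n by blast
  qed
  then show "\<exists>n. \<forall>h\<in>tele 1. (\<forall>i\<in>{1..n}. h i = \<one>\<^bsub>\<Omega> x d i\<^esub>) \<longrightarrow> h \<in> N" by blast
qed

end

theorem theorem3p11:
  fixes x :: "nat \<Rightarrow> 'a" and d r :: nat
  assumes "d \<ge> 5" and "2 \<le> r" and "r \<le> d - 3"
    and "inj_on x {1..d}"
  shows "(\<exists>a\<in>telescope_group x d r. \<exists>b\<in>telescope_group x d r.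
            generate (full_product (\<Omega> x d)) {a, b} = telescope_group x d r)
       \<and> frame_in (\<lambda>l. Alt (words (x ` {1..d}) l)) (telescope_group x d r)
       \<and> full_product (\<lambda>l. Alt (words (x ` {1..d}) l)) \<cong> full_product (\<lambda>l. alt_group (d ^ l))"
proof (intro conjI)
  interpret telescope x d r by unfold_locales (fact assms)+
  have Omega: "(\<lambda>l. Alt (words (x ` {1..d}) l)) = \<Omega> x d"
    by (simp add: \<Omega>_def fun_eq_iff)
  show two: "\<exists>a\<in>telescope_group x d r. \<exists>b\<in>telescope_group x d r.
      generate (full_product (\<Omega> x d)) {a, b} = telescope_group x d r"
    using tele_1_generated_by_two unfolding telescope_group_eq P_def .
  then show "frame_in (\<lambda>l. Alt (words (x ` {1..d}) l)) (telescope_group x d r)"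
    using congruence_subgroup.frame_in_of_congruence[OF telescope_congruence]
    unfolding Omega telescope_group_eq by (metis empty_subsetI finite.emptyI finite.insertI insert_subset)
  show "full_product (\<lambda>l. Alt (words (x ` {1..d}) l)) \<cong> full_product (\<lambda>l. alt_group (d ^ l))"
  proof (rule iso_product_groupI)
    fix l :: nat
    show "Alt (words (x ` {1..d}) l) \<cong> alt_group (d ^ l)"
      using Alt_iso_alt_group[OF finite_W, of l] card_W[of l] by (simp add: X_def)
    show "Group.group (Alt (words (x ` {1..d}) l))"
      using group_Om[of l] by (simp add: X_def)
    show "Group.group (alt_group (d ^ l))" by (rule alt_group_is_group)
  qed
qed

end
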